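(* Let $n\ge1$ be an integer, $k>0$, and let $u\in L^2(\mathbb{R}^n)\cap\mathcal{D}^0(\mathbb{R}^n)$ be a nonnegative function with $u^2\ln u\in L^1(\mathbb{R}^n)$ satisfying $$\mathcal{L}_\Delta u=k\,u\ln u,\qquad u\ge0\quad\text{in }\mathbb{R}^n.$$ If $k\ne\frac4n$, then $u\equiv0$ in $\mathbb{R}^n$.
   Context: The logarithmic Laplacian in $\mathbb{R}^n$ is $$\mathcal{L}_\Delta u(x)=c_n\int_{\mathbb{R}^n}\frac{u(x)1_{B_1(x)}(y)-u(y)}{|x-y|^n}\,dy+\rho_n u(x),\qquad c_n=\pi^{-n/2}\Gamma(n/2),\quad \rho_n=2\ln2+\psi(\tfrac n2)-\gamma,$$ where $B_1(x)$ is the unit ball centered at $x$, $\psi=\Gamma'/\Gamma$ is the digamma function and $\gamma=-\Gamma'(1)$. The functions $t\ln t$ and $t^2\ln t$ on $[0,\infty)$ take the value $0$ at $t=0$. A function $u$ is Dini continuous at $x$ if $\int_0^1\frac{\varpi_{u,x}(r)}{r}dr<\infty$, where $\varpi_{u,x}(r)=\sup_{y\in\mathbb{R}^n,\,|y-x|\le r}|u(y)-u(x)|$. $\mathcal{D}^0(\mathbb{R}^n)$ is the set of functions that are Dini continuous at every $x\in\mathbb{R}^n$. The equation is satisfied pointwise. *)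

theory Defs
  imports "HOL-Analysis.Analysis"
begin

definition log_lap_c :: "nat \<Rightarrow> real" where
  "log_lap_c n = pi powr (- (real n / 2)) * Gamma (real n / 2)"

definition log_lap_rho :: "nat \<Rightarrow> real" where
  "log_lap_rho n = 2 * ln 2 + Digamma (real n / 2) - euler_mascheroni"

(* The conventions psi = Gamma'/Gamma and gamma = - Gamma'(1) agree with the library constants. *)
lemma Digamma_eq_deriv_Gamma:
  fixes x :: real
  assumes "x > 0"
  shows "Digamma x = deriv Gamma x / Gamma x"
proof -
  have nz: "x \<notin> \<int>\<^sub>\<le>\<^sub>0"
    using assms by (auto elim!: nonpos_Ints_cases)
  have "deriv Gamma x = Gamma x * Digamma x"
    by (rule DERIV_imp_deriv) (rule has_field_derivative_Gamma[OF nz])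
  then show ?thesis
    using Gamma_real_pos[OF assms] by simp
qed

lemma euler_mascheroni_eq_deriv_Gamma:
  "(euler_mascheroni :: real) = - deriv Gamma 1"
  using Digamma_eq_deriv_Gamma[of 1] by simp

(* For x = y the quotient is 0 by convention; this affects only a null set. *)
definition log_laplacian :: "('a::euclidean_space \<Rightarrow> real) \<Rightarrow> 'a \<Rightarrow> real" where
  "log_laplacian u x =
     log_lap_c DIM('a) *
       (LINT y|lebesgue. (u x * indicator (ball x 1) y - u y) / norm (x - y) ^ DIM('a))
     + log_lap_rho DIM('a) * u x"

(* The modulus takes values in [0,infinity], since u need not be bounded near x a priori. *)
definition continuity_modulus :: "('a::euclidean_space \<Rightarrow> real) \<Rightarrow> 'a \<Rightarrow> real \<Rightarrow> ennreal" where
  "continuity_modulus u x r = (SUP y\<in>cball x r. ennreal \<bar>u y - u x\<bar>)"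

definition dini_continuous_at :: "('a::euclidean_space \<Rightarrow> real) \<Rightarrow> 'a \<Rightarrow> bool" where
  "dini_continuous_at u x \<longleftrightarrow>
     (\<integral>\<^sup>+r\<in>{0<..<1}. (continuity_modulus u x r / ennreal r) \<partial>lborel) < \<infinity>"

definition dini_functions :: "('a::euclidean_space \<Rightarrow> real) set" where
  "dini_functions = {u. \<forall>x. dini_continuous_at u x}"

definition L2_functions :: "('a::euclidean_space \<Rightarrow> real) set" where
  "L2_functions = {u. u \<in> borel_measurable lebesgue \<and> integrable lebesgue (\<lambda>x. (u x)\<^sup>2)}"

end

theory Submission
  imports Defs
begin

text \<open>
  Let \<open>L\<close> be the operator, \<open>n\<close> the dimension and \<open>c\<close> the constant in front of the integral.
  Split \<open>|z|^(-n) = p(z) + q(z)\<close> with \<open>q(z) = min 1 (|z|^(-n))\<close> and \<open>p\<close> supported in the unit ball;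
  then \<open>L\<close> comes from the quadratic form \<open>E(u,v)\<close> with density
  \<open>c p(x-y) (u(x)-u(y)) (v(x)-v(y)) / 2 - c q(x-y) u(y) v(x)\<close> plus a multiple of \<open>u v\<close>.

  Regularity: maximizing a localized quotient \<open>(u(x) - u(y)) / |x-y|^(3/4)\<close> over pairs at distance at least
  \<open>\<epsilon>\<close>, the kernel gains a factor \<open>ln (1/|x-y|)\<close> at a maximal pair, while \<open>t ln t\<close> is convex, so that the
  right hand side grows at most linearly in \<open>u(x) - u(y)\<close>. Hence \<open>u\<close> is locally Hoelder continuous of
  exponent \<open>3/4 > 1/2\<close>. Since \<open>u\<^sup>2 ln u\<close> is integrable, the far part of the energy is finite, and testing the
  equation with truncations of \<open>u\<close> shows that the near part is finite and \<open>E(u,u) = k \<integral> u\<^sup>2 ln u\<close>.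

  Pohozaev argument: deform \<open>u\<close> by \<open>x \<mapsto> x + t g(x) e\<close>, where \<open>g(x)\<close> is a compactly supported cutoff of \<open>x \<bullet> e\<close>.
  By the equation and the Hoelder bound \<open>E(u,u) - 2 k \<integral> \<Psi>(u)\<close>, with \<open>\<Psi>'(s) = s ln s\<close>, changes only by \<open>o(t)\<close>,
  whereas a change of variables moves the deformation to the kernels, where the derivative in \<open>t\<close> is explicit.
  Removing the cutoff and summing over the coordinate directions \<open>e\<close> gives
  \<open>c n |B\<^sub>1| \<integral> u\<^sup>2 = (k n / 2) \<integral> u\<^sup>2\<close>, and \<open>c n |B\<^sub>1| = 2\<close>.
\<close>

section \<open>Radial integrals\<close>

lemma distr_norm_lborel:
  "distr (lborel :: 'a::euclidean_space measure) borel norm =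
   density lborel (\<lambda>r. indicator {0..} r * ennreal (real DIM('a) * unit_ball_vol DIM('a) * r ^ (DIM('a) - 1)))"
  (is "?M = ?N")
proof (rule measure_eqI_generator_eq_countable)
  let ?LT = "\<lambda>a::real. {..a}" let ?E = "range ?LT"
  show "Int_stable ?E"
    by (auto simp: Int_stable_def)
  show "?E \<subseteq> Pow UNIV" "sets ?M = sigma_sets UNIV ?E" "sets ?N = sigma_sets UNIV ?E"
    by (auto simp: borel_eq_atMost)
  have M: "emeasure ?M {..a} = (if a \<ge> 0 then ennreal (unit_ball_vol DIM('a) * a ^ DIM('a)) else 0)" for a
  proof -
    have "emeasure ?M {..a} = emeasure lborel {x::'a. norm x \<le> a}"
      by (subst emeasure_distr) (auto intro!: arg_cong[where f="emeasure lborel"])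
    also have "{x::'a. norm x \<le> a} = cball 0 a"
      by auto
    finally show ?thesis
      by (auto simp: emeasure_cball)
  qed
  have N: "emeasure ?N {..a} = (if a \<ge> 0 then ennreal (unit_ball_vol DIM('a) * a ^ DIM('a)) else 0)" for a
  proof (cases "a \<ge> 0")
    case True
    have "emeasure ?N {..a} = (\<integral>\<^sup>+r. ennreal (real DIM('a) * unit_ball_vol DIM('a) * r ^ (DIM('a) - 1)) * indicator {0..a} r \<partial>lborel)"
      by (subst emeasure_density) (auto intro!: nn_integral_cong split: split_indicator)
    also have "\<dots> = ennreal (unit_ball_vol DIM('a) * a ^ DIM('a) - unit_ball_vol DIM('a) * 0 ^ DIM('a))"
      using True by (intro nn_integral_FTC_Icc) (auto intro!: derivative_eq_intros)
    finally show ?thesis using True by simp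
  next
    case False
    then have "indicator {0..} r * ennreal (real DIM('a) * unit_ball_vol DIM('a) * r ^ (DIM('a) - 1)) * indicator {..a} r = 0" for r
      by (auto split: split_indicator)
    then have "emeasure ?N {..a} = 0"
      by (subst emeasure_density) (simp_all only: nn_integral_const mult_zero_left, auto)
    then show ?thesis using False by simp
  qed
  show "\<And>X. X \<in> ?E \<Longrightarrow> emeasure ?M X = emeasure ?N X"
    using M N by auto
  show "?LT ` \<int> \<subseteq> ?E" by auto
  show "(\<Union>i\<in>\<int>. ?LT i) = UNIV"
    using Ints_of_int le_of_int_ceiling by blast
  show "\<And>a. a \<in> ?LT ` \<int> \<Longrightarrow> emeasure ?M a \<noteq> \<infinity>"
    by (auto simp: M split: if_splits)
  show "countable (?LT ` \<int>)"
    by (auto simp: Ints_def)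
qed

lemma nn_integral_radial:
  assumes [measurable]: "h \<in> borel_measurable borel"
  shows "(\<integral>\<^sup>+z. h (norm (z::'a::euclidean_space)) \<partial>lborel) =
    (\<integral>\<^sup>+r. indicator {0<..} r * ennreal (real DIM('a) * unit_ball_vol DIM('a) * r ^ (DIM('a) - 1)) * h r \<partial>lborel)"
proof -
  have "(\<integral>\<^sup>+z. h (norm (z::'a)) \<partial>lborel) = (\<integral>\<^sup>+r. h r \<partial>distr (lborel :: 'a measure) borel norm)"
    by (subst nn_integral_distr) auto
  also have "\<dots> = (\<integral>\<^sup>+r. indicator {0..} r * ennreal (real DIM('a) * unit_ball_vol DIM('a) * r ^ (DIM('a) - 1)) * h r \<partial>lborel)"
    unfolding distr_norm_lborel by (subst nn_integral_density) auto
  also have "\<dots> = (\<integral>\<^sup>+r. indicator {0<..} r * ennreal (real DIM('a) * unit_ball_vol DIM('a) * r ^ (DIM('a) - 1)) * h r \<partial>lborel)"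
    by (intro nn_integral_cong_AE AE_I[where N="{0}"]) (auto split: split_indicator)
  finally show ?thesis .
qed

lemma nn_integral_radial_divide:
  fixes h :: "real \<Rightarrow> real"
  assumes [measurable]: "h \<in> borel_measurable borel"
  shows "(\<integral>\<^sup>+z. ennreal (h (norm (z::'a::euclidean_space)) / norm z ^ DIM('a)) \<partial>lborel) =
    ennreal (real DIM('a) * unit_ball_vol DIM('a)) * (\<integral>\<^sup>+r. indicator {0<..} r * ennreal (h r / r) \<partial>lborel)"
proof -
  have D: "DIM('a) = Suc (DIM('a) - 1)"
    using DIM_positive[where 'a='a] by linarith
  have "(\<integral>\<^sup>+z. ennreal (h (norm (z::'a)) / norm z ^ DIM('a)) \<partial>lborel) =
    (\<integral>\<^sup>+r. indicator {0<..} r * ennreal (real DIM('a) * unit_ball_vol DIM('a) * r ^ (DIM('a) - 1)) * ennreal (h r / r ^ DIM('a)) \<partial>lborel)"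
    by (rule nn_integral_radial[where h="\<lambda>r. ennreal (h r / r ^ DIM('a))"]) auto
  also have "\<dots> = (\<integral>\<^sup>+r. ennreal (real DIM('a) * unit_ball_vol DIM('a)) * (indicator {0<..} r * ennreal (h r / r)) \<partial>lborel)"
  proof (rule nn_integral_cong)
    fix r :: real
    show "indicator {0<..} r * ennreal (real DIM('a) * unit_ball_vol DIM('a) * r ^ (DIM('a) - 1)) * ennreal (h r / r ^ DIM('a))
      = ennreal (real DIM('a) * unit_ball_vol DIM('a)) * (indicator {0<..} r * ennreal (h r / r))"
    proof (cases "r > 0")
      case True
      have "r ^ DIM('a) = r * r ^ (DIM('a) - 1)"
        using D by (metis power_Suc)
      then have "real DIM('a) * unit_ball_vol DIM('a) * r ^ (DIM('a) - 1) * (h r / r ^ DIM('a))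
        = real DIM('a) * unit_ball_vol DIM('a) * (h r / r)"
        using True by simp
      then show ?thesis
        using True by (simp add: ennreal_mult'[symmetric])
    qed auto
  qed
  also have "\<dots> = ennreal (real DIM('a) * unit_ball_vol DIM('a)) * (\<integral>\<^sup>+r. indicator {0<..} r * ennreal (h r / r) \<partial>lborel)"
    by (rule nn_integral_cmult) auto
  finally show ?thesis .
qed

definition surf :: "nat \<Rightarrow> real" where
  "surf n = real n * unit_ball_vol n"

lemma surf_pos: "n > 0 \<Longrightarrow> surf n > 0"
  by (simp add: surf_def)

lemma surf_DIM_pos [simp]: "surf DIM('a::euclidean_space) > 0"
  by (rule surf_pos) simp

lemma surf_DIM_nonneg [simp]: "surf DIM('a::euclidean_space) \<ge> 0"
  by (rule less_imp_le) simp

lemma has_bochner_integral_radial: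
  fixes h :: "real \<Rightarrow> real"
  assumes [measurable]: "h \<in> borel_measurable borel"
    and h: "\<And>r. h r \<ge> 0" and v: "v \<ge> 0"
    and I: "(\<integral>\<^sup>+r. indicator {0<..} r * ennreal (h r / r) \<partial>lborel) = ennreal v"
  shows "has_bochner_integral lborel (\<lambda>z::'a::euclidean_space. h (norm z) / norm z ^ DIM('a)) (surf DIM('a) * v)"
proof (rule has_bochner_integral_nn_integral)
  show "(\<integral>\<^sup>+z. ennreal (h (norm (z::'a)) / norm z ^ DIM('a)) \<partial>lborel) = ennreal (surf DIM('a) * v)"
    by (subst nn_integral_radial_divide) (use v in \<open>simp_all add: I surf_def ennreal_mult\<close>)
  show "0 \<le> surf DIM('a) * v"
    using v surf_DIM_pos[where 'a='a] by (simp add: less_imp_le)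
qed (use h in auto)

lemma has_bochner_integral_powr_ball:
  fixes a \<beta> :: real
  assumes "\<beta> > 0" "a \<ge> 0"
  shows "has_bochner_integral lborel
    (\<lambda>z::'a::euclidean_space. indicator (ball 0 a) z * (norm z powr \<beta> / norm z ^ DIM('a)))
    (surf DIM('a) * (a powr \<beta> / \<beta>))"
proof -
  have "((\<lambda>x. x powr (\<beta> - 1)) has_integral (a powr (\<beta> - 1 + 1) / (\<beta> - 1 + 1))) {0..a}"
    using assms by (intro has_integral_powr_from_0) auto
  then have I: "((\<lambda>x. if x \<in> {0..a} then x powr (\<beta> - 1) else 0) has_integral (a powr \<beta> / \<beta>)) UNIV"
    by (subst has_integral_restrict_UNIV) simp
  have "(\<integral>\<^sup>+x. ennreal (if x \<in> {0..a} then x powr (\<beta> - 1) else 0) \<partial>lborel) = ennreal (a powr \<beta> / \<beta>)"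
    by (rule nn_integral_has_integral_lborel[OF _ _ I]) auto
  also have "(\<integral>\<^sup>+x. ennreal (if x \<in> {0..a} then x powr (\<beta> - 1) else 0) \<partial>lborel) =
    (\<integral>\<^sup>+r. indicator {0<..} r * ennreal ((indicator {..<a} r * r powr \<beta>) / r) \<partial>lborel)"
    by (intro nn_integral_cong_AE AE_I[where N="{0, a}"])
      (auto simp: powr_diff split: split_indicator intro!: emeasure_lborel_countable)
  finally have "has_bochner_integral lborel
    (\<lambda>z::'a. (indicator {..<a} (norm z) * norm z powr \<beta>) / norm z ^ DIM('a)) (surf DIM('a) * (a powr \<beta> / \<beta>))"
    using assms by (intro has_bochner_integral_radial) auto
  then show ?thesis
    by (rule has_bochner_integral_cong[THEN iffD1, rotated -1]) (auto split: split_indicator)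
qed

lemma has_bochner_integral_powr_outside:
  fixes a \<gamma> :: real
  assumes "\<gamma> > 0" "a > 0"
  shows "has_bochner_integral lborel
    (\<lambda>z::'a::euclidean_space. indicator {z. a \<le> norm z} z * (norm z powr (-\<gamma>) / norm z ^ DIM('a)))
    (surf DIM('a) * (a powr (-\<gamma>) / \<gamma>))"
proof -
  have "((\<lambda>x. x powr (-\<gamma> - 1)) has_integral -(a powr (-\<gamma> - 1 + 1)) / (-\<gamma> - 1 + 1)) {a..}"
    using assms by (intro has_integral_powr_to_inf) auto
  then have I: "((\<lambda>x. if x \<in> {a..} then x powr (-\<gamma> - 1) else 0) has_integral (a powr (-\<gamma>) / \<gamma>)) UNIV"
    by (subst has_integral_restrict_UNIV) simp
  have "(\<integral>\<^sup>+x. ennreal (if x \<in> {a..} then x powr (-\<gamma> - 1) else 0) \<partial>lborel) = ennreal (a powr (-\<gamma>) / \<gamma>)"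
    by (rule nn_integral_has_integral_lborel[OF _ _ I]) auto
  also have "(\<integral>\<^sup>+x. ennreal (if x \<in> {a..} then x powr (-\<gamma> - 1) else 0) \<partial>lborel) =
    (\<integral>\<^sup>+r. indicator {0<..} r * ennreal ((indicator {a..} r * r powr (-\<gamma>)) / r) \<partial>lborel)"
    using assms by (intro nn_integral_cong) (auto simp: powr_diff split: split_indicator)
  finally have "has_bochner_integral lborel
    (\<lambda>z::'a. (indicator {a..} (norm z) * norm z powr (-\<gamma>)) / norm z ^ DIM('a)) (surf DIM('a) * (a powr (-\<gamma>) / \<gamma>))"
    using assms by (intro has_bochner_integral_radial) auto
  then show ?thesis
    by (rule has_bochner_integral_cong[THEN iffD1, rotated -1]) (auto split: split_indicator)
qed

lemma has_bochner_integral_inverse_annulus: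
  fixes a b :: real
  assumes "0 < a" "a \<le> b"
  shows "has_bochner_integral lborel
    (\<lambda>z::'a::euclidean_space. indicator {z. a \<le> norm z \<and> norm z \<le> b} z * (1 / norm z ^ DIM('a)))
    (surf DIM('a) * ln (b / a))"
proof -
  have "((\<lambda>x. inverse x) has_integral (ln b - ln a)) {a..b}"
    using assms by (intro fundamental_theorem_of_calculus)
      (auto intro!: derivative_eq_intros simp: field_simps simp flip: has_real_derivative_iff_has_vector_derivative)
  then have I: "((\<lambda>x. if x \<in> {a..b} then inverse x else 0) has_integral (ln b - ln a)) UNIV"
    by (subst has_integral_restrict_UNIV) simp
  have "(\<integral>\<^sup>+x. ennreal (if x \<in> {a..b} then inverse x else 0) \<partial>lborel) = ennreal (ln b - ln a)"
    using assms by (intro nn_integral_has_integral_lborel[OF _ _ I]) auto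
  also have "(\<integral>\<^sup>+x. ennreal (if x \<in> {a..b} then inverse x else 0) \<partial>lborel) =
    (\<integral>\<^sup>+r. indicator {0<..} r * ennreal (indicator {a..b} r / r) \<partial>lborel)"
    using assms by (intro nn_integral_cong) (auto simp: inverse_eq_divide split: split_indicator)
  finally have "has_bochner_integral lborel
    (\<lambda>z::'a. indicator {a..b} (norm z) / norm z ^ DIM('a)) (surf DIM('a) * (ln b - ln a))"
    using assms by (intro has_bochner_integral_radial) auto
  then have "has_bochner_integral lborel
    (\<lambda>z::'a::euclidean_space. indicator {z. a \<le> norm z \<and> norm z \<le> b} z * (1 / norm z ^ DIM('a)))
    (surf DIM('a) * (ln b - ln a))"
    by (rule has_bochner_integral_cong[THEN iffD1, rotated -1]) (auto split: split_indicator)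
  then show ?thesis
    using assms by (simp add: ln_div)
qed

section \<open>The kernels of the logarithmic Laplacian\<close>

text \<open>
  Since \<open>1 / 0 = 0\<close>, the value of \<open>near_ker\<close> at \<open>0\<close> is \<open>0\<close>, and \<open>1 / |z|^n = near_ker z + cut_ker 1 z\<close> fails there.
\<close>

definition near_ker :: "'a::euclidean_space \<Rightarrow> real" where
  "near_ker z = max 0 (1 / norm z ^ DIM('a) - 1)"

definition cut_ker :: "real \<Rightarrow> 'a::euclidean_space \<Rightarrow> real" where
  "cut_ker a z = 1 / max a (norm z) ^ DIM('a)"

lemma near_ker_measurable [measurable]: "near_ker \<in> borel_measurable borel"
  unfolding near_ker_def by measurable

lemma cut_ker_measurable [measurable]: "cut_ker a \<in> borel_measurable borel"
  unfolding cut_ker_def by measurable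

lemma near_ker_nonneg [simp]: "near_ker z \<ge> 0"
  by (simp add: near_ker_def)

lemma near_ker_minus_commute: "near_ker (x - y) = near_ker (y - x)"
  by (simp add: near_ker_def norm_minus_commute)

lemma cut_ker_minus_commute: "cut_ker a (x - y) = cut_ker a (y - x)"
  by (simp add: cut_ker_def norm_minus_commute)

lemma cut_ker_nonneg [simp]: "a \<ge> 0 \<Longrightarrow> cut_ker a z \<ge> 0"
  by (simp add: cut_ker_def le_max_iff_disj)

lemma near_ker_le: "near_ker z \<le> 1 / norm (z::'a::euclidean_space) ^ DIM('a)"
  by (simp add: near_ker_def)

lemma near_ker_eq_0:
  assumes "norm z \<ge> 1"
  shows "near_ker (z::'a::euclidean_space) = 0"
proof -
  have "1 / norm z ^ DIM('a) \<le> 1"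
    using one_le_power[OF assms, of "DIM('a)"] by (subst divide_le_eq_1) linarith
  then show ?thesis by (simp add: near_ker_def)
qed

lemma near_ker_inside:
  assumes "z \<noteq> 0" "norm z \<le> 1"
  shows "near_ker (z::'a::euclidean_space) = 1 / norm z ^ DIM('a) - 1"
proof -
  have "1 / norm z ^ DIM('a) \<ge> 1"
    using power_le_one[of "norm z" "DIM('a)"] assms by (simp add: le_divide_eq)
  then show ?thesis by (simp add: near_ker_def)
qed

lemma cut_ker_le_1: "cut_ker 1 z \<le> 1"
  using one_le_power[of "max 1 (norm z)" "DIM('a)"]
  by (simp add: cut_ker_def divide_le_eq)

lemma cut_ker_le: "z \<noteq> 0 \<Longrightarrow> cut_ker a (z::'a::euclidean_space) \<le> 1 / norm z ^ DIM('a)"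
  unfolding cut_ker_def by (intro divide_left_mono power_mono) (auto intro!: mult_pos_pos zero_less_power simp: less_max_iff_disj)

lemma cut_ker_inside: "norm z \<le> a \<Longrightarrow> cut_ker a (z::'a::euclidean_space) = 1 / a ^ DIM('a)"
  by (simp add: cut_ker_def max_def)

lemma cut_ker_outside: "norm z \<ge> a \<Longrightarrow> cut_ker a (z::'a::euclidean_space) = 1 / norm z ^ DIM('a)"
  by (simp add: cut_ker_def max_def)

lemma kernel_split:
  assumes "z \<noteq> 0"
  shows "1 / norm z ^ DIM('a) = near_ker z + cut_ker 1 (z::'a::euclidean_space)"
proof (cases "norm z \<le> 1")
  case True
  then show ?thesis using near_ker_inside[OF assms True] by (simp add: cut_ker_inside)
next
  case False
  then show ?thesis by (simp add: near_ker_eq_0 cut_ker_outside)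
qed

lemma integrable_cut_ker_powr:
  assumes "\<gamma> > 0"
  shows "integrable lborel (\<lambda>z::'a::euclidean_space. cut_ker 1 z * max 1 (norm z) powr (-\<gamma>))"
proof -
  have "integrable lborel (\<lambda>z::'a. indicator {z. 1 \<le> norm z} z * (norm z powr (-\<gamma>) / norm z ^ DIM('a)))"
    by (rule integrable.intros[OF has_bochner_integral_powr_outside[OF assms]]) simp
  moreover have "integrable lborel (\<lambda>z::'a. indicator (ball 0 1) z :: real)"
    by (intro integrable_real_indicator) (auto simp: emeasure_ball)
  ultimately have "integrable lborel (\<lambda>z::'a. indicator (ball 0 1) z + indicator {z. 1 \<le> norm z} z * (norm z powr (-\<gamma>) / norm z ^ DIM('a)))"
    by (rule Bochner_Integration.integrable_add[rotated])
  moreover have "indicator (ball 0 1) z + indicator {z. 1 \<le> norm z} z * (norm z powr (-\<gamma>) / norm z ^ DIM('a))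
     = cut_ker 1 z * max 1 (norm z) powr (-\<gamma>)" for z :: 'a
    by (auto simp: cut_ker_def max_def split: split_indicator)
  ultimately show ?thesis by simp
qed

lemma borel_measurable_mono_ennreal:
  fixes f :: "real \<Rightarrow> ennreal"
  assumes "mono f"
  shows "f \<in> borel_measurable borel"
proof (rule borel_measurableI_greater)
  fix c
  define S where "S = {x. c < f x}"
  have up: "y \<in> S" if "x \<in> S" "x \<le> y" for x y
    using that monoD[OF assms, of x y] by (auto simp: S_def intro: less_le_trans)
  have "S \<in> sets borel"
  proof (cases "S = {} \<or> \<not> bdd_below S")
    case True
    then have "S = {} \<or> S = UNIV"
      using up unfolding bdd_below_def by (metis (lifting) UNIV_eq_I linear)
    then show ?thesis by auto
  next
    case False
    then have lower: "Inf S \<le> x" if "x \<in> S" for x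
      using that by (simp add: cInf_lower)
    have upper: "x \<in> S" if "Inf S < x" for x
      using that up False by (meson cInf_less_iff less_imp_le)
    have "S = {Inf S<..} \<union> (if Inf S \<in> S then {Inf S} else {})"
    proof (intro set_eqI iffI)
      fix x assume "x \<in> S"
      then show "x \<in> {Inf S<..} \<union> (if Inf S \<in> S then {Inf S} else {})"
        using lower[of x] by (cases "x = Inf S") auto
    qed (use upper in \<open>auto split: if_splits\<close>)
    moreover have "{Inf S<..} \<union> (if Inf S \<in> S then {Inf S} else {}) \<in> sets borel"
      by simp
    ultimately show ?thesis by metis
  qed
  then show "{x \<in> space borel. c < f x} \<in> sets borel" by (simp add: S_def)
qed

lemma
  fixes u :: "'a::euclidean_space \<Rightarrow> real"
  assumes "dini_continuous_at u x"
  shows dini_continuous_at_imp_isCont: "isCont u x"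
    and dini_continuous_at_nn_integral:
      "(\<integral>\<^sup>+y. ennreal (near_ker (x - y) * \<bar>u x - u y\<bar>) \<partial>lborel) < \<infinity>"
proof -
  let ?m = "continuity_modulus u x"
  have mono: "?m r \<le> ?m s" if "r \<le> s" for r s
    unfolding continuity_modulus_def using that by (intro SUP_subset_mono) auto
  have m_ge: "ennreal \<bar>u y - u x\<bar> \<le> ?m r" if "dist x y \<le> r" for y r
    unfolding continuity_modulus_def using that by (intro SUP_upper) auto
  have [measurable]: "?m \<in> borel_measurable borel"
    by (rule borel_measurable_mono_ennreal) (auto simp: mono_def mono)
  have fin: "(\<integral>\<^sup>+r\<in>{0<..<1}. (?m r / ennreal r) \<partial>lborel) < \<infinity>"
    using assms by (simp add: dini_continuous_at_def)
  show "isCont u x"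
  proof (rule ccontr)
    assume "\<not> isCont u x"
    then obtain e where e: "e > 0" and far: "\<And>d. d > 0 \<Longrightarrow> \<exists>y. dist y x < d \<and> \<not> dist (u y) (u x) < e"
      unfolding continuous_at_eps_delta by (auto simp: dist_norm)
    have lower: "ennreal e \<le> ?m r" if r: "r > 0" for r
    proof -
      obtain y where "dist y x < r" "\<not> dist (u y) (u x) < e" using far[OF r] by blast
      then have "ennreal e \<le> ennreal \<bar>u y - u x\<bar>" "dist x y \<le> r"
        by (auto simp: dist_real_def dist_commute intro!: ennreal_leI)
      then show ?thesis using m_ge order_trans by blast
    qed
    have "ennreal (e * T) \<le> (\<integral>\<^sup>+r\<in>{0<..<1}. (?m r / ennreal r) \<partial>lborel)" if "T \<ge> 0" for T
    proof -
      have "(\<integral>\<^sup>+r. ennreal (e / r) * indicator {exp (-T - 1)..exp (-1)} r \<partial>lborel)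
          = ennreal (e * ln (exp (-1)) - e * ln (exp (-T - 1)))"
      proof (rule nn_integral_FTC_Icc)
        fix r :: real assume "r \<in> {exp (-T - 1)..exp (-1)}"
        then have "r > 0" using less_le_trans[OF exp_gt_zero] by auto
        then show "((\<lambda>r. e * ln r) has_real_derivative e / r) (at r)" "0 \<le> e / r"
          using e by (auto intro!: derivative_eq_intros)
      qed (use that in auto)
      then have "ennreal (e * T) = (\<integral>\<^sup>+r. ennreal (e / r) * indicator {exp (-T - 1)..exp (-1)} r \<partial>lborel)"
        by (simp add: algebra_simps)
      also have "\<dots> \<le> (\<integral>\<^sup>+r\<in>{0<..<1}. (?m r / ennreal r) \<partial>lborel)"
      proof (rule nn_integral_mono)
        fix r :: real
        show "ennreal (e / r) * indicator {exp (-T - 1)..exp (-1)} r \<le> ?m r / ennreal r * indicator {0<..<1} r"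
        proof (cases "r \<in> {exp (-T - 1)..exp (-1)}")
          case True
          then have r: "r > 0" "r < 1" using less_le_trans[OF exp_gt_zero] by (auto intro: le_less_trans)
          have "ennreal (e / r) = ennreal e / ennreal r"
            using e r by (simp add: divide_ennreal)
          also have "\<dots> \<le> ?m r / ennreal r"
            using lower[OF r(1)] by (rule divide_right_mono_ennreal)
          finally show ?thesis using r True by (simp split: split_indicator)
        qed simp
      qed
      finally show ?thesis .
    qed
    note * = this
    obtain I where I: "(\<integral>\<^sup>+r\<in>{0<..<1}. (?m r / ennreal r) \<partial>lborel) = ennreal I" "I \<ge> 0"
      using fin by (cases "\<integral>\<^sup>+r\<in>{0<..<1}. (?m r / ennreal r) \<partial>lborel" rule: ennreal_cases) auto
    have "ennreal (e * ((I + 1) / e)) \<le> ennreal I"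
      using *[of "(I + 1) / e"] e I by simp
    then show False using e I by (simp add: ennreal_le_iff2)
  qed
  have "(\<integral>\<^sup>+y. ennreal (near_ker (x - y) * \<bar>u x - u y\<bar>) \<partial>lborel)
      \<le> (\<integral>\<^sup>+y. indicator {..<1} (norm (y - x)) * (?m (norm (y - x)) * ennreal (1 / norm (y - x) ^ DIM('a))) \<partial>lborel)"
  proof (rule nn_integral_mono)
    fix y
    show "ennreal (near_ker (x - y) * \<bar>u x - u y\<bar>) \<le> indicator {..<1} (norm (y - x)) * (?m (norm (y - x)) * ennreal (1 / norm (y - x) ^ DIM('a)))"
    proof (cases "norm (y - x) < 1")
      case True
      have "ennreal (near_ker (x - y) * \<bar>u x - u y\<bar>) = ennreal \<bar>u y - u x\<bar> * ennreal (near_ker (y - x))"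
        by (simp add: ennreal_mult' near_ker_minus_commute abs_minus_commute mult.commute)
      also have "\<dots> \<le> ?m (norm (y - x)) * ennreal (1 / norm (y - x) ^ DIM('a))"
        by (intro mult_mono m_ge ennreal_leI near_ker_le) (auto simp: dist_norm norm_minus_commute)
      finally show ?thesis using True by simp
    qed (simp add: near_ker_eq_0 norm_minus_commute)
  qed
  also have "\<dots> = (\<integral>\<^sup>+z. indicator {..<1} (norm (z::'a)) * (?m (norm z) * ennreal (1 / norm z ^ DIM('a))) \<partial>lborel)"
    by (subst (2) lborel_distr_plus[where c="-x", symmetric], subst nn_integral_distr) (auto simp: algebra_simps)
  also have "\<dots> = (\<integral>\<^sup>+r. indicator {0<..} r * ennreal (real DIM('a) * unit_ball_vol DIM('a) * r ^ (DIM('a) - 1)) *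
     (indicator {..<1} r * (?m r * ennreal (1 / r ^ DIM('a)))) \<partial>lborel)"
    by (rule nn_integral_radial[where h="\<lambda>r. indicator {..<1} r * (?m r * ennreal (1 / r ^ DIM('a)))"]) measurable
  also have "\<dots> = (\<integral>\<^sup>+r. ennreal (surf DIM('a)) * (?m r / ennreal r * indicator {0<..<1} r) \<partial>lborel)"
  proof (rule nn_integral_cong)
    fix r :: real
    show "indicator {0<..} r * ennreal (real DIM('a) * unit_ball_vol DIM('a) * r ^ (DIM('a) - 1)) *
     (indicator {..<1} r * (?m r * ennreal (1 / r ^ DIM('a)))) = ennreal (surf DIM('a)) * (?m r / ennreal r * indicator {0<..<1} r)"
    proof (cases "0 < r \<and> r < 1")
      case True
      have "DIM('a) = Suc (DIM('a) - 1)"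
        using DIM_positive[where 'a='a] by linarith
      then have "r ^ DIM('a) = r * r ^ (DIM('a) - 1)"
        by (metis power_Suc)
      then have "r ^ (DIM('a) - 1) * (1 / r ^ DIM('a)) = inverse r"
        using True by (simp add: field_simps)
      then have "ennreal (real DIM('a) * unit_ball_vol DIM('a) * r ^ (DIM('a) - 1)) * ennreal (1 / r ^ DIM('a))
        = ennreal (surf DIM('a)) * ennreal (inverse r)"
        using True by (simp add: ennreal_mult'[symmetric] surf_def mult.assoc divide_inverse)
      then show ?thesis
        using True by (simp add: divide_ennreal_def inverse_ennreal mult_ac)
    qed (auto split: split_indicator)
  qed
  also have "\<dots> = ennreal (surf DIM('a)) * (\<integral>\<^sup>+r\<in>{0<..<1}. (?m r / ennreal r) \<partial>lborel)"
    by (rule nn_integral_cmult) measurable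
  also have "\<dots> < \<infinity>"
    using fin by (simp add: ennreal_mult_less_top)
  finally show "(\<integral>\<^sup>+y. ennreal (near_ker (x - y) * \<bar>u x - u y\<bar>) \<partial>lborel) < \<infinity>" .
qed

lemma lborel_distr_diff_left: "distr lborel borel (\<lambda>y. x - y) = (lborel :: 'a::euclidean_space measure)"
  by (subst (2) lborel_affine[of "-1" x]) (auto simp: density_1)

lemma integrable_lborel_diff_left:
  fixes f :: "'a::euclidean_space \<Rightarrow> real"
  assumes "integrable lborel f"
  shows "integrable lborel (\<lambda>y. f (x - y))"
proof -
  have "integrable (distr lborel borel (\<lambda>y. x - y)) f"
    using assms by (simp add: lborel_distr_diff_left)
  then show ?thesis by (rule integrable_distr[rotated]) simp
qed

lemma integral_lborel_diff_left:
  fixes f :: "'a::euclidean_space \<Rightarrow> real"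
  assumes [measurable]: "f \<in> borel_measurable borel"
  shows "(\<integral>y. f (x - y) \<partial>lborel) = (\<integral>y. f y \<partial>lborel)"
  by (subst (2) lborel_distr_diff_left[of x, symmetric], subst integral_distr) auto

lemma integrable_cut_ker_power:
  "integrable lborel (\<lambda>z::'a::euclidean_space. cut_ker 1 z * (1 / max 1 (norm z)) ^ Suc m)"
proof -
  have "max 1 (norm z) powr - real (Suc m) = (1 / max 1 (norm z)) ^ Suc m" for z :: 'a
    by (subst powr_minus, subst powr_realpow) (auto simp: field_simps)
  then show ?thesis
    using integrable_cut_ker_powr[of "real (Suc m)", where 'a='a] by simp
qed

lemma integrable_cut_ker_square: "integrable lborel (\<lambda>z::'a::euclidean_space. (cut_ker 1 z)\<^sup>2)"
proof -
  have "Suc (DIM('a) - 1) = DIM('a)"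
    using DIM_positive[where 'a='a] by linarith
  then show ?thesis
    using integrable_cut_ker_power[of "DIM('a) - 1", where 'a='a]
    by (simp only: cut_ker_def power_one_over power2_eq_square)
qed

lemma integrable_cut_ker_mult:
  fixes u :: "'a::euclidean_space \<Rightarrow> real"
  assumes [measurable]: "u \<in> borel_measurable borel" and "integrable lborel (\<lambda>x. (u x)\<^sup>2)"
  shows "integrable lborel (\<lambda>y. cut_ker 1 (x - y) * u y)"
proof (rule Bochner_Integration.integrable_bound)
  show "integrable lborel (\<lambda>y. (cut_ker 1 (x - y))\<^sup>2 + (u y)\<^sup>2)"
    by (intro Bochner_Integration.integrable_add integrable_lborel_diff_left integrable_cut_ker_square assms)
  have "\<bar>c * v\<bar> \<le> c\<^sup>2 + v\<^sup>2" for c v :: real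
  proof -
    have "2 * \<bar>c\<bar> * \<bar>v\<bar> \<le> c\<^sup>2 + v\<^sup>2" "0 \<le> \<bar>c\<bar> * \<bar>v\<bar>"
      using sum_squares_bound[of "\<bar>c\<bar>" "\<bar>v\<bar>"] by auto
    then show ?thesis unfolding abs_mult by linarith
  qed
  then show "AE y in lborel. norm (cut_ker 1 (x - y) * u y) \<le> norm ((cut_ker 1 (x - y))\<^sup>2 + (u y)\<^sup>2)"
    by auto
qed auto

lemma
  fixes u :: "'a::euclidean_space \<Rightarrow> real"
  assumes "u \<in> L2_functions \<inter> dini_functions"
  shows continuous_on_L2_dini: "continuous_on UNIV u"
    and integrable_L2_dini_square: "integrable lborel (\<lambda>x. (u x)\<^sup>2)"
    and integrable_near_ker_dini: "integrable lborel (\<lambda>y. near_ker (x - y) * (u x - u y))"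
    and log_laplacian_kernel_form: "log_laplacian u x =
      log_lap_c DIM('a) * ((\<integral>y. near_ker (x - y) * (u x - u y) \<partial>lborel) - (\<integral>y. cut_ker 1 (x - y) * u y \<partial>lborel))
      + (log_lap_rho DIM('a) + log_lap_c DIM('a) * unit_ball_vol DIM('a)) * u x"
proof -
  have dini: "dini_continuous_at u x" for x
    using assms by (auto simp: dini_functions_def)
  then show "continuous_on UNIV u"
    by (auto simp: continuous_on_eq_continuous_at dini_continuous_at_imp_isCont)
  then have [measurable]: "u \<in> borel_measurable borel"
    by (rule borel_measurable_continuous_onI)
  show sq: "integrable lborel (\<lambda>x. (u x)\<^sup>2)"
    using assms by (auto simp: L2_functions_def integrable_completion)
  show near: "integrable lborel (\<lambda>y. near_ker (x - y) * (u x - u y))"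
    using dini_continuous_at_nn_integral[OF dini, of x]
    by (intro integrableI_bounded) (auto simp: abs_mult)
  have cut: "integrable lborel (\<lambda>y. cut_ker 1 (x - y) * u y)"
    using sq by (intro integrable_cut_ker_mult) auto
  have ball: "integrable lborel (\<lambda>y. indicator (ball x 1) y * u x)"
    by (intro integrable_mult_left integrable_real_indicator) (auto simp: emeasure_ball)
  have [measurable]: "ball x 1 \<in> sets borel" by simp
  have eq: "(u x * indicator (ball x 1) y - u y) / norm (x - y) ^ DIM('a) =
    near_ker (x - y) * (u x - u y) - cut_ker 1 (x - y) * u y + indicator (ball x 1) y * u x" for y
  proof (cases "y = x")
    case True
    then show ?thesis by (simp add: cut_ker_inside)
  next
    case False
    then have "(u x * indicator (ball x 1) y - u y) / norm (x - y) ^ DIM('a) =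
        (u x * indicator (ball x 1) y - u y) * (near_ker (x - y) + cut_ker 1 (x - y))"
      using kernel_split[of "x - y"] by (simp add: divide_inverse)
    also have "\<dots> = near_ker (x - y) * (u x - u y) - cut_ker 1 (x - y) * u y + indicator (ball x 1) y * u x"
    proof (cases "dist x y < 1")
      case True
      then show ?thesis by (simp add: cut_ker_inside dist_norm algebra_simps)
    next
      case False
      then show ?thesis by (simp add: near_ker_eq_0 dist_norm)
    qed
    finally show ?thesis .
  qed
  have "(LINT y|lebesgue. (u x * indicator (ball x 1) y - u y) / norm (x - y) ^ DIM('a)) =
    (\<integral>y. near_ker (x - y) * (u x - u y) - cut_ker 1 (x - y) * u y + indicator (ball x 1) y * u x \<partial>lborel)"
    unfolding eq by (rule integral_completion) measurable
  also have "\<dots> = (\<integral>y. near_ker (x - y) * (u x - u y) \<partial>lborel) - (\<integral>y. cut_ker 1 (x - y) * u y \<partial>lborel)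
     + unit_ball_vol DIM('a) * u x"
    using near cut ball by (simp add: content_ball)
  finally show "log_laplacian u x =
      log_lap_c DIM('a) * ((\<integral>y. near_ker (x - y) * (u x - u y) \<partial>lborel) - (\<integral>y. cut_ker 1 (x - y) * u y \<partial>lborel))
      + (log_lap_rho DIM('a) + log_lap_c DIM('a) * unit_ball_vol DIM('a)) * u x"
    by (simp only: log_laplacian_def) (simp add: distrib_left distrib_right)
qed

section \<open>Local Hoelder continuity\<close>

lemma abs_power_Suc_diff_le:
  fixes p q M :: real
  assumes "0 \<le> p" "p \<le> M" "0 \<le> q" "q \<le> M"
  shows "\<bar>p ^ Suc m - q ^ Suc m\<bar> \<le> real (Suc m) * M ^ m * \<bar>p - q\<bar>"
proof (induction m)
  case (Suc m)
  have "p ^ Suc (Suc m) - q ^ Suc (Suc m) = p * (p ^ Suc m - q ^ Suc m) + (p - q) * q ^ Suc m"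
    by (simp add: algebra_simps)
  then have "\<bar>p ^ Suc (Suc m) - q ^ Suc (Suc m)\<bar> \<le> p * \<bar>p ^ Suc m - q ^ Suc m\<bar> + \<bar>p - q\<bar> * q ^ Suc m"
    using assms by (metis abs_mult abs_of_nonneg abs_triangle_ineq zero_le_power)
  also have "\<dots> \<le> M * (real (Suc m) * M ^ m * \<bar>p - q\<bar>) + \<bar>p - q\<bar> * M ^ Suc m"
    using assms by (intro add_mono mult_mono Suc.IH power_mono) auto
  also have "\<dots> = real (Suc (Suc m)) * M ^ Suc m * \<bar>p - q\<bar>"
    by (simp add: algebra_simps)
  finally show ?case .
qed simp

lemma abs_inverse_power_diff_le:
  fixes s t :: real
  assumes "t > 0" "s \<ge> t / 2" "n > 0"
  shows "\<bar>1 / s ^ n - 1 / t ^ n\<bar> \<le> real n * 2 ^ n * \<bar>s - t\<bar> / t ^ Suc n"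
proof -
  obtain m where n: "n = Suc m" using assms(3) gr0_implies_Suc by blast
  have s: "s > 0" using assms by auto
  have "\<bar>(1 / s) ^ Suc m - (1 / t) ^ Suc m\<bar> \<le> real (Suc m) * (2 / t) ^ m * \<bar>1 / s - 1 / t\<bar>"
    using assms s by (intro abs_power_Suc_diff_le) (auto simp: field_simps)
  also have "\<bar>1 / s - 1 / t\<bar> = \<bar>s - t\<bar> / (s * t)"
    using s assms(1) by (simp add: diff_frac_eq abs_minus_commute abs_mult)
  also have "\<dots> \<le> \<bar>s - t\<bar> / (t / 2 * t)"
    using s assms by (intro divide_left_mono mult_right_mono) auto
  also have "real (Suc m) * (2 / t) ^ m * (\<bar>s - t\<bar> / (t / 2 * t)) = real n * 2 ^ n * \<bar>s - t\<bar> / t ^ Suc n"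
    using assms(1) by (simp add: n power_divide field_simps)
  finally show ?thesis
    using assms(1) by (simp add: n power_one_over mult_left_mono)
qed

lemma cut_ker_diff_le:
  fixes x y :: "'a::euclidean_space"
  assumes "a > 0" "norm (x - y) \<le> a / 2"
  shows "\<bar>cut_ker a x - cut_ker a y\<bar> \<le> real DIM('a) * 2 ^ DIM('a) * norm (x - y) / max a (norm y) ^ Suc DIM('a)"
proof -
  have diff: "\<bar>max a (norm x) - max a (norm y)\<bar> \<le> norm (x - y)"
    using norm_triangle_ineq3[of x y] by (auto simp: max_def)
  have "\<bar>cut_ker a x - cut_ker a y\<bar> \<le> real DIM('a) * 2 ^ DIM('a) * \<bar>max a (norm x) - max a (norm y)\<bar> / max a (norm y) ^ Suc DIM('a)"
    unfolding cut_ker_def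
    using assms diff by (intro abs_inverse_power_diff_le) (auto simp: max_def split: if_splits)
  also have "\<dots> \<le> real DIM('a) * 2 ^ DIM('a) * norm (x - y) / max a (norm y) ^ Suc DIM('a)"
    using assms diff by (intro divide_right_mono mult_left_mono) (auto simp: max_def)
  finally show ?thesis .
qed

lemma xlnx_diff_le:
  fixes s t M :: real
  assumes "0 \<le> t" "t < s" "s \<le> M"
  shows "s * ln s - t * ln t \<le> (ln M + 1) * (s - t)"
proof -
  have "s * ln s - t * ln t \<le> (ln s + 1) * (s - t)"
  proof (cases "t = 0")
    case False
    have "t * (ln s - ln t) = t * ln (s / t)"
      using assms False by (simp add: ln_div)
    also have "\<dots> \<le> t * (s / t - 1)"
      using assms False by (intro mult_left_mono ln_le_minus_one) auto
    also have "\<dots> = s - t"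
      using False by (simp add: field_simps)
    finally show ?thesis by (simp add: algebra_simps)
  qed (use assms in \<open>simp add: algebra_simps\<close>)
  also have "\<dots> \<le> (ln M + 1) * (s - t)"
    using assms by (intro mult_right_mono) auto
  finally show ?thesis .
qed

definition mid_ker :: "real \<Rightarrow> 'a::euclidean_space \<Rightarrow> real" where
  "mid_ker a z = cut_ker a z - cut_ker 1 z"

lemma mid_ker_measurable [measurable]: "mid_ker a \<in> borel_measurable borel"
  unfolding mid_ker_def by measurable

lemma mid_ker_outside: "a \<le> 1 \<Longrightarrow> norm z \<ge> 1 \<Longrightarrow> mid_ker a (z::'a::euclidean_space) = 0"
  by (simp add: mid_ker_def cut_ker_outside)

lemma mid_ker_nonneg: "0 < a \<Longrightarrow> a \<le> 1 \<Longrightarrow> mid_ker a z \<ge> 0"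
  unfolding mid_ker_def cut_ker_def by (auto intro!: divide_left_mono power_mono mult_pos_pos simp: less_max_iff_disj)

lemma mid_ker_le: "0 < a \<Longrightarrow> mid_ker a (z::'a::euclidean_space) \<le> 1 / a ^ DIM('a)"
proof -
  assume a: "0 < a"
  have "cut_ker a z \<le> 1 / a ^ DIM('a)"
    unfolding cut_ker_def using a by (intro divide_left_mono power_mono) (auto intro!: mult_pos_pos simp: less_max_iff_disj)
  then show ?thesis unfolding mid_ker_def by (smt (verit) cut_ker_nonneg)
qed

lemma mid_ker_mult_integrable:
  assumes a: "0 < a" "a \<le> 1" and [measurable]: "f \<in> borel_measurable borel" and f: "\<And>z::'a::euclidean_space. norm z < 1 \<Longrightarrow> \<bar>f z\<bar> \<le> C"
  shows "integrable lborel (\<lambda>z. mid_ker a z * f z)"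
proof (rule Bochner_Integration.integrable_bound)
  show "integrable lborel (\<lambda>z::'a. indicator (ball 0 1) z * (1 / a ^ DIM('a) * C))"
    by (intro integrable_mult_left integrable_real_indicator) (auto simp: emeasure_ball)
  show "AE z in lborel. norm (mid_ker a z * f z) \<le> norm (indicator (ball 0 1) z * (1 / a ^ DIM('a) * C))"
  proof (rule AE_I2)
    fix z :: 'a
    show "norm (mid_ker a z * f z) \<le> norm (indicator (ball 0 1) z * (1 / a ^ DIM('a) * C))"
    proof (cases "norm z < 1")
      case True
      have "\<bar>mid_ker a z * f z\<bar> \<le> 1 / a ^ DIM('a) * C"
        unfolding abs_mult using mid_ker_nonneg[OF a, of z] mid_ker_le[OF a(1), of z] f[OF True] a by (intro mult_mono) auto
      also have "\<dots> \<le> \<bar>1 / a ^ DIM('a) * C\<bar>" by (rule abs_ge_self)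
      finally show ?thesis using True by simp
    qed (use a in \<open>simp add: mid_ker_outside\<close>)
  qed
qed measurable

lemma mid_ker_integral_ge:
  assumes a: "0 < a" "a \<le> 1"
  shows "(\<integral>z. mid_ker a (z::'a::euclidean_space) \<partial>lborel) \<ge> surf DIM('a) * ln (1 / a) - unit_ball_vol DIM('a)"
proof -
  let ?A = "{z::'a. a \<le> norm z \<and> norm z \<le> 1}"
  have H: "has_bochner_integral lborel (\<lambda>z::'a. indicator ?A z * (1 / norm z ^ DIM('a)) - indicator (cball 0 1) z)
    (surf DIM('a) * ln (1 / a) - unit_ball_vol DIM('a))"
    using has_bochner_integral_inverse_annulus[OF a, where 'a='a]
      has_bochner_integral_real_indicator[of "cball (0::'a) 1" lborel]
    by (intro has_bochner_integral_diff) (auto simp: emeasure_cball content_cball)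
  then have "surf DIM('a) * ln (1 / a) - unit_ball_vol DIM('a) = (\<integral>z. indicator ?A z * (1 / norm z ^ DIM('a)) - indicator (cball 0 1) (z::'a) \<partial>lborel)"
    by (simp add: has_bochner_integral_iff)
  also have "\<dots> \<le> (\<integral>z. mid_ker a (z::'a) \<partial>lborel)"
  proof (rule integral_mono)
    show "integrable lborel (\<lambda>z::'a. indicator ?A z * (1 / norm z ^ DIM('a)) - indicator (cball 0 1) z :: real)"
      using H by (simp add: has_bochner_integral_iff)
    show "integrable lborel (mid_ker a)"
      using mid_ker_mult_integrable[OF a, of "\<lambda>_. 1" 1] by simp
    fix z :: 'a
    show "indicator ?A z * (1 / norm z ^ DIM('a)) - indicator (cball 0 1) z \<le> mid_ker a z"
      using mid_ker_nonneg[OF a, of z] a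
      by (auto split: split_indicator simp: mid_ker_def cut_ker_outside cut_ker_inside)
  qed
  finally show ?thesis .
qed

locale log_equation =
  fixes u :: "'a::euclidean_space \<Rightarrow> real" and k c b :: real
  assumes k_pos: "k > 0" and c_pos: "c > 0"
    and cont: "continuous_on UNIV u" and u_nonneg: "\<And>x. u x \<ge> 0"
    and square_int: "integrable lborel (\<lambda>x. (u x)\<^sup>2)"
    and near_int: "\<And>x. integrable lborel (\<lambda>y. near_ker (x - y) * (u x - u y))"
    and equation: "\<And>x. c * ((\<integral>y. near_ker (x - y) * (u x - u y) \<partial>lborel) - (\<integral>y. cut_ker 1 (x - y) * u y \<partial>lborel))
        + b * u x = k * (u x * ln (u x))"
begin

lemma u_measurable [measurable]: "u \<in> borel_measurable borel"
  using cont by (rule borel_measurable_continuous_onI)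

lemma cut_int: "integrable lborel (\<lambda>y. cut_ker 1 (x - y) * u y)"
  using square_int by (intro integrable_cut_ker_mult) auto

lemma near_translate:
  "integrable lborel (\<lambda>z. near_ker z * (u x - u (x - z)))"
  "(\<integral>y. near_ker (x - y) * (u x - u y) \<partial>lborel) = (\<integral>z. near_ker z * (u x - u (x - z)) \<partial>lborel)"
  using integrable_lborel_diff_left[OF near_int[of x], of x]
    integral_lborel_diff_left[of "\<lambda>y. near_ker (x - y) * (u x - u y)" x]
  by simp_all

definition tail_mass :: real where
  "tail_mass = (\<integral>z. cut_ker 1 (z::'a) * (1 / max 1 (norm z)) \<partial>lborel) + (\<integral>x. (u x)\<^sup>2 \<partial>lborel)"

lemma tail_mass_nonneg: "tail_mass \<ge> 0"
  unfolding tail_mass_def by (intro add_nonneg_nonneg Bochner_Integration.integral_nonneg) auto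

lemma cut_part_diff:
  fixes x y :: 'a
  assumes "dist x y \<le> 1/2"
  shows "\<bar>(\<integral>w. cut_ker 1 (x - w) * u w \<partial>lborel) - (\<integral>w. cut_ker 1 (y - w) * u w \<partial>lborel)\<bar>
     \<le> real DIM('a) * 2 ^ DIM('a) * dist x y * tail_mass"
proof -
  let ?D = "real DIM('a) * 2 ^ DIM('a)"
  let ?W = "\<lambda>z::'a. cut_ker 1 z * (1 / max 1 (norm z))"
  have W: "integrable lborel ?W"
    using integrable_cut_ker_power[of 0, where 'a='a] by simp
  have "\<bar>(\<integral>w. cut_ker 1 (x - w) * u w \<partial>lborel) - (\<integral>w. cut_ker 1 (y - w) * u w \<partial>lborel)\<bar>
    = \<bar>\<integral>w. (cut_ker 1 (x - w) - cut_ker 1 (y - w)) * u w \<partial>lborel\<bar>"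
    using cut_int by (simp add: left_diff_distrib)
  also have "\<dots> \<le> (\<integral>w. \<bar>(cut_ker 1 (x - w) - cut_ker 1 (y - w)) * u w\<bar> \<partial>lborel)"
    by (rule integral_abs_bound)
  also have "\<dots> \<le> (\<integral>w. ?D * dist x y * (?W (y - w) + (u w)\<^sup>2) \<partial>lborel)"
  proof (rule integral_mono)
    show "integrable lborel (\<lambda>w. \<bar>(cut_ker 1 (x - w) - cut_ker 1 (y - w)) * u w\<bar>)"
      using cut_int by (simp add: left_diff_distrib)
    show "integrable lborel (\<lambda>w. ?D * dist x y * (?W (y - w) + (u w)\<^sup>2))"
      by (intro integrable_mult_right Bochner_Integration.integrable_add integrable_lborel_diff_left W square_int)
    fix w
    let ?m = "max 1 (norm (y - w))"
    have m: "?m \<ge> 1" by simp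
    have "\<bar>cut_ker 1 (x - w) - cut_ker 1 (y - w)\<bar> \<le> ?D * norm ((x - w) - (y - w)) / ?m ^ Suc DIM('a)"
      using assms by (intro cut_ker_diff_le) (auto simp: dist_norm)
    also have "\<dots> = ?D * dist x y * ?W (y - w)"
      by (simp add: cut_ker_def dist_norm)
    finally have 1: "\<bar>cut_ker 1 (x - w) - cut_ker 1 (y - w)\<bar> \<le> ?D * dist x y * ?W (y - w)" .
    have W1: "0 \<le> ?W (y - w)" "?W (y - w) \<le> 1"
      using m mult_mono[OF cut_ker_le_1[of "y - w"], of "1 / ?m" 1] by auto
    have "u w \<le> 1 + (u w)\<^sup>2"
      using sum_squares_bound[of "u w" 1] u_nonneg[of w] by simp
    then have "?W (y - w) * u w \<le> ?W (y - w) * (1 + (u w)\<^sup>2)"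
      using W1 by (intro mult_left_mono) auto
    also have "\<dots> \<le> ?W (y - w) + (u w)\<^sup>2"
      using mult_right_mono[OF W1(2), of "(u w)\<^sup>2"] unfolding distrib_left mult_1_right mult_1_left by (simp add: add_left_mono)
    finally have 2: "?W (y - w) * u w \<le> ?W (y - w) + (u w)\<^sup>2" .
    have "\<bar>(cut_ker 1 (x - w) - cut_ker 1 (y - w)) * u w\<bar> \<le> ?D * dist x y * ?W (y - w) * u w"
      unfolding abs_mult abs_of_nonneg[OF u_nonneg] by (rule mult_right_mono[OF 1 u_nonneg])
    also have "\<dots> \<le> ?D * dist x y * (?W (y - w) + (u w)\<^sup>2)"
      using mult_left_mono[OF 2, of "?D * dist x y"] by (simp add: mult.assoc)
    finally show "\<bar>(cut_ker 1 (x - w) - cut_ker 1 (y - w)) * u w\<bar> \<le> ?D * dist x y * (?W (y - w) + (u w)\<^sup>2)" .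
  qed
  also have "\<dots> = ?D * dist x y * ((\<integral>w. ?W (y - w) \<partial>lborel) + (\<integral>w. (u w)\<^sup>2 \<partial>lborel))"
    using integrable_lborel_diff_left[OF W, of y] square_int by simp
  also have "(\<integral>w. ?W (y - w) \<partial>lborel) = (\<integral>w. ?W w \<partial>lborel)"
    by (rule integral_lborel_diff_left) measurable
  finally show ?thesis by (simp add: tail_mass_def)
qed

lemma maximal_pair_not_close:
  fixes xs x0 y0 :: 'a and A M :: real
  defines "\<tau> \<equiv> \<lambda>x. max 0 (1 - dist xs x)"
  defines "r \<equiv> dist x0 y0" and "\<delta> \<equiv> u x0 - u y0"
  assumes M: "\<And>y. dist xs y \<le> 4 \<Longrightarrow> u y \<le> M" "M \<ge> 1" and A: "A \<ge> 1"
    and e: "0 < e" "e \<le> r" "r \<le> 1" and \<tau>0: "\<tau> x0 > 0"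
    and \<delta>: "\<tau> x0 * \<delta> = A * r powr (3/4)"
    and max: "\<And>x y. e \<le> dist x y \<Longrightarrow> dist x y \<le> 1 \<Longrightarrow> \<tau> x * (u x - u y) \<le> A * dist x y powr (3/4)"
    and r8: "r \<le> \<tau> x0 / 8"
  shows "c * (surf DIM('a) * ln (1 / (2 * r))) \<le>
    c * (unit_ball_vol DIM('a) + surf DIM('a) / 2 + real DIM('a) * 2 ^ DIM('a) * (16 * surf DIM('a) + 8 * M * surf DIM('a) + tail_mass))
    + k * (ln M + 1) + \<bar>b\<bar>"
proof -
  let ?n = "DIM('a)"
  let ?S = "surf DIM('a)"
  let ?D = "real DIM('a) * 2 ^ DIM('a)"
  define t where "t = \<tau> x0"
  define a where "a = 2 * r"
  have t: "0 < t" "t \<le> 1" using \<tau>0 by (auto simp: t_def \<tau>_def)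
  have r: "r > 0" using e by simp
  have xs0: "dist xs x0 = 1 - t" using \<tau>0 by (auto simp: t_def \<tau>_def max_def split: if_splits)
  have a: "0 < a" "a \<le> 1" using r r8 t by (auto simp: a_def t_def)
  have S: "?S > 0" by simp
  have \<delta>t: "\<delta> * t = A * r powr (3/4)" using \<delta> by (simp add: t_def mult.commute)
  have r_le_powr: "r \<le> r powr (3/4)"
    using powr_mono'[of "3/4" 1 r] r e(3) by simp
  have rt: "r / t \<le> \<delta>"
  proof -
    have "r \<le> A * r powr (3/4)" using mult_mono[OF A r_le_powr] r A by simp
    then show ?thesis using t \<delta>t by (simp add: divide_le_eq)
  qed
  then have \<delta>0: "\<delta> > 0" using r t by (meson divide_pos_pos less_le_trans)
  have r_\<delta>: "r \<le> \<delta>"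
    using rt t r by (smt (verit) divide_le_eq_1 le_divide_eq mult_left_le)
  have \<tau>_shift: "t - dist x0 x \<le> \<tau> x" for x
    using dist_triangle[of xs x x0] xs0 by (simp add: \<tau>_def)
  define g where "g = (\<lambda>z. \<delta> - (u (x0 - z) - u (y0 - z)))"
  have g_meas [measurable]: "g \<in> borel_measurable borel" unfolding g_def by measurable
  have M': "u w \<le> M" if "dist y0 w \<le> 2" for w
  proof -
    have "dist xs w \<le> dist xs x0 + dist x0 y0 + dist y0 w"
      by (meson add_mono_thms_linordered_semiring(3) dist_triangle order_trans)
    then show ?thesis using that xs0 t r8 by (intro M(1)) (auto simp: r_def t_def)
  qed
  have g_bound: "\<bar>g z\<bar> \<le> \<delta> + M" if "norm z < 1" for z
  proof -
    have "dist y0 (x0 - z) \<le> dist y0 x0 + dist x0 (x0 - z)" by (rule dist_triangle)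
    also have "\<dots> \<le> 2" using that e(3) by (simp add: r_def dist_commute dist_norm)
    finally have "u (x0 - z) \<le> M" by (rule M')
    moreover have "u (y0 - z) \<le> M" using that by (intro M') (auto simp: dist_norm)
    ultimately show ?thesis
      using u_nonneg[of "x0 - z"] u_nonneg[of "y0 - z"] \<delta>0 by (auto simp: g_def abs_le_iff)
  qed

  text \<open>Near the diagonal, moving both points by the same vector cannot increase the weighted quotient.\<close>
  have g_lower: "g z \<ge> - (2 * \<delta> / t) * norm z" if z: "norm z < a" for z
  proof -
    have z4: "norm z \<le> t / 4" using z r8 by (simp add: a_def t_def)
    have "\<tau> (x0 - z) * (u (x0 - z) - u (y0 - z)) \<le> A * r powr (3/4)"
      using max[of "x0 - z" "y0 - z"] e by (simp add: r_def dist_norm)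
    then have le: "\<tau> (x0 - z) * (u (x0 - z) - u (y0 - z)) \<le> \<delta> * t" using \<delta>t by simp
    have \<tau>z: "\<tau> (x0 - z) \<ge> t - norm z" using \<tau>_shift[of "x0 - z"] by (simp add: dist_norm)
    have pos: "t - norm z > 0" using z4 t by simp
    show ?thesis
    proof (cases "u (x0 - z) - u (y0 - z) \<le> 0")
      case True
      then have "g z \<ge> 0" using \<delta>0 by (simp add: g_def)
      moreover have "- (2 * \<delta> / t) * norm z \<le> 0" using \<delta>0 t by simp
      ultimately show ?thesis by linarith
    next
      case False
      then have "(t - norm z) * (u (x0 - z) - u (y0 - z)) \<le> \<delta> * t"
        using order_trans[OF mult_right_mono[OF \<tau>z, of "u (x0 - z) - u (y0 - z)"] le] by simp
      then have "u (x0 - z) - u (y0 - z) \<le> \<delta> * t / (t - norm z)"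
        using pos by (simp add: le_divide_eq mult.commute)
      also have "\<dots> \<le> \<delta> * (1 + 2 * norm z / t)"
      proof -
        have "t * t \<le> (t + 2 * norm z) * (t - norm z)"
          using z4 t mult_right_mono[of "norm z" "t/2" "norm z"] by (simp add: algebra_simps)
        then have "t / (t - norm z) \<le> (t + 2 * norm z) / t"
          using pos t by (simp add: divide_le_eq le_divide_eq field_simps)
        then have "\<delta> * (t / (t - norm z)) \<le> \<delta> * ((t + 2 * norm z) / t)"
          using \<delta>0 by (intro mult_left_mono) auto
        then show ?thesis using t by (simp add: add_divide_distrib)
      qed
      finally show ?thesis by (simp add: g_def algebra_simps)
    qed
  qed
  define I where "I = (\<lambda>x. \<integral>y. near_ker (x - y) * (u x - u y) \<partial>lborel)"
  define Q where "Q = (\<lambda>x. \<integral>y. cut_ker 1 (x - y) * u y \<partial>lborel)"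
  have ng: "integrable lborel (\<lambda>z. near_ker z * g z)"
    and I_diff: "I x0 - I y0 = (\<integral>z. near_ker z * g z \<partial>lborel)"
  proof -
    have *: "near_ker z * g z = near_ker z * (u x0 - u (x0 - z)) - near_ker z * (u y0 - u (y0 - z))" for z
      by (simp add: g_def \<delta>_def algebra_simps)
    show "integrable lborel (\<lambda>z. near_ker z * g z)"
      unfolding * by (intro Bochner_Integration.integrable_diff near_translate)
    show "I x0 - I y0 = (\<integral>z. near_ker z * g z \<partial>lborel)"
      unfolding * I_def near_translate(2)
      by (rule Bochner_Integration.integral_diff[symmetric]) (rule near_translate)+
  qed
  have mg: "integrable lborel (\<lambda>z. mid_ker a z * g z)"
    using a g_bound by (intro mid_ker_mult_integrable) auto
  have inner: "(\<integral>z. near_ker z * g z - mid_ker a z * g z \<partial>lborel) \<ge> - (?S * \<delta> / 2)"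
  proof -
    have B: "has_bochner_integral lborel (\<lambda>z::'a. (2 * \<delta> / t) * (indicator (ball 0 a) z * (norm z powr 1 / norm z ^ ?n)))
       ((2 * \<delta> / t) * (?S * (a powr 1 / 1)))"
      using a by (intro has_bochner_integral_mult_right has_bochner_integral_powr_ball) auto
    have "- (?S * \<delta> / 2) \<le> - ((2 * \<delta> / t) * (?S * (a powr 1 / 1)))"
    proof -
      have "(2 * \<delta> / t) * (?S * (a powr 1 / 1)) = (4 * ?S * \<delta>) * (r / t)"
        using a by (simp add: a_def)
      also have "\<dots> \<le> (4 * ?S * \<delta>) * (1 / 8)"
        using r8 t S \<delta>0 by (intro mult_left_mono) (auto simp: t_def divide_le_eq)
      finally show ?thesis by (simp add: mult.commute)
    qed
    also have "\<dots> = (\<integral>z. - ((2 * \<delta> / t) * (indicator (ball 0 a) z * (norm z powr 1 / norm (z::'a) ^ ?n))) \<partial>lborel)"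
      using B by (simp only: has_bochner_integral_iff integral_minus)
    also have "\<dots> \<le> (\<integral>z. near_ker z * g z - mid_ker a z * g z \<partial>lborel)"
    proof (rule integral_mono_AE)
      show "integrable lborel (\<lambda>z::'a. - ((2 * \<delta> / t) * (indicator (ball 0 a) z * (norm z powr 1 / norm z ^ ?n))))"
        by (intro Bochner_Integration.integrable_minus integrable.intros[OF B])
      show "integrable lborel (\<lambda>z. near_ker z * g z - mid_ker a z * g z)"
        using ng mg by simp
      show "AE z in lborel. - ((2 * \<delta> / t) * (indicator (ball 0 a) z * (norm z powr 1 / norm z ^ ?n))) \<le> near_ker z * g z - mid_ker a z * g z"
        using AE_lborel_singleton[of "0::'a"]
      proof eventually_elim
        case (elim z)
        have ker: "near_ker z - mid_ker a z = 1 / norm z ^ ?n - cut_ker a z"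
          using kernel_split[OF elim] by (simp add: mid_ker_def)
        show ?case
        proof (cases "norm z < a")
          case True
          have k0: "0 \<le> 1 / norm z ^ ?n - cut_ker a z" "1 / norm z ^ ?n - cut_ker a z \<le> 1 / norm z ^ ?n"
            using cut_ker_le[OF elim, of a] cut_ker_nonneg[of a z] a by auto
          have "- ((2 * \<delta> / t) * (norm z / norm z ^ ?n)) = - ((1 / norm z ^ ?n) * ((2 * \<delta> / t) * norm z))"
            by simp
          also have "\<dots> \<le> - ((1 / norm z ^ ?n - cut_ker a z) * ((2 * \<delta> / t) * norm z))"
            using k0 \<delta>0 t by (intro le_imp_neg_le mult_right_mono) auto
          also have "\<dots> = (1 / norm z ^ ?n - cut_ker a z) * (- (2 * \<delta> / t) * norm z)"
            by simp
          also have "\<dots> \<le> (1 / norm z ^ ?n - cut_ker a z) * g z"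
            using k0 g_lower[OF True] by (intro mult_left_mono) auto
          finally show ?thesis using True by (simp flip: ker left_diff_distrib)
        next
          case False
          then have "near_ker z - mid_ker a z = 0"
            using ker by (simp add: cut_ker_outside)
          then show ?thesis using False by simp
        qed
      qed
    qed
    finally show ?thesis .
  qed

  text \<open>The middle part of the kernel has large mass and produces the gain \<^term>\<open>ln (1 / (2 * r))\<close>.\<close>
  define \<Lambda> where "\<Lambda> = (\<integral>z. mid_ker a (z::'a) \<partial>lborel)"
  have \<Lambda>: "\<Lambda> \<ge> ?S * ln (1 / a) - unit_ball_vol ?n"
    unfolding \<Lambda>_def using a by (rule mid_ker_integral_ge)
  define B where "B = (\<lambda>w. mid_ker a (x0 - w) - mid_ker a (y0 - w))"
  have mid1: "integrable lborel (\<lambda>z::'a. mid_ker a z)"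
    using mid_ker_mult_integrable[OF a, of "\<lambda>_. 1" 1] by simp
  have mid_u: "integrable lborel (\<lambda>z. mid_ker a z * u (x0 - z))" "integrable lborel (\<lambda>z. mid_ker a z * u (y0 - z))"
  proof -
    show "integrable lborel (\<lambda>z. mid_ker a z * u (x0 - z))"
    proof (rule mid_ker_mult_integrable[OF a, where C=M])
      fix z :: 'a assume "norm z < 1"
      moreover have "dist y0 (x0 - z) \<le> dist y0 x0 + dist x0 (x0 - z)" by (rule dist_triangle)
      ultimately have "u (x0 - z) \<le> M" using e(3) by (intro M') (simp add: r_def dist_commute dist_norm)
      then show "\<bar>u (x0 - z)\<bar> \<le> M" using u_nonneg by simp
    qed measurable
    show "integrable lborel (\<lambda>z. mid_ker a z * u (y0 - z))"
    proof (rule mid_ker_mult_integrable[OF a, where C=M])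
      fix z :: 'a assume "norm z < 1"
      then have "u (y0 - z) \<le> M" by (intro M') (simp add: dist_norm)
      then show "\<bar>u (y0 - z)\<bar> \<le> M" using u_nonneg by simp
    qed measurable
  qed
  have mid_shift: "integrable lborel (\<lambda>w. mid_ker a (x - w))" "(\<integral>w. mid_ker a (x - w) \<partial>lborel) = \<Lambda>" for x :: 'a
    using integrable_lborel_diff_left[OF mid1] integral_lborel_diff_left[of "mid_ker a"] by (auto simp: \<Lambda>_def)
  have mid_u': "integrable lborel (\<lambda>w. mid_ker a (x0 - w) * u w)" "integrable lborel (\<lambda>w. mid_ker a (y0 - w) * u w)"
    "(\<integral>w. mid_ker a (x0 - w) * u w \<partial>lborel) = (\<integral>z. mid_ker a z * u (x0 - z) \<partial>lborel)"
    "(\<integral>w. mid_ker a (y0 - w) * u w \<partial>lborel) = (\<integral>z. mid_ker a z * u (y0 - z) \<partial>lborel)"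
    using integrable_lborel_diff_left[OF mid_u(1), of x0] integrable_lborel_diff_left[OF mid_u(2), of y0]
      integral_lborel_diff_left[of "\<lambda>z. mid_ker a z * u (x0 - z)" x0]
      integral_lborel_diff_left[of "\<lambda>z. mid_ker a z * u (y0 - z)" y0] by simp_all
  have Bu: "integrable lborel (\<lambda>w. B w * (u w - u y0))"
    unfolding B_def using mid_u' mid_shift(1) by (simp add: algebra_simps)
  have middle: "(\<integral>z. mid_ker a z * g z \<partial>lborel) = \<delta> * \<Lambda> - (\<integral>w. B w * (u w - u y0) \<partial>lborel)"
  proof -
    have "(\<integral>z. mid_ker a z * g z \<partial>lborel) = (\<integral>z. mid_ker a z * \<delta> - (mid_ker a z * u (x0 - z) - mid_ker a z * u (y0 - z)) \<partial>lborel)"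
      by (simp add: g_def right_diff_distrib)
    also have "\<dots> = \<delta> * \<Lambda> - ((\<integral>w. mid_ker a (x0 - w) * u w \<partial>lborel) - (\<integral>w. mid_ker a (y0 - w) * u w \<partial>lborel))"
      using mid1 mid_u mid_u' by (simp add: \<Lambda>_def)
    also have "(\<integral>w. B w * (u w - u y0) \<partial>lborel) = (\<integral>w. (mid_ker a (x0 - w) * u w - mid_ker a (y0 - w) * u w)
        - (mid_ker a (x0 - w) * u y0 - mid_ker a (y0 - w) * u y0) \<partial>lborel)"
      by (simp add: B_def algebra_simps)
    then have "(\<integral>w. B w * (u w - u y0) \<partial>lborel) = (\<integral>w. mid_ker a (x0 - w) * u w \<partial>lborel) - (\<integral>w. mid_ker a (y0 - w) * u w \<partial>lborel)"
      using mid_u' mid_shift by simp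
    ultimately show ?thesis by simp
  qed
  have J1: "\<bar>\<integral>w. B w * (u w - u y0) \<partial>lborel\<bar> \<le> ?D * (16 * ?S + 8 * M * ?S) * \<delta>"
  proof -
    define h1 where "h1 = (\<lambda>v::'a. indicator {v. r \<le> norm v} v * (norm v powr (-(1/4)) / norm v ^ ?n) :: real)"
    define h2 where "h2 = (\<lambda>v::'a. indicator {v. t / 4 \<le> norm v} v * (norm v powr (-1) / norm v ^ ?n) :: real)"
    define C1 where "C1 = 4 * ?D * \<delta> * r powr (1/4)"
    define C2 where "C2 = 2 * ?D * r * M"
    have C: "C1 \<ge> 0" "C2 \<ge> 0" using \<delta>0 r M(2) by (auto simp: C1_def C2_def)
    have h0: "h1 v \<ge> 0" "h2 v \<ge> 0" for v by (auto simp: h1_def h2_def)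
    have H1: "has_bochner_integral lborel h1 (?S * (r powr (-(1/4)) / (1/4)))"
      unfolding h1_def using r by (intro has_bochner_integral_powr_outside) auto
    have H2: "has_bochner_integral lborel h2 (?S * ((t/4) powr (-1) / 1))"
      unfolding h2_def using t by (intro has_bochner_integral_powr_outside) auto
    have [measurable]: "h1 \<in> borel_measurable borel" "h2 \<in> borel_measurable borel"
      using H1 H2 by (auto simp: has_bochner_integral_iff dest: borel_measurable_integrable)
    have h_int: "integrable lborel (\<lambda>w. C1 * h1 (y0 - w) + C2 * h2 (y0 - w))"
      using H1 H2 by (intro Bochner_Integration.integrable_add integrable_mult_right integrable_lborel_diff_left)
        (auto simp: has_bochner_integral_iff)
    have "\<bar>\<integral>w. B w * (u w - u y0) \<partial>lborel\<bar> \<le> (\<integral>w. \<bar>B w * (u w - u y0)\<bar> \<partial>lborel)"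
      by (rule integral_abs_bound)
    also have "\<dots> \<le> (\<integral>w. C1 * h1 (y0 - w) + C2 * h2 (y0 - w) \<partial>lborel)"
    proof (rule integral_mono)
      show "integrable lborel (\<lambda>w. \<bar>B w * (u w - u y0)\<bar>)" using Bu by simp
      show "integrable lborel (\<lambda>w. C1 * h1 (y0 - w) + C2 * h2 (y0 - w))" by (rule h_int)
      fix w
      define v where "v = y0 - w"
      have xw: "norm (x0 - w) \<le> norm v + r" "norm (x0 - w) \<ge> norm v - r"
        using norm_triangle_ineq[of "x0 - y0" v] norm_triangle_ineq2[of v "y0 - x0"]
        by (auto simp: v_def r_def dist_norm norm_minus_commute algebra_simps)
      show "\<bar>B w * (u w - u y0)\<bar> \<le> C1 * h1 (y0 - w) + C2 * h2 (y0 - w)"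
      proof (cases "norm v < r \<or> norm v \<ge> 2")
        case True
        then have "B w = 0"
        proof
          assume "norm v < r"
          then have "norm (x0 - w) \<le> a" "norm (y0 - w) \<le> a" using xw r by (auto simp: a_def v_def)
          then show ?thesis using a by (simp add: B_def mid_ker_def cut_ker_inside)
        next
          assume "norm v \<ge> 2"
          then have "norm (x0 - w) \<ge> 1" "norm (y0 - w) \<ge> 1" using xw e(3) by (auto simp: v_def)
          then show ?thesis using a by (simp add: B_def mid_ker_outside)
        qed
        then show ?thesis using C h0 by simp
      next
        case False
        then have v: "r \<le> norm v" "norm v < 2" "norm v > 0" using r by auto
        have Dle: "?D * norm ((x0 - w) - (y0 - w)) / max d (norm (y0 - w)) ^ Suc ?n \<le> ?D * r / norm v ^ Suc ?n" for d
        proof -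
          have "norm v ^ Suc ?n \<le> max d (norm v) ^ Suc ?n"
            by (intro power_mono) auto
          then have "?D * r / max d (norm v) ^ Suc ?n \<le> ?D * r / norm v ^ Suc ?n"
            using v(3) r by (intro divide_left_mono mult_pos_pos zero_less_power) (auto simp: less_max_iff_disj)
          then show ?thesis by (simp add: r_def v_def dist_norm)
        qed
        have "\<bar>B w\<bar> \<le> \<bar>cut_ker a (x0 - w) - cut_ker a (y0 - w)\<bar> + \<bar>cut_ker 1 (x0 - w) - cut_ker 1 (y0 - w)\<bar>"
          by (simp add: B_def mid_ker_def)
        also have "\<dots> \<le> ?D * r / norm v ^ Suc ?n + ?D * r / norm v ^ Suc ?n"
          using a by (intro add_mono order_trans[OF cut_ker_diff_le Dle]) (auto simp: a_def r_def dist_norm)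
        finally have Bw: "\<bar>B w\<bar> \<le> 2 * ?D * r / norm v ^ Suc ?n" by (simp add: mult_ac)
        show ?thesis
        proof (cases "norm v \<le> t / 4")
          case True
          have dw: "dist w y0 = norm v" "dist y0 w = norm v" by (auto simp: v_def dist_norm norm_minus_commute)
          have \<tau>1: "t / 2 \<le> \<tau> w"
            using \<tau>_shift[of w] xw(1) True r8 t by (simp add: dist_norm t_def)
          have \<tau>2: "t / 2 \<le> \<tau> y0"
            using \<tau>_shift[of y0] r8 t by (simp add: r_def t_def)
          have m1: "\<tau> w * (u w - u y0) \<le> A * norm v powr (3/4)" "\<tau> y0 * (u y0 - u w) \<le> A * norm v powr (3/4)"
            using max[of w y0] max[of y0 w] dw v e True t by auto
          have "t / 2 * \<bar>u w - u y0\<bar> \<le> A * norm v powr (3/4)"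
          proof (cases "u w \<ge> u y0")
            case True
            then show ?thesis using order_trans[OF mult_right_mono[OF \<tau>1, of "u w - u y0"] m1(1)] by simp
          next
            case False
            then show ?thesis using order_trans[OF mult_right_mono[OF \<tau>2, of "u y0 - u w"] m1(2)] by simp
          qed
          also have "A = \<delta> * t / r powr (3/4)" using \<delta>t r by simp
          also have "\<delta> * t / r powr (3/4) * norm v powr (3/4) = t / 2 * (2 * \<delta> * norm v powr (3/4) / r powr (3/4))"
            by simp
          finally have du: "\<bar>u w - u y0\<bar> \<le> 2 * \<delta> * norm v powr (3/4) / r powr (3/4)"
            by (rule mult_left_le_imp_le) (use t in simp)
          have "\<bar>B w * (u w - u y0)\<bar> \<le> (2 * ?D * r / norm v ^ Suc ?n) * (2 * \<delta> * norm v powr (3/4) / r powr (3/4))"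
            unfolding abs_mult using Bw du by (intro mult_mono) auto
          also have "\<dots> = 4 * ?D * \<delta> * (r / r powr (3/4)) * ((norm v powr (3/4) / norm v) / norm v ^ ?n)"
            by (simp add: mult_ac)
          also have "r / r powr (3/4) = r powr (1/4)"
            using powr_diff[of r 1 "3/4"] r by simp
          also have "norm v powr (3/4) / norm v = norm v powr (-(1/4))"
            using powr_diff[of "norm v" "3/4" 1] v by simp
          finally have "\<bar>B w * (u w - u y0)\<bar> \<le> C1 * h1 v"
            using v by (simp add: C1_def h1_def)
          then show ?thesis using mult_nonneg_nonneg[OF C(2) h0(2), of v] by (simp add: v_def)
        next
          case False
          have "u w \<le> M" "u y0 \<le> M" using v by (auto intro!: M' simp: v_def dist_norm)
          then have du: "\<bar>u w - u y0\<bar> \<le> M" using u_nonneg[of w] u_nonneg[of y0] by (auto simp: abs_le_iff)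
          have "\<bar>B w * (u w - u y0)\<bar> \<le> (2 * ?D * r / norm v ^ Suc ?n) * M"
            unfolding abs_mult using Bw du by (intro mult_mono) auto
          also have "\<dots> = C2 * ((1 / norm v) / norm v ^ ?n)"
            by (simp add: C2_def mult_ac)
          also have "1 / norm v = norm v powr (-1)"
            using v by (simp add: powr_minus divide_inverse)
          finally have "\<bar>B w * (u w - u y0)\<bar> \<le> C2 * h2 v"
            using False by (simp add: h2_def)
          then show ?thesis using mult_nonneg_nonneg[OF C(1) h0(1), of v] by (simp add: v_def)
        qed
      qed
    qed
    also have "\<dots> = C1 * (\<integral>w. h1 (y0 - w) \<partial>lborel) + C2 * (\<integral>w. h2 (y0 - w) \<partial>lborel)"
      using H1 H2 by (subst Bochner_Integration.integral_add)
        (auto simp: has_bochner_integral_iff intro!: integrable_mult_right integrable_lborel_diff_left)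
    also have "\<dots> = C1 * (?S * (r powr (-(1/4)) / (1/4))) + C2 * (?S * ((t/4) powr (-1) / 1))"
      using H1 H2 by (simp add: integral_lborel_diff_left has_bochner_integral_iff)
    also have "\<dots> = 16 * ?D * ?S * \<delta> * (r powr (1/4) * r powr (-(1/4))) + 8 * ?D * M * ?S * (r / t)"
      using t by (simp add: C1_def C2_def powr_minus field_simps)
    also have "r powr (1/4) * r powr (-(1/4)) = 1"
      using r by (simp flip: powr_add)
    also have "16 * ?D * ?S * \<delta> * 1 + 8 * ?D * M * ?S * (r / t) \<le> 16 * ?D * ?S * \<delta> * 1 + 8 * ?D * M * ?S * \<delta>"
      using rt S M(2) by (intro add_left_mono mult_left_mono) auto
    also have "\<dots> = ?D * (16 * ?S + 8 * M * ?S) * \<delta>"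
      by (simp add: algebra_simps)
    finally show ?thesis .
  qed
  have J2: "\<bar>Q x0 - Q y0\<bar> \<le> ?D * \<delta> * tail_mass"
  proof -
    have "\<bar>Q x0 - Q y0\<bar> \<le> ?D * dist x0 y0 * tail_mass"
      unfolding Q_def using a by (intro cut_part_diff) (simp add: a_def r_def)
    also have "\<dots> \<le> ?D * \<delta> * tail_mass"
      using r_\<delta> tail_mass_nonneg by (intro mult_right_mono mult_left_mono) (auto simp: r_def)
    finally show ?thesis .
  qed
  have eq_diff: "c * ((I x0 - I y0) - (Q x0 - Q y0)) + b * \<delta> \<le> k * ((ln M + 1) * \<delta>)"
  proof -
    have "c * ((I x0 - I y0) - (Q x0 - Q y0)) + b * \<delta> = (c * (I x0 - Q x0) + b * u x0) - (c * (I y0 - Q y0) + b * u y0)"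
      by (simp add: \<delta>_def algebra_simps)
    also have "\<dots> = k * (u x0 * ln (u x0)) - k * (u y0 * ln (u y0))"
      unfolding I_def Q_def equation ..
    also have "\<dots> = k * (u x0 * ln (u x0) - u y0 * ln (u y0))"
      by (simp add: right_diff_distrib)
    also have "\<dots> \<le> k * ((ln M + 1) * \<delta>)"
    proof (intro mult_left_mono)
      have "u x0 \<le> M" using xs0 t by (intro M(1)) auto
      then show "u x0 * ln (u x0) - u y0 * ln (u y0) \<le> (ln M + 1) * \<delta>"
        unfolding \<delta>_def using \<delta>0 u_nonneg by (intro xlnx_diff_le) (auto simp: \<delta>_def)
    qed (use k_pos in auto)
    finally show ?thesis .
  qed
  have I_lower: "I x0 - I y0 \<ge> \<delta> * \<Lambda> - ?D * (16 * ?S + 8 * M * ?S) * \<delta> - ?S * \<delta> / 2"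
  proof -
    have "I x0 - I y0 = (\<integral>z. near_ker z * g z - mid_ker a z * g z \<partial>lborel) + (\<integral>z. mid_ker a z * g z \<partial>lborel)"
      unfolding I_diff using ng mg by simp
    then show ?thesis using inner middle J1 by linarith
  qed
  let ?E = "unit_ball_vol ?n + ?S / 2 + ?D * (16 * ?S + 8 * M * ?S + tail_mass)"
  have "\<delta> * (?S * ln (1 / a)) - \<delta> * ?E \<le> (I x0 - I y0) - (Q x0 - Q y0)"
  proof -
    have "\<delta> * (?S * ln (1 / a) - unit_ball_vol ?n) \<le> \<delta> * \<Lambda>"
      using \<Lambda> \<delta>0 by (intro mult_left_mono) auto
    then show ?thesis using I_lower J2 by (simp add: algebra_simps)
  qed
  then have "c * (\<delta> * (?S * ln (1 / a)) - \<delta> * ?E) \<le> c * ((I x0 - I y0) - (Q x0 - Q y0))"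
    using c_pos by (intro mult_left_mono) auto
  also have "\<dots> \<le> k * ((ln M + 1) * \<delta>) + \<bar>b\<bar> * \<delta>"
  proof -
    have "- (b * \<delta>) \<le> \<bar>b\<bar> * \<delta>" using \<delta>0 mult_right_mono[of "-b" "\<bar>b\<bar>" \<delta>] by simp
    then show ?thesis using eq_diff by linarith
  qed
  finally have "\<delta> * (c * (?S * ln (1 / a))) \<le> \<delta> * (c * ?E + k * (ln M + 1) + \<bar>b\<bar>)"
    by (simp add: algebra_simps)
  then show ?thesis
    using \<delta>0 by (simp add: a_def)
qed

theorem locally_holder:
  obtains C where "C \<ge> 0"
    "\<And>x y. norm x \<le> R \<Longrightarrow> dist x y \<le> 1 \<Longrightarrow> u x - u y \<le> C * dist x y powr (3/4)"
proof -
  have "compact (u ` cball 0 (R + 4))"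
    using cont by (intro compact_continuous_image) (auto intro: continuous_on_subset)
  then have "bdd_above (u ` cball 0 (R + 4))"
    by (intro bounded_imp_bdd_above compact_imp_bounded)
  then obtain M0 where M0: "\<And>y. y \<in> cball 0 (R + 4) \<Longrightarrow> u y \<le> M0"
    unfolding bdd_above_def by (meson imageI)
  define M where "M = max 1 M0"
  let ?n = "DIM('a)"
  define E where "E = (c * (unit_ball_vol ?n + surf ?n / 2 + real ?n * 2 ^ ?n * (16 * surf ?n + 8 * M * surf ?n + tail_mass))
    + k * (ln M + 1) + \<bar>b\<bar>) / (c * surf ?n)"
  define r1 where "r1 = min (1/8) (exp (- E) / 4)"
  define C where "C = 1 + M / r1 powr (3/4)"
  have r1: "r1 > 0" "r1 \<le> 1/8" by (auto simp: r1_def)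
  have M1: "M \<ge> 1" by (simp add: M_def)
  have C1: "C \<ge> 1" using r1 M1 by (simp add: C_def)
  have main: "u xs - u ys \<le> C * dist xs ys powr (3/4)" if R: "norm xs \<le> R" and d1: "dist xs ys \<le> 1" for xs ys
  proof (cases "xs = ys")
    case False
    define e where "e = dist xs ys"
    have e: "e > 0" using False by (simp add: e_def)
    define \<tau> where "\<tau> = (\<lambda>x. max 0 (1 - dist xs x))"
    define F where "F = (\<lambda>p. \<tau> (fst p) * (u (fst p) - u (snd p)) / dist (fst p) (snd p) powr (3/4))"
    define K where "K = {p. dist xs (fst p) \<le> 1 \<and> e \<le> dist (fst p) (snd p) \<and> dist (fst p) (snd p) \<le> 1}"
    have "closed K" unfolding K_def by (intro closed_Collect_conj closed_Collect_le continuous_intros)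
    moreover have "K \<subseteq> cball xs 1 \<times> cball xs 2"
    proof
      fix p assume p: "p \<in> K"
      have "dist xs (snd p) \<le> dist xs (fst p) + dist (fst p) (snd p)" by (rule dist_triangle)
      then show "p \<in> cball xs 1 \<times> cball xs 2" using p by (auto simp: K_def mem_Times_iff)
    qed
    ultimately have "compact K"
      using compact_Int_closed[of "cball xs 1 \<times> cball xs 2" K] by (simp add: compact_Times Int_absorb1)
    moreover have "(xs, ys) \<in> K" using d1 by (simp add: K_def e_def)
    moreover have "continuous_on K F"
      unfolding F_def \<tau>_def
      by (intro continuous_intros continuous_on_compose2[OF cont]) (use e in \<open>auto simp: K_def\<close>)
    ultimately obtain p where p: "p \<in> K" and pmax: "\<And>q. q \<in> K \<Longrightarrow> F q \<le> F p"
      using continuous_attains_sup[of K F] by blast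
    obtain x0 y0 where p_eq: "p = (x0, y0)" by (cases p)
    define A where "A = F (x0, y0)"
    have dp: "dist xs x0 \<le> 1" "e \<le> dist x0 y0" "dist x0 y0 \<le> 1"
      using p by (auto simp: p_eq K_def)
    have "A \<le> C"
    proof (rule ccontr)
      assume "\<not> A \<le> C"
      then have AC: "A > C" by simp
      define r where "r = dist x0 y0"
      have r: "r > 0" "r \<le> 1" "e \<le> r" using dp e by (auto simp: r_def)
      have Aeq: "\<tau> x0 * (u x0 - u y0) = A * r powr (3/4)"
        using r by (simp add: A_def F_def r_def)
      have \<tau>0: "\<tau> x0 > 0"
      proof (rule ccontr)
        assume "\<not> \<tau> x0 > 0"
        then have "\<tau> x0 = 0" by (simp add: \<tau>_def)
        then have "A = 0" by (simp add: A_def F_def)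
        then show False using AC C1 by simp
      qed
      have \<tau>1: "\<tau> x0 \<le> 1" by (simp add: \<tau>_def)
      have MM: "u y \<le> M" if "dist xs y \<le> 4" for y
      proof -
        have "norm y \<le> norm xs + dist xs y"
          using norm_triangle_ineq4[of xs "xs - y"] by (simp add: dist_norm)
        then have "u y \<le> M0" using that R by (intro M0) simp
        then show ?thesis by (simp add: M_def)
      qed
      have "(r / \<tau> x0) powr (3/4) \<le> M / A"
      proof -
        have "A * r powr (3/4) \<le> \<tau> x0 * M"
          unfolding Aeq[symmetric] using \<tau>0 MM[of x0] dp u_nonneg[of y0] by (intro mult_left_mono) auto
        moreover have "\<tau> x0 \<le> \<tau> x0 powr (3/4)"
          using powr_mono'[of "3/4" 1 "\<tau> x0"] \<tau>0 \<tau>1 by simp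
        then have "\<tau> x0 * M \<le> \<tau> x0 powr (3/4) * M"
          using M1 by (intro mult_right_mono) auto
        ultimately have "A * r powr (3/4) \<le> \<tau> x0 powr (3/4) * M" by simp
        then show ?thesis
          using AC C1 r \<tau>0 by (simp add: powr_divide field_simps)
      qed
      also have "M / A < r1 powr (3/4)"
      proof -
        have "M / r1 powr (3/4) < A" using AC by (simp add: C_def)
        then show ?thesis using r1 AC C1 by (simp add: field_simps)
      qed
      finally have "(r / \<tau> x0) powr (3/4) < r1 powr (3/4)" .
      then have "r / \<tau> x0 < r1"
        using powr_mono2[of "3/4" r1 "r / \<tau> x0"] r1 by (meson less_imp_le not_le zero_le_divide_iff zero_le_numeral)
      then have rr: "r < r1 * \<tau> x0" using \<tau>0 by (simp add: divide_less_eq)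
      have "r1 * \<tau> x0 \<le> 1/8 * \<tau> x0" using r1 \<tau>0 by (intro mult_right_mono) auto
      then have r8: "r \<le> \<tau> x0 / 8" using rr by simp
      have "r1 * \<tau> x0 \<le> r1 * 1" using r1 \<tau>1 by (intro mult_left_mono) auto
      then have r_r1: "r < r1" using rr by simp
      have "c * (surf ?n * ln (1 / (2 * dist x0 y0))) \<le>
        c * (unit_ball_vol ?n + surf ?n / 2 + real ?n * 2 ^ ?n * (16 * surf ?n + 8 * M * surf ?n + tail_mass))
        + k * (ln M + 1) + \<bar>b\<bar>"
      proof (rule maximal_pair_not_close[where A=A and e=e and xs=xs])
        fix x y :: 'a assume xy: "e \<le> dist x y" "dist x y \<le> 1"
        show "max 0 (1 - dist xs x) * (u x - u y) \<le> A * dist x y powr (3/4)"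
        proof (cases "dist xs x \<le> 1")
          case True
          then have "(x, y) \<in> K" using xy by (simp add: K_def)
          from pmax[OF this] have "\<tau> x * (u x - u y) / dist x y powr (3/4) \<le> A"
            unfolding p_eq A_def[symmetric] by (simp add: F_def)
          moreover have "x \<noteq> y" using e xy(1) by auto
          ultimately show ?thesis by (simp add: pos_divide_le_eq \<tau>_def)
        next
          case False
          then show ?thesis using AC C1 by simp
        qed
      qed (use MM M1 AC C1 e dp \<tau>0 Aeq r8 in \<open>auto simp: \<tau>_def r_def\<close>)
      then have "ln (1 / (2 * r)) \<le> E"
        using c_pos surf_DIM_pos[where 'a='a] unfolding E_def r_def
        by (subst le_divide_eq) (auto simp: mult_ac)
      then have "1 / (2 * r) \<le> exp E"
        using r by (metis exp_le_cancel_iff exp_ln divide_pos_pos zero_less_one mult_pos_pos zero_less_numeral)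
      then have "exp (- E) \<le> 2 * r"
        using r by (simp add: exp_minus field_simps)
      moreover have "r1 \<le> exp (- E) / 4" by (simp add: r1_def)
      ultimately show False using r_r1 r1 by linarith
    qed
    moreover have "F (xs, ys) \<le> A"
      using pmax[OF \<open>(xs, ys) \<in> K\<close>] by (simp add: A_def p_eq)
    ultimately have "(u xs - u ys) / dist xs ys powr (3/4) \<le> C"
      by (simp add: F_def \<tau>_def)
    then show ?thesis using False by (simp add: pos_divide_le_eq)
  qed simp
  show thesis
    using C1 main by (intro that[of C]) auto
qed

end

section \<open>Weak formulation and finiteness of the energy\<close>

lemma integrable_lborel_pairI:
  fixes F :: "'a::euclidean_space \<times> 'a \<Rightarrow> real"
  assumes [measurable]: "F \<in> borel_measurable (lborel \<Otimes>\<^sub>M lborel)"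
    and F: "\<And>x. integrable lborel (\<lambda>y. F (x, y))" "\<And>x. (\<integral>y. \<bar>F (x, y)\<bar> \<partial>lborel) \<le> H x"
    and H: "integrable lborel H"
  shows "integrable (lborel \<Otimes>\<^sub>M lborel) F"
proof (rule lborel_pair.Fubini_integrable)
  show "integrable lborel (\<lambda>x. \<integral>y. norm (F (x, y)) \<partial>lborel)"
  proof (rule Bochner_Integration.integrable_bound[OF H])
    show "AE x in lborel. norm (\<integral>y. norm (F (x, y)) \<partial>lborel) \<le> norm (H x)"
      using F(2) by (intro AE_I2) (simp, meson abs_ge_self order_trans)
  qed measurable
qed (use F in auto)

lemma
  fixes f h :: "'a::euclidean_space \<Rightarrow> real"
  assumes f: "integrable lborel f" and h: "integrable lborel h"
  shows integrable_lborel_pair_diff: "integrable (lborel \<Otimes>\<^sub>M lborel) (\<lambda>p. f (fst p) * h (fst p - snd p))"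
    and integral_lborel_pair_diff:
      "(\<integral>p. f (fst p) * h (fst p - snd p) \<partial>(lborel \<Otimes>\<^sub>M lborel)) = (\<integral>x. f x \<partial>lborel) * (\<integral>z. h z \<partial>lborel)"
proof -
  have [measurable]: "f \<in> borel_measurable borel" "h \<in> borel_measurable borel"
    using f h by (auto dest: borel_measurable_integrable)
  show *: "integrable (lborel \<Otimes>\<^sub>M lborel) (\<lambda>p. f (fst p) * h (fst p - snd p))"
  proof (rule integrable_lborel_pairI[where H="\<lambda>x. \<bar>f x\<bar> * (\<integral>z. \<bar>h z\<bar> \<partial>lborel)"])
    show "integrable lborel (\<lambda>y. f (fst (x, y)) * h (fst (x, y) - snd (x, y)))" for x
      using integrable_lborel_diff_left[OF h] by simp
    show "(\<integral>y. \<bar>f (fst (x, y)) * h (fst (x, y) - snd (x, y))\<bar> \<partial>lborel) \<le> \<bar>f x\<bar> * (\<integral>z. \<bar>h z\<bar> \<partial>lborel)" for x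
      using integral_lborel_diff_left[of "\<lambda>z. \<bar>h z\<bar>" x] by (simp add: abs_mult)
  qed (use f in auto)
  have "(\<integral>p. f (fst p) * h (fst p - snd p) \<partial>(lborel \<Otimes>\<^sub>M lborel)) = (\<integral>x. \<integral>y. f x * h (x - y) \<partial>lborel \<partial>lborel)"
    using lborel_pair.integral_fst'[OF *] by simp
  then show "(\<integral>p. f (fst p) * h (fst p - snd p) \<partial>(lborel \<Otimes>\<^sub>M lborel)) = (\<integral>x. f x \<partial>lborel) * (\<integral>z. h z \<partial>lborel)"
    using integral_lborel_diff_left[of h] by simp
qed

lemma
  fixes F :: "'a::euclidean_space \<times> 'a \<Rightarrow> real"
  shows integrable_lborel_pair_swap: "integrable (lborel \<Otimes>\<^sub>M lborel) F \<Longrightarrow> integrable (lborel \<Otimes>\<^sub>M lborel) (\<lambda>p. F (snd p, fst p))"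
    and integral_lborel_pair_swap: "F \<in> borel_measurable (lborel \<Otimes>\<^sub>M lborel) \<Longrightarrow> (\<integral>p. F (snd p, fst p) \<partial>(lborel \<Otimes>\<^sub>M lborel)) = (\<integral>p. F p \<partial>(lborel \<Otimes>\<^sub>M lborel))"
  using lborel_pair.integrable_product_swap[of F] lborel_pair.integral_product_swap[of F]
  by (simp_all only: case_prod_unfold)

lemma integrable_lborel_pair_diff_snd:
  fixes f h :: "'a::euclidean_space \<Rightarrow> real"
  assumes f: "integrable lborel f" and h: "integrable lborel h" and even: "\<And>z. h (- z) = h z"
  shows "integrable (lborel \<Otimes>\<^sub>M lborel) (\<lambda>p. f (snd p) * h (fst p - snd p))"
proof -
  have "h (x - y) = h (y - x)" for x y
    using even[of "x - y"] by simp
  then show ?thesis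
    using integrable_lborel_pair_swap[OF integrable_lborel_pair_diff[OF f h]] by simp
qed

locale log_equation_entropy = log_equation +
  assumes entropy_int: "integrable lborel (\<lambda>x. (u x)\<^sup>2 * ln (u x))"
begin

lemma far_energy_integrable: "integrable (lborel \<Otimes>\<^sub>M lborel) (\<lambda>p. cut_ker 1 (fst p - snd p) * u (snd p) * u (fst p))"
proof -
  define rad where "rad = (\<lambda>x. max 1 (u x powr (-4)))"
  define K where "K = (\<lambda>z::'a. cut_ker 1 z * max 1 (norm z) powr (1/4))"
  define G where "G = (\<lambda>p. (u (fst p))\<^sup>2 * (cut_ker 1 (fst p - snd p) * indicator {z. norm z \<le> rad (fst p)} (fst p - snd p)
    + (K (fst p - snd p))\<^sup>2 + (u (snd p))\<^sup>2))"
  have [measurable]: "rad \<in> borel_measurable borel" "K \<in> borel_measurable borel"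
    unfolding rad_def K_def by measurable
  have K2: "integrable lborel (\<lambda>z. (K z)\<^sup>2)"
  proof -
    have eq: "(K z)\<^sup>2 = cut_ker 1 z * max 1 (norm z) powr - (real DIM('a) - 1/2)" for z
    proof -
      have "max 1 (norm z) powr - (real DIM('a) - 1/2) = max 1 (norm z) powr - real DIM('a) * max 1 (norm z) powr (1/4 + 1/4)"
        by (subst powr_add[symmetric]) (simp add: algebra_simps)
      also have "max 1 (norm z) powr - real DIM('a) = cut_ker 1 z"
        by (simp add: cut_ker_def powr_minus powr_realpow inverse_eq_divide)
      finally show ?thesis
        by (simp only: powr_add) (simp add: K_def power2_eq_square mult_ac)
    qed
    have "real DIM('a) - 1/2 > 0"
      using DIM_positive[where 'a='a] by linarith
    then show ?thesis
      unfolding eq by (rule integrable_cut_ker_powr)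
  qed
  have rad_ge: "rad x \<ge> 1" for x by (simp add: rad_def)
  have ball: "integrable lborel (\<lambda>z::'a. cut_ker 1 z * indicator {z. norm z \<le> L} z)"
    "(\<integral>z. cut_ker 1 (z::'a) * indicator {z. norm z \<le> L} z \<partial>lborel) \<le> unit_ball_vol DIM('a) + surf DIM('a) * ln L"
    if L: "L \<ge> 1" for L
  proof -
    have H: "has_bochner_integral lborel (\<lambda>z::'a. indicator (cball 0 1) z + indicator {z. 1 \<le> norm z \<and> norm z \<le> L} z * (1 / norm z ^ DIM('a)))
      (unit_ball_vol DIM('a) + surf DIM('a) * ln (L / 1))"
      using has_bochner_integral_inverse_annulus[of 1 L, where 'a='a] L
        has_bochner_integral_real_indicator[of "cball (0::'a) 1" lborel]
      by (intro has_bochner_integral_add) (auto simp: emeasure_cball content_cball)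
    have le: "cut_ker 1 z * indicator {z. norm z \<le> L} z \<le> indicator (cball 0 1) z + indicator {z. 1 \<le> norm z \<and> norm z \<le> L} z * (1 / norm z ^ DIM('a))" for z :: 'a
      by (cases "norm z \<le> 1") (auto simp: cut_ker_inside cut_ker_outside split: split_indicator)
    show *: "integrable lborel (\<lambda>z::'a. cut_ker 1 z * indicator {z. norm z \<le> L} z)"
      using le by (intro Bochner_Integration.integrable_bound[OF integrable.intros[OF H]])
        (auto intro!: AE_I2 simp: abs_mult intro: order_trans[OF _ abs_ge_self])
    show "(\<integral>z. cut_ker 1 (z::'a) * indicator {z. norm z \<le> L} z \<partial>lborel) \<le> unit_ball_vol DIM('a) + surf DIM('a) * ln L"
      using integral_mono[OF * integrable.intros[OF H] le] H by (simp add: has_bochner_integral_iff)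
  qed
  have G: "integrable (lborel \<Otimes>\<^sub>M lborel) G"
  proof (rule integrable_lborel_pairI)
    let ?c = "unit_ball_vol DIM('a) + (\<integral>z. (K z)\<^sup>2 \<partial>lborel) + (\<integral>y. (u y)\<^sup>2 \<partial>lborel)"
    show "G \<in> borel_measurable (lborel \<Otimes>\<^sub>M lborel)"
      unfolding G_def by measurable
    show "integrable lborel (\<lambda>x. (u x)\<^sup>2 * ?c + 4 * surf DIM('a) * \<bar>(u x)\<^sup>2 * ln (u x)\<bar>)"
      using square_int entropy_int by (intro Bochner_Integration.integrable_add integrable_mult_left integrable_mult_right integrable_abs)
    fix x
    have i1: "integrable lborel (\<lambda>y. cut_ker 1 (x - y) * indicator {z. norm z \<le> rad x} (x - y))"
      by (rule integrable_lborel_diff_left[OF ball(1)[OF rad_ge]])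
    have i2: "integrable lborel (\<lambda>y. (K (x - y))\<^sup>2)"
      by (rule integrable_lborel_diff_left[OF K2])
    show int: "integrable lborel (\<lambda>y. G (x, y))"
      unfolding G_def fst_conv snd_conv
      by (intro integrable_mult_right Bochner_Integration.integrable_add i1 i2 square_int)
    have nn: "G (x, y) \<ge> 0" for y by (simp add: G_def)
    have ln: "(u x)\<^sup>2 * ln (rad x) \<le> 4 * \<bar>(u x)\<^sup>2 * ln (u x)\<bar>"
    proof (cases "u x = 0")
      case False
      then have "u x > 0" using u_nonneg[of x] by simp
      then have "ln (rad x) \<le> 4 * \<bar>ln (u x)\<bar>"
        by (auto simp: rad_def max_def ln_powr)
      then have "(u x)\<^sup>2 * ln (rad x) \<le> (u x)\<^sup>2 * (4 * \<bar>ln (u x)\<bar>)"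
        by (intro mult_left_mono) auto
      then show ?thesis by (simp add: abs_mult)
    qed simp
    have "(\<integral>y. \<bar>G (x, y)\<bar> \<partial>lborel) = (\<integral>y. G (x, y) \<partial>lborel)"
      using nn by simp
    also have "\<dots> = (u x)\<^sup>2 * ((\<integral>z. cut_ker 1 (z::'a) * indicator {z. norm z \<le> rad x} z \<partial>lborel) + (\<integral>z. (K z)\<^sup>2 \<partial>lborel) + (\<integral>y. (u y)\<^sup>2 \<partial>lborel))"
      using i1 i2 square_int integral_lborel_diff_left[of "\<lambda>z. cut_ker 1 z * indicator {z. norm z \<le> rad x} z" x]
        integral_lborel_diff_left[of "\<lambda>z. (K z)\<^sup>2" x]
      unfolding G_def fst_conv snd_conv by simp
    also have "\<dots> \<le> (u x)\<^sup>2 * ((unit_ball_vol DIM('a) + surf DIM('a) * ln (rad x)) + (\<integral>z. (K z)\<^sup>2 \<partial>lborel) + (\<integral>y. (u y)\<^sup>2 \<partial>lborel))"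
      by (intro mult_left_mono add_right_mono ball(2) rad_ge) auto
    also have "\<dots> = (u x)\<^sup>2 * ?c + surf DIM('a) * ((u x)\<^sup>2 * ln (rad x))"
      by (simp add: algebra_simps)
    also have "\<dots> \<le> (u x)\<^sup>2 * ?c + surf DIM('a) * (4 * \<bar>(u x)\<^sup>2 * ln (u x)\<bar>)"
      by (intro add_left_mono mult_left_mono ln) auto
    finally show "(\<integral>y. \<bar>G (x, y)\<bar> \<partial>lborel) \<le> (u x)\<^sup>2 * ?c + 4 * surf DIM('a) * \<bar>(u x)\<^sup>2 * ln (u x)\<bar>"
      by simp
  qed

  text \<open>For \<^term>\<open>u x \<ge> u y\<close> either \<^term>\<open>x - y\<close> is so short that \<^term>\<open>u x * u y \<le> (u x)\<^sup>2\<close> suffices,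
    or \<^term>\<open>1 \<le> u x * norm (x - y) powr (1/4)\<close>.\<close>
  have ordered: "cut_ker 1 (x - y) * u y * u x \<le> G (x, y)" if le: "u y \<le> u x" for x y
  proof (cases "norm (x - y) \<le> rad x")
    case True
    have "cut_ker 1 (x - y) * u y * u x \<le> cut_ker 1 (x - y) * u x * u x"
      using le u_nonneg by (intro mult_right_mono mult_left_mono) auto
    also have "\<dots> = (u x)\<^sup>2 * (cut_ker 1 (x - y) * indicator {z. norm z \<le> rad x} (x - y))"
      using True by (simp add: power2_eq_square)
    also have "\<dots> \<le> G (x, y)"
      unfolding G_def fst_conv snd_conv by (intro mult_left_mono) auto
    finally show ?thesis .
  next
    case False
    show ?thesis
    proof (cases "u x = 0")
      case True
      then show ?thesis by (simp add: G_def)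
    next
      case False
      then have ux: "u x > 0" using u_nonneg[of x] by simp
      have n: "norm (x - y) > 1" "norm (x - y) > u x powr (-4)"
        using \<open>\<not> norm (x - y) \<le> rad x\<close> by (auto simp: rad_def)
      have "(u x powr (-4)) powr (1/4) \<le> norm (x - y) powr (1/4)"
        using n by (intro powr_mono2) auto
      then have "1 / u x \<le> norm (x - y) powr (1/4)"
        unfolding powr_powr using ux by (simp add: powr_minus inverse_eq_divide)
      then have "1 \<le> u x * norm (x - y) powr (1/4)"
        using ux by (simp add: divide_le_eq mult.commute)
      then have "(cut_ker 1 (x - y) * u y * u x) * 1 \<le> (cut_ker 1 (x - y) * u y * u x) * (u x * norm (x - y) powr (1/4))"
        using u_nonneg by (intro mult_left_mono mult_nonneg_nonneg) auto
      also have "\<dots> = (u x)\<^sup>2 * (K (x - y) * u y)"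
        using n by (simp add: K_def power2_eq_square max_def mult_ac)
      also have "\<dots> \<le> (u x)\<^sup>2 * ((K (x - y))\<^sup>2 + (u y)\<^sup>2)"
        using sum_squares_bound[of "K (x - y)" "u y"] u_nonneg[of y]
        by (intro mult_left_mono) (auto simp: K_def intro: order_trans[rotated])
      also have "\<dots> \<le> G (x, y)"
        unfolding G_def fst_conv snd_conv by (intro mult_left_mono) auto
      finally show ?thesis by simp
    qed
  qed
  show ?thesis
  proof (rule Bochner_Integration.integrable_bound)
    show "integrable (lborel \<Otimes>\<^sub>M lborel) (\<lambda>p. G p + G (snd p, fst p))"
      by (intro Bochner_Integration.integrable_add G integrable_lborel_pair_swap)
    show "AE p in lborel \<Otimes>\<^sub>M lborel. norm (cut_ker 1 (fst p - snd p) * u (snd p) * u (fst p)) \<le> norm (G p + G (snd p, fst p))"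
    proof (rule AE_I2)
      fix p :: "'a \<times> 'a"
      obtain x y where p: "p = (x, y)" by (cases p)
      have nn: "G (x, y) \<ge> 0" "G (y, x) \<ge> 0" by (simp_all add: G_def)
      have "cut_ker 1 (x - y) * u y * u x \<le> G (x, y) + G (y, x)"
        using ordered[of y x] ordered[of x y] nn cut_ker_minus_commute[of 1 x y] by (cases "u y \<le> u x") (auto simp: mult_ac)
      then show "norm (cut_ker 1 (fst p - snd p) * u (snd p) * u (fst p)) \<le> norm (G p + G (snd p, fst p))"
        using u_nonneg nn by (simp add: p abs_mult)
    qed
  qed measurable
qed

definition near_form :: "('a \<Rightarrow> real) \<Rightarrow> ('a \<Rightarrow> real) \<Rightarrow> real" where
  "near_form f g = (\<integral>p. near_ker (fst p - snd p) * (f (fst p) - f (snd p)) * (g (fst p) - g (snd p)) \<partial>(lborel \<Otimes>\<^sub>M lborel))"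

definition cut_form :: "('a \<Rightarrow> real) \<Rightarrow> ('a \<Rightarrow> real) \<Rightarrow> real" where
  "cut_form f g = (\<integral>p. cut_ker 1 (fst p - snd p) * f (snd p) * g (fst p) \<partial>(lborel \<Otimes>\<^sub>M lborel))"

lemma holder_ball:
  obtains C where "C \<ge> 0"
    "\<And>x y. norm x \<le> R \<Longrightarrow> dist x y \<le> 1 \<Longrightarrow> \<bar>u x - u y\<bar> \<le> C * dist x y powr (3/4)"
proof -
  obtain C where C: "C \<ge> 0" "\<And>x y. norm x \<le> R + 1 \<Longrightarrow> dist x y \<le> 1 \<Longrightarrow> u x - u y \<le> C * dist x y powr (3/4)"
    using locally_holder[of "R + 1"] by blast
  have "\<bar>u x - u y\<bar> \<le> C * dist x y powr (3/4)" if "norm x \<le> R" "dist x y \<le> 1" for x y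
  proof -
    have "norm y \<le> norm x + dist x y"
      using norm_triangle_ineq4[of x "x - y"] by (simp add: dist_norm)
    then show ?thesis
      using C(2)[of x y] C(2)[of y x] that by (simp add: abs_le_iff dist_commute)
  qed
  then show thesis using C(1) that by blast
qed

lemma
  fixes d :: "'a \<Rightarrow> real"
  assumes d_meas [measurable]: "d \<in> borel_measurable borel" and bound: "\<And>x. \<bar>d x\<bar> \<le> D"
    and support: "\<And>x. norm x > R \<Longrightarrow> d x = 0"
  shows near_form_integrable: "integrable (lborel \<Otimes>\<^sub>M lborel) (\<lambda>p. near_ker (fst p - snd p) * (u (fst p) - u (snd p)) * (d (fst p) - d (snd p)))"
    and cut_form_integrable: "integrable (lborel \<Otimes>\<^sub>M lborel) (\<lambda>p. cut_ker 1 (fst p - snd p) * u (snd p) * d (fst p))"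
    and weak_equation: "c * (near_form u d / 2 - cut_form u d) + b * (\<integral>x. u x * d x \<partial>lborel) = k * (\<integral>x. u x * ln (u x) * d x \<partial>lborel)"
proof -
  have D: "D \<ge> 0" using bound[of 0] by simp
  obtain C where C: "C \<ge> 0" "\<And>x y. norm x \<le> R \<Longrightarrow> dist x y \<le> 1 \<Longrightarrow> \<bar>u x - u y\<bar> \<le> C * dist x y powr (3/4)"
    using holder_ball[of R] by blast
  define F where "F = (\<lambda>p. near_ker (fst p - snd p) * (u (fst p) - u (snd p)) * d (fst p))"
  have [measurable]: "F \<in> borel_measurable (lborel \<Otimes>\<^sub>M lborel)" unfolding F_def by measurable
  have Dball: "integrable lborel (\<lambda>x::'a. indicator (cball 0 R) x * D)"
    using emeasure_lborel_cball_finite[of "0::'a" R] by (intro integrable_mult_left integrable_real_indicator) auto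
  have bound': "\<bar>d x\<bar> \<le> indicator (cball 0 R) x * D" for x
    using bound[of x] support[of x] by (cases "norm x \<le> R") auto
  have d_int: "integrable lborel d"
    by (rule Bochner_Integration.integrable_bound[OF Dball]) (use bound' in \<open>auto intro!: AE_I2 intro: order_trans[OF _ abs_ge_self]\<close>)
  define h where "h = (\<lambda>z::'a. indicator (ball 0 1) z * (norm z powr (3/4) / norm z ^ DIM('a)) :: real)"
  have h: "integrable lborel h"
    unfolding h_def by (rule integrable.intros[OF has_bochner_integral_powr_ball]) auto
  have F_le: "\<bar>F (x, y)\<bar> \<le> \<bar>C * d x * h (x - y)\<bar>" for x y
  proof (cases "norm x \<le> R \<and> norm (x - y) < 1")
    case True
    have "\<bar>F (x, y)\<bar> = near_ker (x - y) * \<bar>u x - u y\<bar> * \<bar>d x\<bar>"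
      by (simp add: F_def abs_mult)
    also have "\<dots> \<le> (1 / norm (x - y) ^ DIM('a)) * (C * norm (x - y) powr (3/4)) * \<bar>d x\<bar>"
      using C(2)[of x y] True by (intro mult_right_mono mult_mono near_ker_le) (auto simp: dist_norm)
    also have "\<dots> = \<bar>C * d x * h (x - y)\<bar>"
      using True C(1) by (simp add: h_def abs_mult)
    finally show ?thesis .
  next
    case False
    then have "F (x, y) = 0"
      using support[of x] near_ker_eq_0[of "x - y"] by (auto simp: F_def)
    then show ?thesis by simp
  qed
  have F_int: "integrable (lborel \<Otimes>\<^sub>M lborel) F"
  proof (rule Bochner_Integration.integrable_bound)
    show "integrable (lborel \<Otimes>\<^sub>M lborel) (\<lambda>p. (C * d (fst p)) * h (fst p - snd p))"
      by (rule integrable_lborel_pair_diff) (use d_int h in auto)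
  qed (use F_le in \<open>auto intro!: AE_I2\<close>)
  have eq: "near_ker (fst p - snd p) * (u (fst p) - u (snd p)) * (d (fst p) - d (snd p)) = F p + F (snd p, fst p)" for p
    by (simp add: F_def near_ker_minus_commute[of "snd p" "fst p"] algebra_simps)
  show "integrable (lborel \<Otimes>\<^sub>M lborel) (\<lambda>p. near_ker (fst p - snd p) * (u (fst p) - u (snd p)) * (d (fst p) - d (snd p)))"
    unfolding eq by (intro Bochner_Integration.integrable_add integrable_lborel_pair_swap F_int)
  have "near_form u d = 2 * (\<integral>p. F p \<partial>(lborel \<Otimes>\<^sub>M lborel))"
    unfolding near_form_def eq using F_int integrable_lborel_pair_swap[OF F_int] integral_lborel_pair_swap[of F] by simp
  also have "(\<integral>p. F p \<partial>(lborel \<Otimes>\<^sub>M lborel)) = (\<integral>x. \<integral>y. F (x, y) \<partial>lborel \<partial>lborel)"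
    by (rule lborel_pair.integral_fst'[OF F_int, symmetric])
  also have "\<dots> = (\<integral>x. (\<integral>y. near_ker (x - y) * (u x - u y) \<partial>lborel) * d x \<partial>lborel)"
    by (simp add: F_def)
  finally have near: "near_form u d = 2 * (\<integral>x. (\<integral>y. near_ker (x - y) * (u x - u y) \<partial>lborel) * d x \<partial>lborel)" .
  let ?G = "\<lambda>p. cut_ker 1 (fst p - snd p) * u (snd p) * d (fst p)"
  let ?W = "(\<integral>z. (cut_ker 1 (z::'a))\<^sup>2 \<partial>lborel) + (\<integral>y. (u y)\<^sup>2 \<partial>lborel)"
  show G_int: "integrable (lborel \<Otimes>\<^sub>M lborel) ?G"
  proof (rule integrable_lborel_pairI)
    show "integrable lborel (\<lambda>x. ?W * \<bar>d x\<bar>)" using d_int by simp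
    fix x
    show "integrable lborel (\<lambda>y. ?G (x, y))"
      using cut_int[of x] by simp
    have i: "integrable lborel (\<lambda>y. (cut_ker 1 (x - y))\<^sup>2)"
      by (rule integrable_lborel_diff_left[OF integrable_cut_ker_square])
    have "(\<integral>y. \<bar>?G (x, y)\<bar> \<partial>lborel) = (\<integral>y. cut_ker 1 (x - y) * u y \<partial>lborel) * \<bar>d x\<bar>"
      using u_nonneg by (simp add: abs_mult)
    also have "(\<integral>y. cut_ker 1 (x - y) * u y \<partial>lborel) \<le> (\<integral>y. (cut_ker 1 (x - y))\<^sup>2 + (u y)\<^sup>2 \<partial>lborel)"
    proof (rule integral_mono[OF cut_int])
      fix y
      have "0 \<le> cut_ker 1 (x - y) * u y" using u_nonneg by simp
      then show "cut_ker 1 (x - y) * u y \<le> (cut_ker 1 (x - y))\<^sup>2 + (u y)\<^sup>2"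
        using sum_squares_bound[of "cut_ker 1 (x - y)" "u y"] by linarith
    qed (use i square_int in auto)
    also have "\<dots> = ?W"
      using i square_int integral_lborel_diff_left[of "\<lambda>z. (cut_ker 1 z)\<^sup>2" x] by simp
    finally show "(\<integral>y. \<bar>?G (x, y)\<bar> \<partial>lborel) \<le> ?W * \<bar>d x\<bar>"
      by (simp add: mult_right_mono)
  qed measurable
  have "cut_form u d = (\<integral>x. \<integral>y. ?G (x, y) \<partial>lborel \<partial>lborel)"
    unfolding cut_form_def by (rule lborel_pair.integral_fst'[OF G_int, symmetric])
  then have cut: "cut_form u d = (\<integral>x. (\<integral>y. cut_ker 1 (x - y) * u y \<partial>lborel) * d x \<partial>lborel)"
    by simp
  have i1: "integrable lborel (\<lambda>x. (\<integral>y. near_ker (x - y) * (u x - u y) \<partial>lborel) * d x)"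
    using lborel_pair.integrable_fst'[OF F_int] by (simp add: F_def)
  have i2: "integrable lborel (\<lambda>x. (\<integral>y. cut_ker 1 (x - y) * u y \<partial>lborel) * d x)"
    using lborel_pair.integrable_fst'[OF G_int] by simp
  have i3: "integrable lborel (\<lambda>x. u x * d x)"
  proof (rule Bochner_Integration.integrable_bound)
    show "integrable lborel (\<lambda>x. (u x)\<^sup>2 + D * \<bar>d x\<bar>)" using square_int d_int by simp
    show "AE x in lborel. norm (u x * d x) \<le> norm ((u x)\<^sup>2 + D * \<bar>d x\<bar>)"
    proof (rule AE_I2)
      fix x
      have "u x * \<bar>d x\<bar> \<le> (u x)\<^sup>2 + (\<bar>d x\<bar>)\<^sup>2"
        using sum_squares_bound[of "u x" "\<bar>d x\<bar>"] mult_nonneg_nonneg[OF u_nonneg[of x], of "\<bar>d x\<bar>"] by linarith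
      also have "(\<bar>d x\<bar>)\<^sup>2 \<le> D * \<bar>d x\<bar>"
        unfolding power2_eq_square using bound[of x] by (intro mult_right_mono) auto
      finally show "norm (u x * d x) \<le> norm ((u x)\<^sup>2 + D * \<bar>d x\<bar>)"
        using u_nonneg D by (simp add: abs_mult)
    qed
  qed measurable
  have "k * (\<integral>x. u x * ln (u x) * d x \<partial>lborel) = (\<integral>x. k * (u x * ln (u x)) * d x \<partial>lborel)"
    by (simp add: mult.assoc)
  also have "\<dots> = (\<integral>x. c * ((\<integral>y. near_ker (x - y) * (u x - u y) \<partial>lborel) * d x)
      - c * ((\<integral>y. cut_ker 1 (x - y) * u y \<partial>lborel) * d x) + b * (u x * d x) \<partial>lborel)"
    unfolding equation[symmetric] by (simp add: algebra_simps)
  also have "\<dots> = c * (near_form u d / 2) - c * cut_form u d + b * (\<integral>x. u x * d x \<partial>lborel)"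
    using i1 i2 i3 by (simp add: near cut)
  finally show "c * (near_form u d / 2 - cut_form u d) + b * (\<integral>x. u x * d x \<partial>lborel) = k * (\<integral>x. u x * ln (u x) * d x \<partial>lborel)"
    by (simp add: right_diff_distrib)
qed

end

lemma integrable_near_ker_norm_square: "integrable lborel (\<lambda>z::'a::euclidean_space. near_ker z * (norm z)\<^sup>2)"
proof (rule Bochner_Integration.integrable_bound)
  show "integrable lborel (\<lambda>z::'a. indicator (ball 0 1) z * (norm z powr 2 / norm z ^ DIM('a)))"
    by (rule integrable.intros[OF has_bochner_integral_powr_ball]) auto
  show "AE z in lborel. norm (near_ker z * (norm z)\<^sup>2) \<le> norm (indicator (ball 0 1) z * (norm z powr 2 / norm (z::'a) ^ DIM('a)))"
  proof (rule AE_I2)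
    fix z :: 'a
    show "norm (near_ker z * (norm z)\<^sup>2) \<le> norm (indicator (ball 0 1) z * (norm z powr 2 / norm z ^ DIM('a)))"
    proof (cases "norm z < 1")
      case True
      then show ?thesis
        using mult_right_mono[OF near_ker_le[of z], of "(norm z)\<^sup>2"] by (simp add: abs_mult)
    qed (simp add: near_ker_eq_0)
  qed
qed measurable

definition hat :: "nat \<Rightarrow> 'a::euclidean_space \<Rightarrow> real" where
  "hat m x = max 0 (1 - norm x / real (Suc m))"

lemma hat_measurable [measurable]: "hat m \<in> borel_measurable borel"
  unfolding hat_def by measurable

lemma hat_bounds [simp]: "0 \<le> hat m x" "hat m x \<le> 1"
  by (auto simp: hat_def)

lemma hat_eq_0: "norm x > real (Suc m) \<Longrightarrow> hat m x = 0"
  by (simp add: hat_def divide_simps)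

lemma hat_diff_le: "\<bar>hat m x - hat m y\<bar> \<le> norm (x - y)"
proof -
  have "\<bar>hat m x - hat m y\<bar> \<le> \<bar>norm x / real (Suc m) - norm y / real (Suc m)\<bar>"
  proof -
    have "\<bar>max 0 (1 - v) - max 0 (1 - w)\<bar> \<le> \<bar>v - w\<bar>" for v w :: real
      by (auto simp: max_def)
    then show ?thesis unfolding hat_def .
  qed
  also have "\<dots> = \<bar>norm x - norm y\<bar> / real (Suc m)"
    unfolding diff_divide_distrib[symmetric] abs_divide by simp
  also have "\<dots> \<le> \<bar>norm x - norm y\<bar> / 1"
    by (intro divide_left_mono) auto
  also have "\<dots> \<le> norm (x - y)" by (simp add: norm_triangle_ineq3)
  finally show ?thesis .
qed

lemma hat_tendsto: "(\<lambda>m. hat m x) \<longlonglongrightarrow> 1"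
proof -
  have "(\<lambda>m. max 0 (1 - norm x * inverse (real (Suc m)))) \<longlonglongrightarrow> max 0 (1 - norm x * 0)"
    by (intro tendsto_intros LIMSEQ_inverse_real_of_nat)
  then show ?thesis by (simp add: hat_def[abs_def] divide_inverse)
qed

context log_equation_entropy
begin

definition cutoff :: "nat \<Rightarrow> 'a \<Rightarrow> real" where
  "cutoff m x = (hat m x)\<^sup>2 * u x"

lemma cutoff_measurable [measurable]: "cutoff m \<in> borel_measurable borel"
  unfolding cutoff_def by measurable

lemma cutoff_bounded: obtains D where "\<And>x. \<bar>cutoff m x\<bar> \<le> D"
proof -
  have "compact (u ` cball 0 (real (Suc m)))"
    using cont by (intro compact_continuous_image) (auto intro: continuous_on_subset)
  then have "bdd_above (u ` cball 0 (real (Suc m)))"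
    by (intro bounded_imp_bdd_above compact_imp_bounded)
  then obtain D where D: "\<And>y. y \<in> cball 0 (real (Suc m)) \<Longrightarrow> u y \<le> D"
    unfolding bdd_above_def by (meson imageI)
  have "\<bar>cutoff m x\<bar> \<le> \<bar>D\<bar>" for x
  proof (cases "norm x \<le> real (Suc m)")
    case True
    have "(hat m x)\<^sup>2 * u x \<le> 1 * \<bar>D\<bar>"
      using D[of x] True u_nonneg[of x] by (intro mult_mono power_le_one) auto
    then show ?thesis using u_nonneg[of x] by (simp add: cutoff_def abs_mult)
  qed (simp add: cutoff_def hat_eq_0)
  then show thesis by (rule that)
qed

lemma cutoff_eq_0: "norm x > real (Suc m) \<Longrightarrow> cutoff m x = 0"
  by (simp add: cutoff_def hat_eq_0)

lemma cutoff_le: "0 \<le> cutoff m x" "cutoff m x \<le> u x"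
  using u_nonneg[of x] mult_right_mono[of "(hat m x)\<^sup>2" 1 "u x"]
  by (auto simp: cutoff_def power_le_one)

lemma near_form_cutoff_integrable:
  "integrable (lborel \<Otimes>\<^sub>M lborel) (\<lambda>p. near_ker (fst p - snd p) * (u (fst p) - u (snd p)) * (cutoff m (fst p) - cutoff m (snd p)))"
proof -
  obtain D where "\<And>x. \<bar>cutoff m x\<bar> \<le> D" using cutoff_bounded[of m] by blast
  then show ?thesis by (rule near_form_integrable[OF cutoff_measurable _ cutoff_eq_0])
qed

lemma weak_equation_cutoff:
  "c * (near_form u (cutoff m) / 2 - cut_form u (cutoff m)) + b * (\<integral>x. u x * cutoff m x \<partial>lborel)
    = k * (\<integral>x. u x * ln (u x) * cutoff m x \<partial>lborel)"
proof -
  obtain D where "\<And>x. \<bar>cutoff m x\<bar> \<le> D" using cutoff_bounded[of m] by blast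
  then show ?thesis by (rule weak_equation[OF cutoff_measurable _ cutoff_eq_0])
qed

lemma square_near_integrable:
  "integrable (lborel \<Otimes>\<^sub>M lborel) (\<lambda>p. near_ker (fst p - snd p) * (norm (fst p - snd p))\<^sup>2 * (u (fst p))\<^sup>2)"
  "integrable (lborel \<Otimes>\<^sub>M lborel) (\<lambda>p. near_ker (fst p - snd p) * (norm (fst p - snd p))\<^sup>2 * (u (snd p))\<^sup>2)"
proof -
  have "near_ker (- z) * (norm (- z))\<^sup>2 = near_ker z * (norm z)\<^sup>2" for z :: 'a
    by (simp add: near_ker_def)
  then show
    "integrable (lborel \<Otimes>\<^sub>M lborel) (\<lambda>p. near_ker (fst p - snd p) * (norm (fst p - snd p))\<^sup>2 * (u (fst p))\<^sup>2)"
    "integrable (lborel \<Otimes>\<^sub>M lborel) (\<lambda>p. near_ker (fst p - snd p) * (norm (fst p - snd p))\<^sup>2 * (u (snd p))\<^sup>2)"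
    using integrable_lborel_pair_diff[OF square_int integrable_near_ker_norm_square]
      integrable_lborel_pair_diff_snd[OF square_int integrable_near_ker_norm_square]
    by (simp_all add: mult.commute mult.left_commute)
qed

lemma near_energy_integrable:
  "integrable (lborel \<Otimes>\<^sub>M lborel) (\<lambda>p. near_ker (fst p - snd p) * (u (fst p) - u (snd p)) * (u (fst p) - u (snd p)))"
proof -
  let ?P = "lborel \<Otimes>\<^sub>M lborel :: ('a \<times> 'a) measure"
  define Z where "Z = (\<lambda>m p. near_ker (fst p - snd p) * (hat m (fst p) * u (fst p) - hat m (snd p) * u (snd p))\<^sup>2)"
  define Y where "Y = (\<lambda>p. near_ker (fst p - snd p) * (norm (fst p - snd p))\<^sup>2 * (u (fst p))\<^sup>2
    + near_ker (fst p - snd p) * (norm (fst p - snd p))\<^sup>2 * (u (snd p))\<^sup>2)"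
  have [measurable]: "Z m \<in> borel_measurable ?P" "Y \<in> borel_measurable ?P" for m
    unfolding Z_def Y_def by measurable
  have Y: "integrable ?P Y"
    unfolding Y_def by (intro Bochner_Integration.integrable_add square_near_integrable)
  define B where "B = (2 * (k * (\<integral>x. \<bar>(u x)\<^sup>2 * ln (u x)\<bar> \<partial>lborel) + \<bar>b\<bar> * (\<integral>x. (u x)\<^sup>2 \<partial>lborel)) / c
    + 2 * cut_form u u) + (\<integral>p. Y p \<partial>?P)"
  have Z_le: "Z m p \<le> near_ker (fst p - snd p) * (u (fst p) - u (snd p)) * (cutoff m (fst p) - cutoff m (snd p)) + Y p" for m p
  proof -
    obtain x y where p: "p = (x, y)" by (cases p)
    let ?a = "hat m x" and ?b = "hat m y"
    have "(?a * u x - ?b * u y)\<^sup>2 = (u x - u y) * (?a\<^sup>2 * u x - ?b\<^sup>2 * u y) + u x * u y * (?a - ?b)\<^sup>2"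
      by (simp add: power2_eq_square algebra_simps)
    also have "\<dots> \<le> (u x - u y) * (?a\<^sup>2 * u x - ?b\<^sup>2 * u y) + (norm (x - y))\<^sup>2 * ((u x)\<^sup>2 + (u y)\<^sup>2)"
    proof -
      have "u x * u y \<le> (u x)\<^sup>2 + (u y)\<^sup>2"
        using sum_squares_bound[of "u x" "u y"] mult_nonneg_nonneg[OF u_nonneg u_nonneg, of x y] by linarith
      moreover have "(?a - ?b)\<^sup>2 \<le> (norm (x - y))\<^sup>2"
        using hat_diff_le[of m x y] by (metis abs_le_square_iff abs_norm_cancel)
      ultimately have "u x * u y * (?a - ?b)\<^sup>2 \<le> ((u x)\<^sup>2 + (u y)\<^sup>2) * (norm (x - y))\<^sup>2"
        by (intro mult_mono) auto
      then show ?thesis by (simp add: mult.commute)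
    qed
    finally have "near_ker (x - y) * (?a * u x - ?b * u y)\<^sup>2 \<le>
      near_ker (x - y) * ((u x - u y) * (?a\<^sup>2 * u x - ?b\<^sup>2 * u y) + (norm (x - y))\<^sup>2 * ((u x)\<^sup>2 + (u y)\<^sup>2))"
      by (intro mult_left_mono) auto
    then show ?thesis
      by (simp add: p Z_def Y_def cutoff_def distrib_left mult.assoc)
  qed
  have Z_int: "integrable ?P (Z m)" for m
  proof (rule Bochner_Integration.integrable_bound)
    show "integrable ?P (\<lambda>p. near_ker (fst p - snd p) * (u (fst p) - u (snd p)) * (cutoff m (fst p) - cutoff m (snd p)) + Y p)"
      by (intro Bochner_Integration.integrable_add near_form_cutoff_integrable Y)
    show "AE p in ?P. norm (Z m p) \<le> norm (near_ker (fst p - snd p) * (u (fst p) - u (snd p)) * (cutoff m (fst p) - cutoff m (snd p)) + Y p)"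
    proof (rule AE_I2)
      fix p
      have "Z m p \<ge> 0" by (simp add: Z_def)
      then show "norm (Z m p) \<le> norm (near_ker (fst p - snd p) * (u (fst p) - u (snd p)) * (cutoff m (fst p) - cutoff m (snd p)) + Y p)"
        using Z_le[of m p] by (simp add: abs_le_iff)
    qed
  qed measurable
  have Z_bound: "(\<integral>p. Z m p \<partial>?P) \<le> B" for m
  proof -
    have "(\<integral>p. Z m p \<partial>?P) \<le> (\<integral>p. near_ker (fst p - snd p) * (u (fst p) - u (snd p)) * (cutoff m (fst p) - cutoff m (snd p)) + Y p \<partial>?P)"
      using Z_le by (intro integral_mono Z_int Bochner_Integration.integrable_add near_form_cutoff_integrable Y)
    also have "\<dots> = near_form u (cutoff m) + (\<integral>p. Y p \<partial>?P)"
      unfolding near_form_def by (intro Bochner_Integration.integral_add near_form_cutoff_integrable Y)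
    also have "near_form u (cutoff m) = 2 * (k * (\<integral>x. u x * ln (u x) * cutoff m x \<partial>lborel) + - b * (\<integral>x. u x * cutoff m x \<partial>lborel)) / c + 2 * cut_form u (cutoff m)"
      using weak_equation_cutoff[of m] c_pos by (simp add: field_simps)
    also have "\<dots> \<le> 2 * (k * (\<integral>x. \<bar>(u x)\<^sup>2 * ln (u x)\<bar> \<partial>lborel) + \<bar>b\<bar> * (\<integral>x. (u x)\<^sup>2 \<partial>lborel)) / c + 2 * cut_form u u"
    proof -
      have 1: "(\<integral>x. u x * ln (u x) * cutoff m x \<partial>lborel) \<le> (\<integral>x. \<bar>(u x)\<^sup>2 * ln (u x)\<bar> \<partial>lborel)"
      proof (rule integral_mono')
        fix x
        have "u x * ln (u x) * cutoff m x \<le> u x * \<bar>ln (u x)\<bar> * u x"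
          using cutoff_le[of m x] u_nonneg[of x] by (intro mult_mono mult_left_mono) auto
        then show "u x * ln (u x) * cutoff m x \<le> \<bar>(u x)\<^sup>2 * ln (u x)\<bar>"
          by (simp add: abs_mult power2_eq_square mult_ac)
      qed (use entropy_int in auto)
      have 2: "(\<integral>x. u x * cutoff m x \<partial>lborel) \<le> (\<integral>x. (u x)\<^sup>2 \<partial>lborel)" "(\<integral>x. u x * cutoff m x \<partial>lborel) \<ge> 0"
        using cutoff_le u_nonneg
        by (auto intro!: integral_mono' Bochner_Integration.integral_nonneg mult_left_mono square_int[unfolded power2_eq_square] simp: power2_eq_square)
      have "- b * (\<integral>x. u x * cutoff m x \<partial>lborel) \<le> \<bar>b\<bar> * (\<integral>x. (u x)\<^sup>2 \<partial>lborel)"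
        using 2 by (intro mult_mono) auto
      moreover have "cut_form u (cutoff m) \<le> cut_form u u"
        unfolding cut_form_def using u_nonneg cutoff_le
        by (intro integral_mono' far_energy_integrable mult_left_mono mult_nonneg_nonneg) auto
      ultimately show ?thesis
        using 1 k_pos c_pos by (intro add_mono divide_right_mono mult_left_mono) auto
    qed
    finally show ?thesis by (simp add: B_def)
  qed
  define Z0 where "Z0 = (\<lambda>p. near_ker (fst p - snd p) * (u (fst p) - u (snd p))\<^sup>2)"
  have "(\<integral>\<^sup>+p. ennreal (Z0 p) \<partial>?P) = (\<integral>\<^sup>+p. liminf (\<lambda>m. ennreal (Z m p)) \<partial>?P)"
  proof (rule nn_integral_cong)
    fix p :: "'a \<times> 'a"
    have "(\<lambda>m. Z m p) \<longlonglongrightarrow> near_ker (fst p - snd p) * (1 * u (fst p) - 1 * u (snd p))\<^sup>2"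
      unfolding Z_def by (intro tendsto_intros hat_tendsto)
    then have "(\<lambda>m. ennreal (Z m p)) \<longlonglongrightarrow> ennreal (Z0 p)"
      by (intro tendsto_ennrealI) (simp add: Z0_def)
    then show "ennreal (Z0 p) = liminf (\<lambda>m. ennreal (Z m p))"
      by (intro lim_imp_Liminf[symmetric]) auto
  qed
  also have "\<dots> \<le> liminf (\<lambda>m. \<integral>\<^sup>+p. ennreal (Z m p) \<partial>?P)"
    by (rule nn_integral_liminf) measurable
  also have "\<dots> \<le> ennreal B"
  proof -
    have "(\<integral>\<^sup>+p. ennreal (Z m p) \<partial>?P) \<le> ennreal B" for m
      using Z_bound[of m] by (subst nn_integral_eq_integral[OF Z_int]) (auto simp: Z_def intro: ennreal_leI)
    then show ?thesis
      by (intro Liminf_le) auto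
  qed
  finally have "(\<integral>\<^sup>+p. ennreal (Z0 p) \<partial>?P) < \<infinity>"
    using ennreal_less_top le_less_trans by fastforce
  then have "integrable ?P Z0"
    by (intro integrableI_nonneg) (auto simp: Z0_def)
  then show ?thesis
    by (simp add: Z0_def power2_eq_square mult.assoc)
qed

theorem energy_identity:
  "c * (near_form u u / 2 - cut_form u u) + b * (\<integral>x. (u x)\<^sup>2 \<partial>lborel) = k * (\<integral>x. (u x)\<^sup>2 * ln (u x) \<partial>lborel)"
proof -
  let ?P = "lborel \<Otimes>\<^sub>M lborel :: ('a \<times> 'a) measure"
  have cutoff_lim: "(\<lambda>m. cutoff m x) \<longlonglongrightarrow> u x" for x
  proof -
    have "(\<lambda>m. cutoff m x) \<longlonglongrightarrow> 1\<^sup>2 * u x"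
      unfolding cutoff_def by (intro tendsto_intros hat_tendsto)
    then show ?thesis by simp
  qed
  have near: "(\<lambda>m. near_form u (cutoff m)) \<longlonglongrightarrow> near_form u u"
    unfolding near_form_def
  proof (rule integral_dominated_convergence)
    let ?w = "\<lambda>p. 2 * (near_ker (fst p - snd p) * (u (fst p) - u (snd p)) * (u (fst p) - u (snd p)))
      + near_ker (fst p - snd p) * (norm (fst p - snd p))\<^sup>2 * (u (snd p))\<^sup>2"
    show "integrable ?P ?w"
      by (intro Bochner_Integration.integrable_add integrable_mult_right near_energy_integrable square_near_integrable)
    fix m
    show "AE p in ?P. norm (near_ker (fst p - snd p) * (u (fst p) - u (snd p)) * (cutoff m (fst p) - cutoff m (snd p))) \<le> ?w p"
    proof (rule AE_I2)
      fix p :: "'a \<times> 'a"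
      obtain x y where p: "p = (x, y)" by (cases p)
      let ?d = "\<bar>u x - u y\<bar>" and ?z = "norm (x - y)"
      have "cutoff m x - cutoff m y = (hat m x)\<^sup>2 * (u x - u y) + (hat m x - hat m y) * (hat m x + hat m y) * u y"
        by (simp add: cutoff_def power2_eq_square algebra_simps)
      then have "\<bar>cutoff m x - cutoff m y\<bar> \<le> (hat m x)\<^sup>2 * ?d + \<bar>hat m x - hat m y\<bar> * (hat m x + hat m y) * u y"
        using u_nonneg[of y] by (metis (no_types, lifting) abs_mult abs_of_nonneg abs_power2 abs_triangle_ineq add_nonneg_nonneg hat_bounds(1))
      also have "\<dots> \<le> 1 * ?d + ?z * 2 * u y"
        using hat_diff_le[of m x y] u_nonneg[of y] add_mono[OF hat_bounds(2)[of m x] hat_bounds(2)[of m y]]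
        by (intro add_mono mult_mono power_le_one mult_nonneg_nonneg) auto
      finally have "?d * \<bar>cutoff m x - cutoff m y\<bar> \<le> ?d * (?d + 2 * (?z * u y))"
        by (intro mult_left_mono) auto
      also have "\<dots> \<le> 2 * (?d * ?d) + ?z\<^sup>2 * (u y)\<^sup>2"
        using sum_squares_bound[of ?d "?z * u y"] by (simp add: power2_eq_square algebra_simps)
      finally have "?d * \<bar>cutoff m x - cutoff m y\<bar> \<le> 2 * (?d * ?d) + ?z\<^sup>2 * (u y)\<^sup>2" .
      then have "near_ker (x - y) * (?d * \<bar>cutoff m x - cutoff m y\<bar>) \<le> near_ker (x - y) * (2 * (?d * ?d) + ?z\<^sup>2 * (u y)\<^sup>2)"
        by (intro mult_left_mono) auto
      then show "norm (near_ker (fst p - snd p) * (u (fst p) - u (snd p)) * (cutoff m (fst p) - cutoff m (snd p))) \<le> ?w p"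
        by (simp add: p abs_mult distrib_left mult.assoc mult.left_commute)
    qed
    show "AE p in ?P. (\<lambda>m. near_ker (fst p - snd p) * (u (fst p) - u (snd p)) * (cutoff m (fst p) - cutoff m (snd p)))
      \<longlonglongrightarrow> near_ker (fst p - snd p) * (u (fst p) - u (snd p)) * (u (fst p) - u (snd p))"
      by (intro AE_I2 tendsto_intros cutoff_lim)
  qed measurable
  have cut: "(\<lambda>m. cut_form u (cutoff m)) \<longlonglongrightarrow> cut_form u u"
    unfolding cut_form_def
  proof (rule integral_dominated_convergence)
    show "integrable ?P (\<lambda>p. cut_ker 1 (fst p - snd p) * u (snd p) * u (fst p))"
      by (rule far_energy_integrable)
    show "AE p in ?P. norm (cut_ker 1 (fst p - snd p) * u (snd p) * cutoff m (fst p)) \<le> cut_ker 1 (fst p - snd p) * u (snd p) * u (fst p)" for m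
      using u_nonneg cutoff_le by (intro AE_I2) (auto simp: abs_mult intro!: mult_left_mono)
    show "AE p in ?P. (\<lambda>m. cut_ker 1 (fst p - snd p) * u (snd p) * cutoff m (fst p)) \<longlonglongrightarrow> cut_ker 1 (fst p - snd p) * u (snd p) * u (fst p)"
      by (intro AE_I2 tendsto_intros cutoff_lim)
  qed measurable
  have sq: "(\<lambda>m. \<integral>x. u x * cutoff m x \<partial>lborel) \<longlonglongrightarrow> (\<integral>x. u x * u x \<partial>lborel)"
  proof (rule integral_dominated_convergence)
    show "integrable lborel (\<lambda>x. u x * u x)" using square_int by (simp add: power2_eq_square)
    show "AE x in lborel. norm (u x * cutoff m x) \<le> u x * u x" for m
      using u_nonneg cutoff_le by (intro AE_I2) (auto simp: abs_mult intro!: mult_left_mono)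
    show "AE x in lborel. (\<lambda>m. u x * cutoff m x) \<longlonglongrightarrow> u x * u x"
      by (intro AE_I2 tendsto_intros cutoff_lim)
  qed measurable
  have ent: "(\<lambda>m. \<integral>x. u x * ln (u x) * cutoff m x \<partial>lborel) \<longlonglongrightarrow> (\<integral>x. u x * ln (u x) * u x \<partial>lborel)"
  proof (rule integral_dominated_convergence)
    show "integrable lborel (\<lambda>x. \<bar>(u x)\<^sup>2 * ln (u x)\<bar>)" using entropy_int by simp
    show "AE x in lborel. norm (u x * ln (u x) * cutoff m x) \<le> \<bar>(u x)\<^sup>2 * ln (u x)\<bar>" for m
    proof (rule AE_I2)
      fix x
      have "u x * \<bar>ln (u x)\<bar> * cutoff m x \<le> u x * \<bar>ln (u x)\<bar> * u x"
        using cutoff_le[of m x] u_nonneg[of x] by (intro mult_left_mono) auto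
      then show "norm (u x * ln (u x) * cutoff m x) \<le> \<bar>(u x)\<^sup>2 * ln (u x)\<bar>"
        using u_nonneg[of x] cutoff_le(1)[of m x] by (simp add: abs_mult power2_eq_square mult_ac)
    qed
    show "AE x in lborel. (\<lambda>m. u x * ln (u x) * cutoff m x) \<longlonglongrightarrow> u x * ln (u x) * u x"
      by (intro AE_I2 tendsto_intros cutoff_lim)
  qed measurable
  have "(\<lambda>m. c * (near_form u (cutoff m) / 2 - cut_form u (cutoff m)) + b * (\<integral>x. u x * cutoff m x \<partial>lborel))
    \<longlonglongrightarrow> c * (near_form u u / 2 - cut_form u u) + b * (\<integral>x. u x * u x \<partial>lborel)"
    by (intro tendsto_intros near cut sq) simp
  then have "(\<lambda>m. k * (\<integral>x. u x * ln (u x) * cutoff m x \<partial>lborel)) \<longlonglongrightarrow> c * (near_form u u / 2 - cut_form u u) + b * (\<integral>x. u x * u x \<partial>lborel)"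
    unfolding weak_equation_cutoff .
  moreover have "(\<lambda>m. k * (\<integral>x. u x * ln (u x) * cutoff m x \<partial>lborel)) \<longlonglongrightarrow> k * (\<integral>x. u x * ln (u x) * u x \<partial>lborel)"
    by (intro tendsto_intros ent)
  ultimately have "c * (near_form u u / 2 - cut_form u u) + b * (\<integral>x. u x * u x \<partial>lborel) = k * (\<integral>x. u x * ln (u x) * u x \<partial>lborel)"
    by (rule LIMSEQ_unique)
  then show ?thesis by (simp add: power2_eq_square mult_ac)
qed

end

section \<open>Change of variables along one coordinate\<close>

lemma lborel_distr_increasing:
  fixes \<psi> \<psi>' :: "real \<Rightarrow> real"
  assumes deriv: "\<And>y. (\<psi> has_real_derivative \<psi>' y) (at y)" and pos: "\<And>y. \<psi>' y > 0"
    and [measurable]: "\<psi>' \<in> borel_measurable borel" and surj: "surj \<psi>"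
  shows "distr (density lborel (\<lambda>y. ennreal (\<psi>' y))) borel \<psi> = lborel"
proof (rule lborel_eqI[symmetric])
  have mono: "strict_mono \<psi>"
  proof (rule strict_monoI)
    fix y z :: real assume "y < z"
    then show "\<psi> y < \<psi> z"
      by (rule DERIV_pos_imp_increasing) (use deriv pos in auto)
  qed
  have "isCont \<psi> y" for y
    by (rule DERIV_isCont[OF deriv])
  then have "continuous_on UNIV \<psi>" by (simp add: continuous_at_imp_continuous_on)
  then have [measurable]: "\<psi> \<in> borel_measurable borel" by (rule borel_measurable_continuous_onI)
  fix l u :: real
  assume lu': "\<And>b. b \<in> Basis \<Longrightarrow> l \<bullet> b \<le> u \<bullet> b"
  then have lu: "l \<le> u" by simp
  obtain a b where ab: "\<psi> a = l" "\<psi> b = u" using surj unfolding surj_def by metis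
  then have "a \<le> b" using mono lu by (metis strict_mono_less_eq)
  have [measurable]: "\<psi> -` {l<..<u} \<in> sets borel"
    using measurable_sets[of \<psi> borel borel "{l<..<u}"] by simp
  have "emeasure (distr (density lborel (\<lambda>y. ennreal (\<psi>' y))) borel \<psi>) (box l u)
    = (\<integral>\<^sup>+y. ennreal (\<psi>' y) * indicator (\<psi> -` {l<..<u}) y \<partial>lborel)"
    by (subst emeasure_distr) (auto simp: emeasure_density)
  also have "\<psi> -` {l<..<u} = {a<..<b}"
    using mono unfolding ab[symmetric] by (auto simp: strict_mono_less)
  also have "(\<integral>\<^sup>+y. ennreal (\<psi>' y) * indicator {a<..<b} y \<partial>lborel) = (\<integral>\<^sup>+y. ennreal (\<psi>' y) * indicator {a..b} y \<partial>lborel)"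
    by (intro nn_integral_cong_AE AE_I[where N="{a, b}"]) (auto split: split_indicator intro!: emeasure_lborel_countable)
  also have "\<dots> = ennreal (\<psi> b - \<psi> a)"
    using \<open>a \<le> b\<close> deriv pos by (intro nn_integral_FTC_Icc) (auto intro: less_imp_le)
  finally show "emeasure (distr (density lborel (\<lambda>y. ennreal (\<psi>' y))) borel \<psi>) (box l u) = (\<Prod>b\<in>Basis. (u - l) \<bullet> b)"
    by (simp add: ab)
qed simp

lemma nn_integral_lborel_split:
  fixes f :: "'a::euclidean_space \<Rightarrow> ennreal"
  assumes e: "e \<in> Basis" and [measurable]: "f \<in> borel_measurable borel"
  shows "(\<integral>\<^sup>+x. f x \<partial>lborel) =
    (\<integral>\<^sup>+w. (\<integral>\<^sup>+y. f ((\<Sum>b\<in>Basis - {e}. w b *\<^sub>R b) + y *\<^sub>R e) \<partial>lborel) \<partial>(\<Pi>\<^sub>M b\<in>Basis - {e}. lborel))"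
proof -
  interpret product_sigma_finite "\<lambda>_::'a. lborel :: real measure" by standard
  have B: "Basis = insert e (Basis - {e})" using e by auto
  have "(\<integral>\<^sup>+x. f x \<partial>lborel) = (\<integral>\<^sup>+w. f (\<Sum>b\<in>Basis. w b *\<^sub>R b) \<partial>(\<Pi>\<^sub>M b\<in>Basis. lborel))"
    by (subst lborel_eq, subst nn_integral_distr) measurable
  also have "\<dots> = (\<integral>\<^sup>+w. f (\<Sum>b\<in>Basis. w b *\<^sub>R b) \<partial>(\<Pi>\<^sub>M b\<in>insert e (Basis - {e}). lborel))"
    using B by simp
  also have "\<dots> = (\<integral>\<^sup>+w. (\<integral>\<^sup>+y. f (\<Sum>b\<in>Basis. (w(e := y)) b *\<^sub>R b) \<partial>lborel) \<partial>(\<Pi>\<^sub>M b\<in>Basis - {e}. lborel))"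
  proof (rule product_nn_integral_insert)
    have "(\<lambda>w. f (\<Sum>b\<in>Basis. w b *\<^sub>R b)) \<in> borel_measurable (\<Pi>\<^sub>M b\<in>Basis. lborel)"
      by measurable
    then show "(\<lambda>w. f (\<Sum>b\<in>Basis. w b *\<^sub>R b)) \<in> borel_measurable (\<Pi>\<^sub>M b\<in>insert e (Basis - {e}). lborel)"
      using B by simp
  qed auto
  also have "\<dots> = (\<integral>\<^sup>+w. (\<integral>\<^sup>+y. f ((\<Sum>b\<in>Basis - {e}. w b *\<^sub>R b) + y *\<^sub>R e) \<partial>lborel) \<partial>(\<Pi>\<^sub>M b\<in>Basis - {e}. lborel))"
  proof -
    have "(\<Sum>b\<in>Basis. (w(e := y)) b *\<^sub>R b) = (\<Sum>b\<in>Basis - {e}. w b *\<^sub>R b) + y *\<^sub>R e" for w y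
      using e by (subst sum.remove[OF _ e]) (auto intro!: sum.cong simp: add.commute)
    then show ?thesis by simp
  qed
  finally show ?thesis .
qed

lemma lborel_distr_shear:
  fixes G G' :: "'a::euclidean_space \<Rightarrow> real"
  assumes e: "e \<in> Basis" and [measurable]: "G \<in> borel_measurable borel" "G' \<in> borel_measurable borel"
    and deriv: "\<And>x s. ((\<lambda>s. G (x + s *\<^sub>R e)) has_real_derivative G' (x + s *\<^sub>R e)) (at s)"
    and pos: "\<And>x. 1 + G' x > 0" and bounded: "\<And>x. \<bar>G x\<bar> \<le> K"
  shows "distr (density lborel (\<lambda>x. ennreal (1 + G' x))) borel (\<lambda>x. x + G x *\<^sub>R e) = lborel"
    and "surj (\<lambda>x. x + G x *\<^sub>R e)"
proof -
  have d\<psi>: "((\<lambda>s. s + G (x + s *\<^sub>R e)) has_real_derivative 1 + G' (x + s *\<^sub>R e)) (at s)" for x s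
    by (intro derivative_intros deriv)
  have surj: "\<exists>s. s + G (x + s *\<^sub>R e) = v" for x v
  proof -
    have "\<exists>s\<ge>v - K. s \<le> v + K \<and> s + G (x + s *\<^sub>R e) = v"
    proof (rule IVT)
      show "v - K + G (x + (v - K) *\<^sub>R e) \<le> v" "v \<le> v + K + G (x + (v + K) *\<^sub>R e)"
        using bounded[of "x + (v - K) *\<^sub>R e"] bounded[of "x + (v + K) *\<^sub>R e"] by (auto simp: abs_le_iff)
      show "v - K \<le> v + K" using bounded[of 0] by simp
      show "\<forall>s. v - K \<le> s \<and> s \<le> v + K \<longrightarrow> isCont (\<lambda>s. s + G (x + s *\<^sub>R e)) s"
        by (intro allI impI DERIV_isCont[OF d\<psi>])
    qed
    then show ?thesis by blast
  qed
  show "surj (\<lambda>x. x + G x *\<^sub>R e)"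
  proof (rule surjI)
    fix v
    define s where "s = (SOME s. s + G (v + s *\<^sub>R e) = 0)"
    have "s + G (v + s *\<^sub>R e) = 0"
      unfolding s_def using surj by (rule someI_ex)
    then have "s *\<^sub>R e + G (v + s *\<^sub>R e) *\<^sub>R e = 0" by (simp flip: scaleR_add_left)
    then show "(v + (SOME s. s + G (v + s *\<^sub>R e) = 0) *\<^sub>R e) + G (v + (SOME s. s + G (v + s *\<^sub>R e) = 0) *\<^sub>R e) *\<^sub>R e = v"
      unfolding s_def[symmetric] by (simp add: add.assoc)
  qed
  show "distr (density lborel (\<lambda>x. ennreal (1 + G' x))) borel (\<lambda>x. x + G x *\<^sub>R e) = lborel"
  proof (rule measure_eqI)
    fix A assume "A \<in> sets (distr (density lborel (\<lambda>x. ennreal (1 + G' x))) borel (\<lambda>x. x + G x *\<^sub>R e))"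
    then have [measurable]: "A \<in> sets borel" by simp
    let ?T = "\<lambda>w. \<Sum>b\<in>Basis - {e}. w b *\<^sub>R b :: 'a"
    have "emeasure (distr (density lborel (\<lambda>x. ennreal (1 + G' x))) borel (\<lambda>x. x + G x *\<^sub>R e)) A
      = (\<integral>\<^sup>+x. ennreal (1 + G' x) * indicator A (x + G x *\<^sub>R e) \<partial>lborel)"
      by (subst nn_integral_indicator[symmetric], simp, subst nn_integral_distr) (auto simp: nn_integral_density)
    also have "\<dots> = (\<integral>\<^sup>+w. (\<integral>\<^sup>+y. ennreal (1 + G' (?T w + y *\<^sub>R e)) *
        indicator A (?T w + y *\<^sub>R e + G (?T w + y *\<^sub>R e) *\<^sub>R e) \<partial>lborel) \<partial>(\<Pi>\<^sub>M b\<in>Basis - {e}. lborel))"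
      using e by (rule nn_integral_lborel_split) measurable
    also have "\<dots> = (\<integral>\<^sup>+w. (\<integral>\<^sup>+y. indicator A (?T w + y *\<^sub>R e) \<partial>lborel) \<partial>(\<Pi>\<^sub>M b\<in>Basis - {e}. lborel))"
    proof (rule nn_integral_cong)
      fix w :: "'a \<Rightarrow> real"
      let ?\<psi> = "\<lambda>s. s + G (?T w + s *\<^sub>R e)" and ?\<psi>' = "\<lambda>s. 1 + G' (?T w + s *\<^sub>R e)"
      have eq: "lborel = distr (density lborel (\<lambda>y. ennreal (?\<psi>' y))) borel ?\<psi>"
      proof (rule lborel_distr_increasing[symmetric])
        show "surj ?\<psi>" unfolding surj_def using surj by metis
      qed (use d\<psi> pos in auto)
      have "(\<integral>\<^sup>+y. indicator A (?T w + y *\<^sub>R e) \<partial>lborel)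
        = (\<integral>\<^sup>+y. indicator A (?T w + ?\<psi> y *\<^sub>R e) \<partial>(density lborel (\<lambda>y. ennreal (?\<psi>' y))))"
        by (subst eq, subst nn_integral_distr) measurable
      also have "\<dots> = (\<integral>\<^sup>+y. ennreal (?\<psi>' y) * indicator A (?T w + ?\<psi> y *\<^sub>R e) \<partial>lborel)"
        by (subst nn_integral_density) measurable
      finally show "(\<integral>\<^sup>+y. ennreal (1 + G' (?T w + y *\<^sub>R e)) * indicator A (?T w + y *\<^sub>R e + G (?T w + y *\<^sub>R e) *\<^sub>R e) \<partial>lborel)
        = (\<integral>\<^sup>+y. indicator A (?T w + y *\<^sub>R e) \<partial>lborel)"
        by (simp add: scaleR_add_left add.assoc)
    qed
    also have "\<dots> = (\<integral>\<^sup>+x. indicator A x \<partial>lborel)"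
      using e by (rule nn_integral_lborel_split[symmetric]) measurable
    also have "\<dots> = emeasure lborel A" by simp
    finally show "emeasure (distr (density lborel (\<lambda>x. ennreal (1 + G' x))) borel (\<lambda>x. x + G x *\<^sub>R e)) A = emeasure lborel A" .
  qed simp
qed

lemma
  fixes \<Phi> :: "'a::euclidean_space \<Rightarrow> 'a" and J :: "'a \<Rightarrow> real" and f :: "'a \<Rightarrow> real" and F :: "'a \<times> 'a \<Rightarrow> real"
  assumes distr: "distr (density lborel (\<lambda>x. ennreal (J x))) borel \<Phi> = lborel"
    and [measurable]: "\<Phi> \<in> borel_measurable borel" "J \<in> borel_measurable borel" and J: "\<And>x. J x \<ge> 0"
  shows integral_lborel_substitution: "f \<in> borel_measurable borel \<Longrightarrow> (\<integral>x. f x \<partial>lborel) = (\<integral>x. J x * f (\<Phi> x) \<partial>lborel)"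
    and integral_lborel_pair_substitution: "F \<in> borel_measurable (lborel \<Otimes>\<^sub>M lborel) \<Longrightarrow>
      (\<integral>p. F p \<partial>(lborel \<Otimes>\<^sub>M lborel)) = (\<integral>p. J (fst p) * J (snd p) * F (\<Phi> (fst p), \<Phi> (snd p)) \<partial>(lborel \<Otimes>\<^sub>M lborel))"
proof -
  show "(\<integral>x. f x \<partial>lborel) = (\<integral>x. J x * f (\<Phi> x) \<partial>lborel)" if [measurable]: "f \<in> borel_measurable borel"
    by (subst distr[symmetric], subst integral_distr) (use J in \<open>auto simp: integral_density\<close>)
  let ?D = "density lborel (\<lambda>x. ennreal (J x))"
  have sf: "sigma_finite_measure (distr ?D borel \<Phi>)"
    unfolding distr by unfold_locales
  then have sf': "sigma_finite_measure ?D"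
    by (rule sigma_finite_measure_distr) simp
  have "lborel \<Otimes>\<^sub>M lborel = distr ?D borel \<Phi> \<Otimes>\<^sub>M distr ?D borel \<Phi>"
    by (simp add: distr)
  also have "\<dots> = distr (?D \<Otimes>\<^sub>M ?D) (borel \<Otimes>\<^sub>M borel) (\<lambda>(x, y). (\<Phi> x, \<Phi> y))"
    using sf by (intro pair_measure_distr) auto
  also have "?D \<Otimes>\<^sub>M ?D = density (lborel \<Otimes>\<^sub>M lborel) (\<lambda>(x, y). ennreal (J x) * ennreal (J y))"
    using sf' by (intro pair_measure_density) (auto intro: lborel.sigma_finite_measure_axioms)
  also have "(\<lambda>(x, y). ennreal (J x) * ennreal (J y)) = (\<lambda>p. ennreal (J (fst p) * J (snd p)))"
    using J by (auto simp: ennreal_mult)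
  finally have eq: "lborel \<Otimes>\<^sub>M lborel = distr (density (lborel \<Otimes>\<^sub>M lborel) (\<lambda>p. ennreal (J (fst p) * J (snd p)))) (borel \<Otimes>\<^sub>M borel) (\<lambda>(x, y). (\<Phi> x, \<Phi> y))" .
  have sets: "borel_measurable (lborel \<Otimes>\<^sub>M lborel) = borel_measurable (borel \<Otimes>\<^sub>M (borel :: 'a measure))"
    by (intro measurable_cong_sets sets_pair_measure_cong) auto
  show "(\<integral>p. F p \<partial>(lborel \<Otimes>\<^sub>M lborel)) = (\<integral>p. J (fst p) * J (snd p) * F (\<Phi> (fst p), \<Phi> (snd p)) \<partial>(lborel \<Otimes>\<^sub>M lborel))"
    if "F \<in> borel_measurable (lborel \<Otimes>\<^sub>M lborel)"
  proof -
    have [measurable]: "F \<in> borel_measurable (borel \<Otimes>\<^sub>M borel)" using that sets by blast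
    show ?thesis
      by (subst eq, subst integral_distr) (use J in \<open>auto simp: integral_density case_prod_unfold\<close>)
  qed
qed

definition bump :: "real \<Rightarrow> 'a::euclidean_space \<Rightarrow> real" where
  "bump \<rho> x = max 0 (1 - (norm x)\<^sup>2 / \<rho>\<^sup>2)"

definition vfield :: "real \<Rightarrow> 'a \<Rightarrow> 'a::euclidean_space \<Rightarrow> real" where
  "vfield \<rho> e x = (x \<bullet> e) * (bump \<rho> x)\<^sup>2"

definition vfield_deriv :: "real \<Rightarrow> 'a \<Rightarrow> 'a::euclidean_space \<Rightarrow> real" where
  "vfield_deriv \<rho> e x = (bump \<rho> x)\<^sup>2 - 4 * bump \<rho> x * (x \<bullet> e)\<^sup>2 / \<rho>\<^sup>2"

lemma bump_measurable [measurable]: "bump \<rho> \<in> borel_measurable borel"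
  unfolding bump_def by measurable

lemma vfield_measurable [measurable]: "vfield \<rho> e \<in> borel_measurable borel"
  unfolding vfield_def by measurable

lemma vfield_deriv_measurable [measurable]: "vfield_deriv \<rho> e \<in> borel_measurable borel"
  unfolding vfield_deriv_def by measurable

lemma bump_bounds [simp]: "bump \<rho> x \<ge> 0" "bump \<rho> x \<le> 1"
  by (auto simp: bump_def)

lemma bump_eq_0:
  assumes "\<rho> > 0" "norm x \<ge> \<rho>"
  shows "bump \<rho> x = 0"
proof -
  have "\<rho>\<^sup>2 \<le> (norm x)\<^sup>2" using assms by (intro power_mono) auto
  then show ?thesis using assms(1) by (simp add: bump_def le_divide_eq)
qed

lemma abs_inner_Basis_le: "e \<in> Basis \<Longrightarrow> \<bar>x \<bullet> e\<bar> \<le> norm (x::'a::euclidean_space)"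
  using Cauchy_Schwarz_ineq2[of x e] by simp

lemma vfield_deriv_le:
  assumes "\<rho> > 0" "e \<in> Basis"
  shows "\<bar>vfield_deriv \<rho> e x\<bar> \<le> 5"
proof (cases "norm x \<ge> \<rho>")
  case True
  then show ?thesis using assms by (simp add: vfield_deriv_def bump_eq_0)
next
  case False
  have "(x \<bullet> e)\<^sup>2 \<le> \<rho>\<^sup>2"
    using abs_inner_Basis_le[OF assms(2), of x] False by (intro abs_le_square_iff[THEN iffD1]) simp
  then have "bump \<rho> x * ((x \<bullet> e)\<^sup>2 / \<rho>\<^sup>2) \<le> 1 * 1"
    using assms by (intro mult_mono) (auto simp: divide_le_eq)
  moreover have "bump \<rho> x * ((x \<bullet> e)\<^sup>2 / \<rho>\<^sup>2) \<ge> 0" by simp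
  moreover have "(bump \<rho> x)\<^sup>2 \<le> 1" "(bump \<rho> x)\<^sup>2 \<ge> 0" by (simp_all add: power_le_one)
  moreover have "vfield_deriv \<rho> e x = (bump \<rho> x)\<^sup>2 - 4 * (bump \<rho> x * ((x \<bullet> e)\<^sup>2 / \<rho>\<^sup>2))"
    by (simp add: vfield_deriv_def)
  ultimately show ?thesis by linarith
qed

lemma DERIV_max_0_square: "((\<lambda>q::real. (max 0 (1 - q))\<^sup>2) has_real_derivative - 2 * max 0 (1 - q)) (at q)"
proof -
  have "((\<lambda>v::real. (max 0 v)\<^sup>2) has_real_derivative 2 * max 0 v) (at v)" for v
  proof -
    consider "v < 0" | "v = 0" | "v > 0" by linarith
    then show ?thesis
    proof cases
      case 1
      have "((\<lambda>v::real. 0) has_real_derivative 0) (at v)" by simp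
      then have "((\<lambda>v::real. (max 0 v)\<^sup>2) has_real_derivative 0) (at v)"
        by (rule has_field_derivative_transform_within_open[where S="{..<0}"]) (use 1 in auto)
      then show ?thesis using 1 by simp
    next
      case 2
      have "isCont (\<lambda>z::real. max 0 z) 0" by (intro continuous_intros)
      then show ?thesis unfolding CARAT_DERIV
        by (intro exI[of _ "\<lambda>z. max 0 z"]) (auto simp: 2 max_def power2_eq_square)
    next
      case 3
      have "((\<lambda>v::real. v\<^sup>2) has_real_derivative 2 * v) (at v)" by (auto intro!: derivative_eq_intros)
      then have "((\<lambda>v::real. (max 0 v)\<^sup>2) has_real_derivative 2 * v) (at v)"
        by (rule has_field_derivative_transform_within_open[where S="{0<..}"]) (use 3 in auto)
      then show ?thesis using 3 by simp
    qed
  qed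
  moreover have "((\<lambda>q::real. 1 - q) has_real_derivative -1) (at q)"
    by (auto intro!: derivative_eq_intros)
  ultimately have "((\<lambda>q::real. (max 0 (1 - q))\<^sup>2) has_real_derivative 2 * max 0 (1 - q) * -1) (at q)"
    by (rule DERIV_chain2)
  then show ?thesis by simp
qed

lemma vfield_has_derivative:
  assumes "\<rho> > 0"
  shows "(vfield \<rho> e has_derivative (\<lambda>h. (h \<bullet> e) * (bump \<rho> x)\<^sup>2 - 4 * bump \<rho> x * (x \<bullet> e) * (x \<bullet> h) / \<rho>\<^sup>2)) (at x)"
proof -
  have q: "((\<lambda>x. (norm x)\<^sup>2 / \<rho>\<^sup>2) has_derivative (\<lambda>h. 2 * (x \<bullet> h) / \<rho>\<^sup>2)) (at x)"
  proof -
    have "((\<lambda>x. (x \<bullet> x) * inverse (\<rho>\<^sup>2)) has_derivative (\<lambda>h. (x \<bullet> h + h \<bullet> x) * inverse (\<rho>\<^sup>2))) (at x)"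
      by (intro derivative_intros)
    then show ?thesis
      by (simp add: power2_norm_eq_inner divide_inverse inner_commute[of _ x] mult_2[symmetric])
  qed
  have b: "((\<lambda>x. (bump \<rho> x)\<^sup>2) has_derivative (\<lambda>h. 2 * (x \<bullet> h) / \<rho>\<^sup>2 * (- 2 * bump \<rho> x))) (at x)"
    unfolding bump_def
    using has_derivative_compose[OF q DERIV_max_0_square[unfolded has_field_derivative_def]] by (simp add: mult.commute)
  show ?thesis
    unfolding vfield_def
    by (rule has_derivative_eq_rhs[OF has_derivative_mult[OF has_derivative_inner_left[OF has_derivative_ident] b]])
      (auto simp: fun_eq_iff)
qed

lemma vfield_lipschitz:
  assumes "\<rho> > 0" "e \<in> Basis"
  shows "\<bar>vfield \<rho> e x - vfield \<rho> e y\<bar> \<le> 5 * norm (x - y)"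
proof -
  have "norm (vfield \<rho> e x - vfield \<rho> e y) \<le> 5 * norm (x - y)"
  proof (rule differentiable_bound[OF convex_UNIV vfield_has_derivative[OF assms(1)]])
    fix z :: 'a
    show "onorm (\<lambda>h. (h \<bullet> e) * (bump \<rho> z)\<^sup>2 - 4 * bump \<rho> z * (z \<bullet> e) * (z \<bullet> h) / \<rho>\<^sup>2) \<le> 5"
    proof (rule onorm_le)
      fix h
      have 1: "\<bar>(h \<bullet> e) * (bump \<rho> z)\<^sup>2\<bar> \<le> norm h * 1"
        unfolding abs_mult using abs_inner_Basis_le[OF assms(2), of h] by (intro mult_mono) (auto simp: power_le_one)
      have 2: "\<bar>4 * bump \<rho> z * (z \<bullet> e) * (z \<bullet> h) / \<rho>\<^sup>2\<bar> \<le> 4 * norm h"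
      proof (cases "norm z \<ge> \<rho>")
        case True
        then show ?thesis using assms by (simp add: bump_eq_0)
      next
        case False
        have "\<bar>4 * bump \<rho> z * (z \<bullet> e) * (z \<bullet> h) / \<rho>\<^sup>2\<bar> = 4 * bump \<rho> z * \<bar>z \<bullet> e\<bar> * \<bar>z \<bullet> h\<bar> / \<rho>\<^sup>2"
          by (simp add: abs_mult)
        also have "\<dots> \<le> 4 * 1 * \<rho> * (\<rho> * norm h) / \<rho>\<^sup>2"
        proof (intro divide_right_mono mult_mono)
          show "\<bar>z \<bullet> e\<bar> \<le> \<rho>" using abs_inner_Basis_le[OF assms(2), of z] False by simp
          have "\<bar>z \<bullet> h\<bar> \<le> norm z * norm h" by (rule Cauchy_Schwarz_ineq2)
          also have "\<dots> \<le> \<rho> * norm h" using False by (intro mult_right_mono) auto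
          finally show "\<bar>z \<bullet> h\<bar> \<le> \<rho> * norm h" .
        qed (use assms in auto)
        also have "\<dots> = 4 * norm h" using assms(1) by (simp add: power2_eq_square)
        finally show ?thesis .
      qed
      show "norm ((h \<bullet> e) * (bump \<rho> z)\<^sup>2 - 4 * bump \<rho> z * (z \<bullet> e) * (z \<bullet> h) / \<rho>\<^sup>2) \<le> 5 * norm h"
        using 1 2 unfolding real_norm_def by linarith
    qed
  qed auto
  then show ?thesis by simp
qed

lemma vfield_line_deriv:
  assumes "\<rho> > 0" "e \<in> Basis"
  shows "((\<lambda>s. vfield \<rho> e (x + s *\<^sub>R e)) has_real_derivative vfield_deriv \<rho> e (x + s *\<^sub>R e)) (at s)"
proof -
  have "((\<lambda>s. x + s *\<^sub>R e) has_derivative (\<lambda>h. h *\<^sub>R e)) (at s)"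
    by (auto intro!: derivative_eq_intros)
  note d = has_derivative_compose[OF this vfield_has_derivative[OF assms(1), of e]]
  show ?thesis
    unfolding has_field_derivative_def
    by (rule has_derivative_eq_rhs[OF d])
      (use assms(2) in \<open>auto simp: fun_eq_iff vfield_deriv_def power2_eq_square right_diff_distrib left_diff_distrib diff_divide_distrib\<close>)
qed

lemma vfield_le:
  assumes "\<rho> > 0" "e \<in> Basis"
  shows "\<bar>vfield \<rho> e x\<bar> \<le> \<rho>"
proof (cases "norm x \<ge> \<rho>")
  case False
  have "\<bar>vfield \<rho> e x\<bar> \<le> \<rho> * 1"
    unfolding vfield_def abs_mult using False abs_inner_Basis_le[OF assms(2), of x]
    by (intro mult_mono) (auto simp: power_le_one)
  then show ?thesis by simp
qed (use assms in \<open>simp add: vfield_def bump_eq_0\<close>)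

lemma vfield_eq_0: "\<rho> > 0 \<Longrightarrow> norm x \<ge> \<rho> \<Longrightarrow> vfield \<rho> e x = 0"
  by (simp add: vfield_def bump_eq_0)

lemma bump_tendsto: "(\<lambda>m. bump (real (Suc m)) x) \<longlonglongrightarrow> 1"
proof -
  have "(\<lambda>m. max 0 (1 - (norm x)\<^sup>2 * (inverse (real (Suc m)))\<^sup>2)) \<longlonglongrightarrow> max 0 (1 - (norm x)\<^sup>2 * 0\<^sup>2)"
    by (intro tendsto_intros LIMSEQ_inverse_real_of_nat)
  then show ?thesis by (simp add: bump_def[abs_def] divide_inverse power_inverse)
qed

lemma vfield_tendsto: "(\<lambda>m. vfield (real (Suc m)) e x) \<longlonglongrightarrow> x \<bullet> e"
proof -
  have "(\<lambda>m. vfield (real (Suc m)) e x) \<longlonglongrightarrow> (x \<bullet> e) * 1\<^sup>2"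
    unfolding vfield_def by (intro tendsto_intros bump_tendsto)
  then show ?thesis by simp
qed

lemma vfield_deriv_tendsto: "(\<lambda>m. vfield_deriv (real (Suc m)) e x) \<longlonglongrightarrow> 1"
proof -
  have "(\<lambda>m. (bump (real (Suc m)) x)\<^sup>2 - 4 * bump (real (Suc m)) x * (x \<bullet> e)\<^sup>2 * (inverse (real (Suc m)))\<^sup>2) \<longlonglongrightarrow> 1\<^sup>2 - 4 * 1 * (x \<bullet> e)\<^sup>2 * 0\<^sup>2"
    by (intro tendsto_intros bump_tendsto LIMSEQ_inverse_real_of_nat)
  then show ?thesis by (simp add: vfield_deriv_def[abs_def] divide_inverse power_inverse)
qed

section \<open>A compactly supported deformation of the dilation\<close>

definition shift :: "real \<Rightarrow> 'a \<Rightarrow> real \<Rightarrow> 'a::euclidean_space \<Rightarrow> 'a" where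
  "shift \<rho> e t x = x + (t * vfield \<rho> e x) *\<^sub>R e"

definition jac :: "real \<Rightarrow> 'a \<Rightarrow> real \<Rightarrow> 'a::euclidean_space \<Rightarrow> real" where
  "jac \<rho> e t x = 1 + t * vfield_deriv \<rho> e x"

lemma shift_measurable [measurable]: "shift \<rho> e t \<in> borel_measurable borel"
  unfolding shift_def by measurable

lemma jac_measurable [measurable]: "jac \<rho> e t \<in> borel_measurable borel"
  unfolding jac_def by measurable

context
  fixes \<rho> t :: real and e :: "'a::euclidean_space"
  assumes \<rho>: "\<rho> > 0" and e: "e \<in> Basis" and t: "\<bar>t\<bar> \<le> 1/10"
begin

lemma jac_bounds: "1/2 \<le> jac \<rho> e t x" "jac \<rho> e t x \<le> 3/2"
proof -
  have "\<bar>t * vfield_deriv \<rho> e x\<bar> \<le> 1/10 * 5"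
    unfolding abs_mult using t vfield_deriv_le[OF \<rho> e] by (intro mult_mono) auto
  then show "1/2 \<le> jac \<rho> e t x" "jac \<rho> e t x \<le> 3/2" by (auto simp: jac_def abs_le_iff)
qed

lemma jac_nonneg: "jac \<rho> e t x \<ge> 0"
  using jac_bounds(1)[of x] by linarith

lemma shift_diff_le: "norm ((shift \<rho> e t x - shift \<rho> e t y) - (x - y)) \<le> 5 * \<bar>t\<bar> * norm (x - y)"
proof -
  have "(shift \<rho> e t x - shift \<rho> e t y) - (x - y) = (t * (vfield \<rho> e x - vfield \<rho> e y)) *\<^sub>R e"
    by (simp add: shift_def algebra_simps)
  also have "norm \<dots> = \<bar>t\<bar> * \<bar>vfield \<rho> e x - vfield \<rho> e y\<bar>"
    using e by (simp add: abs_mult)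
  also have "\<dots> \<le> \<bar>t\<bar> * (5 * norm (x - y))"
    by (intro mult_left_mono vfield_lipschitz \<rho> e) auto
  finally show ?thesis by simp
qed

lemma shift_norm_ge: "norm (shift \<rho> e t x - shift \<rho> e t y) \<ge> norm (x - y) / 2"
proof -
  have "5 * \<bar>t\<bar> * norm (x - y) \<le> 1/2 * norm (x - y)"
    using t by (intro mult_right_mono) auto
  then show ?thesis
    using shift_diff_le[of x y] norm_triangle_ineq2[of "x - y" "(x - y) - (shift \<rho> e t x - shift \<rho> e t y)"]
    by (simp add: norm_minus_commute)
qed

lemma shift_distr: "distr (density lborel (\<lambda>x. ennreal (jac \<rho> e t x))) borel (shift \<rho> e t) = lborel"
  and shift_surj: "surj (shift \<rho> e t)"
proof -
  have *: "((\<lambda>s. t * vfield \<rho> e (x + s *\<^sub>R e)) has_real_derivative t * vfield_deriv \<rho> e (x + s *\<^sub>R e)) (at s)" for x s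
    by (intro DERIV_cmult vfield_line_deriv \<rho> e)
  have pos: "1 + t * vfield_deriv \<rho> e x > 0" for x
    using jac_bounds(1)[of x] by (simp add: jac_def)
  have bd: "\<bar>t * vfield \<rho> e x\<bar> \<le> \<bar>t\<bar> * \<rho>" for x
    unfolding abs_mult by (intro mult_left_mono vfield_le \<rho> e) auto
  have eq: "shift \<rho> e t = (\<lambda>x. x + (t * vfield \<rho> e x) *\<^sub>R e)" "jac \<rho> e t = (\<lambda>x. 1 + t * vfield_deriv \<rho> e x)"
    by (auto simp: fun_eq_iff shift_def jac_def)
  show "distr (density lborel (\<lambda>x. ennreal (jac \<rho> e t x))) borel (shift \<rho> e t) = lborel"
    unfolding eq by (rule lborel_distr_shear(1)[OF e _ _ * pos bd]) measurable
  show "surj (shift \<rho> e t)"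
    unfolding eq by (rule lborel_distr_shear(2)[OF e _ _ * pos bd]) measurable
qed

lemma shift_inj: "inj (shift \<rho> e t)"
proof (rule injI)
  fix x y assume "shift \<rho> e t x = shift \<rho> e t y"
  then show "x = y" using shift_norm_ge[of x y] by simp
qed

lemma shift_fixed: "norm x \<ge> \<rho> \<Longrightarrow> shift \<rho> e t x = x"
  using \<rho> by (simp add: shift_def vfield_eq_0)

lemma inv_shift [simp]: "inv (shift \<rho> e t) (shift \<rho> e t x) = x" "shift \<rho> e t (inv (shift \<rho> e t) x) = x"
  using shift_inj shift_surj by (simp_all add: surj_f_inv_f)

lemma inv_shift_norm: "norm (inv (shift \<rho> e t) x - inv (shift \<rho> e t) y) \<le> 2 * norm (x - y)"
  using shift_norm_ge[of "inv (shift \<rho> e t) x" "inv (shift \<rho> e t) y"] by simp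

lemma inv_shift_fixed: "norm x \<ge> \<rho> \<Longrightarrow> inv (shift \<rho> e t) x = x"
  by (metis inv_shift(1) shift_fixed)

lemma inv_shift_inside: "norm x \<le> \<rho> \<Longrightarrow> norm (inv (shift \<rho> e t) x) \<le> \<rho>"
  by (metis inv_shift(2) linear shift_fixed)

lemma inv_shift_dist: "dist (inv (shift \<rho> e t) x) x \<le> \<bar>t\<bar> * \<rho>"
proof -
  have "dist y (shift \<rho> e t y) \<le> \<bar>t\<bar> * \<rho>" for y
    using e vfield_le[OF \<rho> e, of y] by (simp add: shift_def dist_norm abs_mult mult_left_mono)
  from this[of "inv (shift \<rho> e t) x"] show ?thesis by simp
qed

lemma inv_shift_measurable [measurable]: "inv (shift \<rho> e t) \<in> borel_measurable borel"
proof (rule borel_measurable_continuous_onI)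
  show "continuous_on UNIV (inv (shift \<rho> e t))"
  proof (rule continuous_on_iff[THEN iffD2], intro ballI allI impI)
    fix x :: 'a and d :: real assume "d > 0"
    then show "\<exists>\<delta>>0. \<forall>y\<in>UNIV. dist y x < \<delta> \<longrightarrow> dist (inv (shift \<rho> e t) y) (inv (shift \<rho> e t) x) < d"
      by (intro exI[of _ "d / 2"]) (auto simp: dist_norm intro!: le_less_trans[OF inv_shift_norm])
  qed
qed

end

lemma xlnx_superadditive:
  fixes s t :: real
  assumes "0 \<le> t" "t \<le> s"
  shows "t * ln t + (s - t) * ln (s - t) \<le> s * ln s"
proof (cases "t = 0 \<or> t = s")
  case False
  then have "t * ln t + (s - t) * ln (s - t) \<le> t * ln s + (s - t) * ln s"
    using assms by (intro add_mono mult_left_mono) auto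
  then show ?thesis by (simp add: algebra_simps)
qed auto

lemma xlnx_holder:
  fixes s t M :: real
  assumes "0 \<le> s" "s \<le> M" "0 \<le> t" "t \<le> M" "M \<ge> 1"
  shows "\<bar>s * ln s - t * ln t\<bar> \<le> ((ln M + 1) * sqrt M + 2) * sqrt \<bar>s - t\<bar>"
proof -
  have *: "\<bar>s * ln s - t * ln t\<bar> \<le> ((ln M + 1) * sqrt M + 2) * sqrt \<bar>s - t\<bar>" if st: "t < s" "s \<le> M" "0 \<le> t" for s t
  proof -
    define x where "x = s - t"
    have x: "x > 0" "x \<le> M" using st by (auto simp: x_def)
    have M1: "ln M + 1 \<ge> 0" "sqrt M \<ge> 0" using assms(5) by auto
    have sqx: "x = sqrt x * sqrt x" using x by simp
    have "(ln M + 1) * x \<le> (ln M + 1) * (sqrt M * sqrt x)"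
      using x M1 by (subst (1) sqx, intro mult_left_mono mult_right_mono) auto
    then have up: "s * ln s - t * ln t \<le> (ln M + 1) * sqrt M * sqrt x"
      using xlnx_diff_le[of t s M] st by (simp add: x_def mult.assoc)
    have "- ln x = 2 * ln (1 / sqrt x)"
      using x by (simp add: ln_div ln_sqrt)
    also have "\<dots> \<le> 2 * (1 / sqrt x - 1)"
      using x by (intro mult_left_mono ln_le_minus_one) auto
    also have "\<dots> \<le> 2 / sqrt x" by simp
    finally have "x * - ln x \<le> x * (2 / sqrt x)" using x by (intro mult_left_mono) auto
    also have "\<dots> = 2 * (x / sqrt x)" by simp
    also have "x / sqrt x = sqrt x" using x by (intro real_div_sqrt) simp
    finally have low: "s * ln s - t * ln t \<ge> - (2 * sqrt x)"
      using xlnx_superadditive[of t s] st by (simp add: x_def)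
    have nn: "0 \<le> (ln M + 1) * sqrt M * sqrt x" "0 \<le> 2 * sqrt x"
      using M1 x by auto
    have "\<bar>s * ln s - t * ln t\<bar> \<le> (ln M + 1) * sqrt M * sqrt x + 2 * sqrt x"
      using up low nn by linarith
    also have "\<dots> = ((ln M + 1) * sqrt M + 2) * sqrt \<bar>s - t\<bar>"
      using x by (simp add: x_def[symmetric] algebra_simps)
    finally show ?thesis .
  qed
  consider "t < s" | "s < t" | "s = t" by linarith
  then show ?thesis
    using *[of t s] *[of s t] assms by cases (auto simp: abs_minus_commute)
qed

definition entropy_fn :: "real \<Rightarrow> real" where
  "entropy_fn s = s\<^sup>2 * ln s / 2 - s\<^sup>2 / 4"

lemma entropy_fn_measurable [measurable]: "entropy_fn \<in> borel_measurable borel"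
  unfolding entropy_fn_def by measurable

lemma entropy_fn_expansion:
  fixes s t M :: real
  assumes "0 \<le> s" "s \<le> M" "0 \<le> t" "t \<le> M" "M \<ge> 1"
  shows "\<bar>entropy_fn s - entropy_fn t - t * ln t * (s - t)\<bar> \<le> ((ln M + 1) * sqrt M + 2) * (sqrt \<bar>s - t\<bar> * \<bar>s - t\<bar>)"
proof -
  let ?L = "(ln M + 1) * sqrt M + 2"
  have L: "?L > 0" using assms(5) by (intro add_nonneg_pos mult_nonneg_nonneg) auto
  have cont: "continuous_on {0..M} (\<lambda>s. s * ln s)"
  proof (rule continuous_on_iff[THEN iffD2], intro ballI allI impI)
    fix x d :: real assume x: "x \<in> {0..M}" and d: "d > 0"
    show "\<exists>\<delta>>0. \<forall>y\<in>{0..M}. dist y x < \<delta> \<longrightarrow> dist (y * ln y) (x * ln x) < d"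
    proof (intro exI[of _ "(d / ?L)\<^sup>2"] conjI ballI impI)
      fix y assume y: "y \<in> {0..M}" and dy: "dist y x < (d / ?L)\<^sup>2"
      have "dist (y * ln y) (x * ln x) \<le> ?L * sqrt \<bar>y - x\<bar>"
        using xlnx_holder[of y M x] x y assms(5) by (simp add: dist_real_def)
      also have "\<dots> < ?L * (d / ?L)"
        using dy L d by (intro mult_strict_left_mono real_less_lsqrt) (auto simp: dist_real_def)
      finally show "dist (y * ln y) (x * ln x) < d" using L by simp
    qed (use d L in auto)
  qed
  have "continuous_on {0..M} (\<lambda>s. s * (s * ln s) / 2 - s\<^sup>2 / 4)"
    by (intro continuous_intros cont) auto
  then have cont': "continuous_on {0..M} entropy_fn"
    by (simp add: entropy_fn_def[abs_def] power2_eq_square mult.assoc)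
  have mv: "\<exists>\<xi>. a < \<xi> \<and> \<xi> < c \<and> entropy_fn c - entropy_fn a = (c - a) * (\<xi> * ln \<xi>)" if ac: "a < c" "0 \<le> a" "c \<le> M" for a c
  proof -
    have deriv: "(entropy_fn has_real_derivative x * ln x) (at x)" if "x > 0" for x
      unfolding entropy_fn_def[abs_def] using that
      by (auto intro!: derivative_eq_intros simp: power2_eq_square field_simps)
    obtain \<xi> where "a < \<xi>" "\<xi> < c" "entropy_fn c - entropy_fn a = (\<xi> * ln \<xi>) * (c - a)"
    proof (rule mvt[OF ac(1), of entropy_fn "\<lambda>x. (*) (x * ln x)"])
      show "continuous_on {a..c} entropy_fn"
        by (rule continuous_on_subset[OF cont']) (use ac in auto)
      show "(entropy_fn has_derivative (*) (x * ln x)) (at x)" if "a < x" "x < c" for x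
        using deriv[of x] that ac(2) by (simp add: has_field_derivative_def)
    qed auto
    then show ?thesis by (auto simp: mult.commute)
  qed
  have "\<exists>\<xi>. 0 \<le> \<xi> \<and> \<xi> \<le> M \<and> \<bar>\<xi> - t\<bar> \<le> \<bar>s - t\<bar> \<and> entropy_fn s - entropy_fn t = (s - t) * (\<xi> * ln \<xi>)"
  proof -
    consider "t < s" | "s < t" | "s = t" by linarith
    then show ?thesis
    proof cases
      case 1
      then obtain \<xi> where "t < \<xi>" "\<xi> < s" "entropy_fn s - entropy_fn t = (s - t) * (\<xi> * ln \<xi>)"
        using mv[of t s] assms by blast
      then show ?thesis using assms by (intro exI[of _ \<xi>]) auto
    next
      case 2
      then obtain \<xi> where "s < \<xi>" "\<xi> < t" "entropy_fn t - entropy_fn s = (t - s) * (\<xi> * ln \<xi>)"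
        using mv[of s t] assms by blast
      then show ?thesis using assms by (intro exI[of _ \<xi>]) (auto simp: algebra_simps)
    next
      case 3
      then show ?thesis using assms by (intro exI[of _ t]) auto
    qed
  qed
  then obtain \<xi> where \<xi>: "0 \<le> \<xi>" "\<xi> \<le> M" "\<bar>\<xi> - t\<bar> \<le> \<bar>s - t\<bar>" "entropy_fn s - entropy_fn t = (s - t) * (\<xi> * ln \<xi>)"
    by blast
  have "\<bar>entropy_fn s - entropy_fn t - t * ln t * (s - t)\<bar> = \<bar>\<xi> * ln \<xi> - t * ln t\<bar> * \<bar>s - t\<bar>"
    unfolding \<xi>(4) abs_mult[symmetric] by (simp add: algebra_simps)
  also have "\<dots> \<le> (?L * sqrt \<bar>\<xi> - t\<bar>) * \<bar>s - t\<bar>"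
    using \<xi> assms by (intro mult_right_mono xlnx_holder) auto
  also have "\<dots> \<le> (?L * sqrt \<bar>s - t\<bar>) * \<bar>s - t\<bar>"
    using \<xi>(3) L by (intro mult_right_mono mult_left_mono) auto
  finally show ?thesis by (simp add: mult.assoc)
qed

section \<open>Variation of the energy\<close>

lemma square_le_powr_interpolation:
  fixes m K a b :: real
  assumes "0 \<le> m" "m \<le> K * a" "m \<le> K * b" "a \<ge> 0" "b \<ge> 0" "K \<ge> 0"
  shows "m\<^sup>2 \<le> K\<^sup>2 * (a powr (5/3) * b powr (1/3))"
proof (cases "m = 0")
  case False
  then have m: "m > 0" using assms by simp
  have "m\<^sup>2 = m powr (5/3) * m powr (1/3)"
    using m by (simp flip: powr_add)
  also have "\<dots> \<le> (K * a) powr (5/3) * (K * b) powr (1/3)"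
    using assms m by (intro mult_mono powr_mono2) auto
  also have "\<dots> = (K powr (5/3) * K powr (1/3)) * (a powr (5/3) * b powr (1/3))"
    using assms by (simp add: powr_mult)
  also have "K powr (5/3) * K powr (1/3) = K\<^sup>2"
    using assms by (cases "K = 0") (simp_all flip: powr_add)
  finally show ?thesis .
qed (use assms in auto)

context log_equation_entropy
begin

theorem variation_estimate:
  assumes \<rho>: "\<rho> > 0" and e: "e \<in> Basis"
  obtains C t0 where "t0 > 0" "t0 \<le> 1/10" and "\<And>t. \<bar>t\<bar> \<le> t0 \<Longrightarrow>
    \<bar>(c * ((\<integral>p. jac \<rho> e t (fst p) * jac \<rho> e t (snd p) * (near_ker (shift \<rho> e t (fst p) - shift \<rho> e t (snd p))
          * (u (fst p) - u (snd p)) * (u (fst p) - u (snd p))) \<partial>(lborel \<Otimes>\<^sub>M lborel)) / 2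
        - (\<integral>p. jac \<rho> e t (fst p) * jac \<rho> e t (snd p) * (cut_ker 1 (shift \<rho> e t (fst p) - shift \<rho> e t (snd p))
          * u (snd p) * u (fst p)) \<partial>(lborel \<Otimes>\<^sub>M lborel)))
      + b * (\<integral>x. jac \<rho> e t x * (u x)\<^sup>2 \<partial>lborel) - 2 * k * (\<integral>x. jac \<rho> e t x * entropy_fn (u x) \<partial>lborel))
     - (c * (near_form u u / 2 - cut_form u u) + b * (\<integral>x. (u x)\<^sup>2 \<partial>lborel) - 2 * k * (\<integral>x. entropy_fn (u x) \<partial>lborel))\<bar>
    \<le> C * \<bar>t\<bar> powr (9/8)"
proof -
  let ?P = "lborel \<Otimes>\<^sub>M lborel :: ('a \<times> 'a) measure"
  obtain C where C: "C \<ge> 0" "\<And>x y. norm x \<le> \<rho> \<Longrightarrow> dist x y \<le> 1 \<Longrightarrow> \<bar>u x - u y\<bar> \<le> C * dist x y powr (3/4)"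
    using holder_ball[of \<rho>] by blast
  have "compact (u ` cball 0 \<rho>)"
    using cont by (intro compact_continuous_image) (auto intro: continuous_on_subset)
  then have "bdd_above (u ` cball 0 \<rho>)"
    by (intro bounded_imp_bdd_above compact_imp_bounded)
  then obtain M0 where M0: "\<And>y. y \<in> cball 0 \<rho> \<Longrightarrow> u y \<le> M0"
    unfolding bdd_above_def by (meson imageI)
  define M where "M = max 1 M0"
  have M: "M \<ge> 1" "\<And>y. norm y \<le> \<rho> \<Longrightarrow> u y \<le> M"
    using M0 by (auto simp: M_def le_max_iff_disj)
  define L where "L = (ln M + 1) * sqrt M + 2"
  have L: "L \<ge> 0" using M(1) by (auto simp: L_def intro!: add_nonneg_nonneg mult_nonneg_nonneg)
  define t0 where "t0 = min (1/10) (1/\<rho>)"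
  have t0: "t0 > 0" "t0 \<le> 1/10" "t0 * \<rho> \<le> 1"
    using \<rho> by (auto simp: t0_def min_def field_simps)
  define E where "E = C * \<rho> powr (3/4)"
  define K where "K = 3 * C + 4 * E"
  have E: "E \<ge> 0" using C by (simp add: E_def)
  have K: "K \<ge> 0" "2 * E \<le> K" using C E by (auto simp: K_def)
  define h where "h = (\<lambda>z::'a. indicator (ball 0 1) z * (norm z powr (1/4) / norm z ^ DIM('a)) :: real)"
  have h: "integrable lborel h"
    unfolding h_def by (rule integrable.intros[OF has_bochner_integral_powr_ball]) auto
  define I where "I = (\<lambda>r (x::'a). indicator (cball 0 r) x :: real)"
  have I: "integrable lborel (I r)" for r
    unfolding I_def using emeasure_lborel_cball_finite[of "0::'a" r] by (intro integrable_real_indicator) auto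
  have I_nn: "I r x \<ge> 0" for r x by (simp add: I_def)
  define N1 where "N1 = (\<integral>x. I (\<rho> + 1) x \<partial>lborel) * (\<integral>z. h z \<partial>lborel)"
  define N2 where "N2 = (\<integral>x. I \<rho> x \<partial>lborel) * (\<integral>z. I (2 * \<rho>) z \<partial>lborel)"
  define N3 where "N3 = (\<integral>x. I \<rho> x \<partial>lborel)"
  have N: "N1 \<ge> 0" "N2 \<ge> 0" "N3 \<ge> 0"
    by (auto simp: N1_def N2_def N3_def h_def I_nn intro!: mult_nonneg_nonneg Bochner_Integration.integral_nonneg)
  define C0 where "C0 = c * (K\<^sup>2 * N1 / 2 + E\<^sup>2 * N2) + \<bar>b\<bar> * (E\<^sup>2 * N3) + 2 * k * (L * (sqrt E * E) * N3)"
  show thesis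
  proof (rule that[OF t0(1,2)])
    fix t assume tt0: "\<bar>t\<bar> \<le> t0"
    then have t: "\<bar>t\<bar> \<le> 1/10" using t0 by simp
    have t\<rho>: "\<bar>t\<bar> * \<rho> \<le> 1"
      using order_trans[OF mult_right_mono[OF tt0, of \<rho>] t0(3)] \<rho> by simp
    note [simp] = inv_shift[OF \<rho> e t]
    note [measurable] = inv_shift_measurable[OF \<rho> e t]
    let ?\<Phi> = "shift \<rho> e t" and ?J = "jac \<rho> e t"
    define w where "w = (\<lambda>x. u (inv ?\<Phi> x))"
    define d where "d = (\<lambda>x. w x - u x)"
    have [measurable]: "w \<in> borel_measurable borel" "d \<in> borel_measurable borel"
      unfolding w_def d_def by measurable
    define T where "T = \<bar>t\<bar>"
    have T: "T \<ge> 0" "T \<le> 1" using t by (auto simp: T_def)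
    have d_out: "d x = 0" if "norm x > \<rho>" for x
      using inv_shift_fixed[OF \<rho> e t, of x] that by (simp add: d_def w_def)
    have d_le: "\<bar>d x\<bar> \<le> E * T powr (3/4)" for x
    proof (cases "norm x \<le> \<rho>")
      case True
      have dist: "dist (inv ?\<Phi> x) x \<le> T * \<rho>"
        using inv_shift_dist[OF \<rho> e t] by (simp add: T_def)
      have "\<bar>d x\<bar> \<le> C * dist x (inv ?\<Phi> x) powr (3/4)"
        unfolding d_def w_def abs_minus_commute[of _ "u x"] using dist t\<rho> True by (intro C(2)) (auto simp: dist_commute T_def)
      also have "\<dots> \<le> C * (T * \<rho>) powr (3/4)"
        using dist C(1) by (intro mult_left_mono powr_mono2) (auto simp: dist_commute)
      also have "\<dots> = E * T powr (3/4)"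
        using T \<rho> by (simp add: E_def powr_mult)
      finally show ?thesis .
    qed (use d_out[of x] E in auto)
    have T34: "T powr (3/4) \<le> 1" using T by (simp add: powr_le1)
    have holder_d: "\<bar>d x - d y\<bar> \<le> K * norm (x - y) powr (3/4)" if x: "norm x \<le> \<rho>" and xy: "norm (x - y) < 1" for x y
    proof (cases "norm (x - y) \<le> 1/2")
      case True
      have 1: "\<bar>u x - u y\<bar> \<le> C * norm (x - y) powr (3/4)"
        using C(2)[of x y] x xy by (simp add: dist_norm)
      have iv: "norm (inv ?\<Phi> x - inv ?\<Phi> y) \<le> 2 * norm (x - y)"
        by (rule inv_shift_norm[OF \<rho> e t])
      have "\<bar>w x - w y\<bar> \<le> C * norm (inv ?\<Phi> x - inv ?\<Phi> y) powr (3/4)"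
        unfolding w_def using C(2)[of "inv ?\<Phi> x" "inv ?\<Phi> y"] inv_shift_inside[OF \<rho> e t x] iv True by (simp add: dist_norm)
      also have "\<dots> \<le> C * (2 * norm (x - y)) powr (3/4)"
        using iv C(1) by (intro mult_left_mono powr_mono2) auto
      also have "\<dots> = C * (2 powr (3/4) * norm (x - y) powr (3/4))"
        by (simp add: powr_mult)
      also have "\<dots> \<le> C * (2 * norm (x - y) powr (3/4))"
        using C(1) powr_mono[of "3/4" 1 "2::real"] by (intro mult_left_mono mult_right_mono) auto
      finally have "\<bar>d x - d y\<bar> \<le> 3 * C * norm (x - y) powr (3/4)"
        using 1 by (simp add: d_def abs_le_iff)
      also have "\<dots> \<le> K * norm (x - y) powr (3/4)"
        using E by (intro mult_right_mono) (auto simp: K_def)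
      finally show ?thesis .
    next
      case False
      have "norm (x - y) powr 1 \<le> norm (x - y) powr (3/4)"
        using xy False by (intro powr_mono') auto
      then have half: "norm (x - y) powr (3/4) \<ge> 1/2" using False by simp
      have "\<bar>d x - d y\<bar> \<le> 2 * (E * T powr (3/4))"
        using d_le[of x] d_le[of y] by (auto simp: abs_le_iff)
      also have "\<dots> \<le> 2 * (E * 1)"
        using T34 E by (intro mult_left_mono) auto
      also have "\<dots> \<le> 4 * E * norm (x - y) powr (3/4)"
        using half E mult_left_mono[OF half, of "4 * E"] by simp
      also have "\<dots> \<le> K * norm (x - y) powr (3/4)"
        using C(1) by (intro mult_right_mono) (auto simp: K_def)
      finally show ?thesis .
    qed
    have near_d_le: "near_ker (x - y) * (d x - d y) * (d x - d y) \<le> K\<^sup>2 * T powr (5/4) * (I (\<rho> + 1) x * h (x - y))" for x y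
    proof (cases "norm (x - y) < 1 \<and> (norm x \<le> \<rho> \<or> norm y \<le> \<rho>)")
      case True
      then have xy: "norm (x - y) < 1" by simp
      have nx: "norm x \<le> \<rho> + 1"
        using True norm_triangle_ineq2[of x y] by auto
      have "\<bar>d x - d y\<bar> \<le> K * norm (x - y) powr (3/4)"
        using True holder_d[of x y] holder_d[of y x] by (auto simp: norm_minus_commute abs_minus_commute)
      moreover have "\<bar>d x - d y\<bar> \<le> K * T powr (3/4)"
      proof -
        have "\<bar>d x - d y\<bar> \<le> 2 * E * T powr (3/4)"
          using d_le[of x] d_le[of y] by (auto simp: abs_le_iff)
        also have "\<dots> \<le> K * T powr (3/4)" using K(2) by (intro mult_right_mono) auto
        finally show ?thesis .
      qed
      ultimately have "\<bar>d x - d y\<bar>\<^sup>2 \<le> K\<^sup>2 * ((T powr (3/4)) powr (5/3) * (norm (x - y) powr (3/4)) powr (1/3))"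
        using K by (intro square_le_powr_interpolation) auto
      then have dd: "(d x - d y) * (d x - d y) \<le> K\<^sup>2 * (T powr (5/4) * norm (x - y) powr (1/4))"
        by (simp add: powr_powr power2_eq_square)
      have "near_ker (x - y) * ((d x - d y) * (d x - d y)) \<le> (1 / norm (x - y) ^ DIM('a)) * (K\<^sup>2 * (T powr (5/4) * norm (x - y) powr (1/4)))"
        by (rule mult_mono[OF near_ker_le[of "x - y"] dd]) auto
      then show ?thesis
        using xy nx by (simp add: I_def h_def mult_ac)
    next
      case False
      then have "near_ker (x - y) * (d x - d y) * (d x - d y) = 0"
        using d_out[of x] d_out[of y] near_ker_eq_0[of "x - y"] by (auto simp: not_le not_less)
      moreover have "K\<^sup>2 * T powr (5/4) * (I (\<rho> + 1) x * h (x - y)) \<ge> 0"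
        by (simp add: I_def h_def)
      ultimately show ?thesis by (simp only:)
    qed
    have dd_int: "integrable ?P (\<lambda>p. near_ker (fst p - snd p) * (d (fst p) - d (snd p)) * (d (fst p) - d (snd p)))"
      and dd_le: "\<bar>near_form d d\<bar> \<le> K\<^sup>2 * N1 * T powr (9/8)"
    proof -
      have i: "integrable ?P (\<lambda>p. K\<^sup>2 * T powr (5/4) * (I (\<rho> + 1) (fst p) * h (fst p - snd p)))"
        by (intro integrable_mult_right integrable_lborel_pair_diff I h)
      have nn: "near_ker (x - y) * (d x - d y) * (d x - d y) \<ge> 0" for x y
        by (simp add: mult.assoc)
      show int: "integrable ?P (\<lambda>p. near_ker (fst p - snd p) * (d (fst p) - d (snd p)) * (d (fst p) - d (snd p)))"
        by (rule Bochner_Integration.integrable_bound[OF i])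
          (use nn near_d_le in \<open>auto intro!: AE_I2 intro: order_trans[OF _ abs_ge_self]\<close>)
      have "\<bar>near_form d d\<bar> = near_form d d"
        unfolding near_form_def using nn by (intro abs_of_nonneg Bochner_Integration.integral_nonneg) auto
      also have "\<dots> \<le> (\<integral>p. K\<^sup>2 * T powr (5/4) * (I (\<rho> + 1) (fst p) * h (fst p - snd p)) \<partial>?P)"
        unfolding near_form_def by (rule integral_mono[OF int i]) (rule near_d_le)
      also have "\<dots> = K\<^sup>2 * T powr (5/4) * N1"
        using integral_lborel_pair_diff[OF I[of "\<rho> + 1"] h] by (simp add: N1_def)
      also have "\<dots> \<le> K\<^sup>2 * T powr (9/8) * N1"
        using T N by (intro mult_right_mono mult_left_mono powr_mono') auto
      finally show "\<bar>near_form d d\<bar> \<le> K\<^sup>2 * N1 * T powr (9/8)" by (simp add: mult_ac)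
    qed
    have T32: "(E * T powr (3/4))\<^sup>2 \<le> E\<^sup>2 * T powr (9/8)"
    proof -
      have "(E * T powr (3/4))\<^sup>2 = E\<^sup>2 * T powr (3/2)"
        by (simp add: power_mult_distrib power2_eq_square powr_add[symmetric])
      also have "\<dots> \<le> E\<^sup>2 * T powr (9/8)"
        using T by (intro mult_left_mono powr_mono') auto
      finally show ?thesis .
    qed
    have d_I: "\<bar>d x\<bar> \<le> E * T powr (3/4) * I \<rho> x" for x
      using d_le[of x] d_out[of x] by (cases "norm x \<le> \<rho>") (auto simp: I_def)
    have cdd_int: "integrable ?P (\<lambda>p. cut_ker 1 (fst p - snd p) * d (snd p) * d (fst p))"
      and cdd_le: "\<bar>cut_form d d\<bar> \<le> E\<^sup>2 * N2 * T powr (9/8)"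
    proof -
      have i: "integrable ?P (\<lambda>p. (E * T powr (3/4))\<^sup>2 * (I \<rho> (fst p) * I (2 * \<rho>) (fst p - snd p)))"
        by (intro integrable_mult_right integrable_lborel_pair_diff I)
      have le: "\<bar>cut_ker 1 (x - y) * d y * d x\<bar> \<le> (E * T powr (3/4))\<^sup>2 * (I \<rho> x * I (2 * \<rho>) (x - y))" for x y
      proof (cases "norm x \<le> \<rho> \<and> norm y \<le> \<rho>")
        case True
        then have "norm (x - y) \<le> 2 * \<rho>" using norm_triangle_ineq4[of x y] by linarith
        moreover have "\<bar>cut_ker 1 (x - y) * d y * d x\<bar> \<le> 1 * (E * T powr (3/4)) * (E * T powr (3/4))"
          unfolding abs_mult using d_le cut_ker_le_1[of "x - y"] E by (intro mult_mono) auto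
        ultimately show ?thesis using True by (simp add: I_def power2_eq_square)
      next
        case False
        then show ?thesis using d_out[of x] d_out[of y] I_nn by auto
      qed
      show int: "integrable ?P (\<lambda>p. cut_ker 1 (fst p - snd p) * d (snd p) * d (fst p))"
        by (rule Bochner_Integration.integrable_bound[OF i]) (use le in \<open>auto intro!: AE_I2 intro: order_trans[OF _ abs_ge_self]\<close>)
      have "\<bar>cut_form d d\<bar> \<le> (\<integral>p. \<bar>cut_ker 1 (fst p - snd p) * d (snd p) * d (fst p)\<bar> \<partial>?P)"
        unfolding cut_form_def by (rule integral_abs_bound)
      also have "\<dots> \<le> (\<integral>p. (E * T powr (3/4))\<^sup>2 * (I \<rho> (fst p) * I (2 * \<rho>) (fst p - snd p)) \<partial>?P)"
        by (rule integral_mono[OF integrable_abs[OF int] i]) (rule le)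
      also have "\<dots> = (E * T powr (3/4))\<^sup>2 * N2"
        using integral_lborel_pair_diff[OF I I, of \<rho> "2 * \<rho>"] by (simp add: N2_def)
      also have "\<dots> \<le> E\<^sup>2 * T powr (9/8) * N2"
        by (rule mult_right_mono[OF T32 N(2)])
      finally show "\<bar>cut_form d d\<bar> \<le> E\<^sup>2 * N2 * T powr (9/8)" by (simp add: mult_ac)
    qed
    have d2_int: "integrable lborel (\<lambda>x. (d x)\<^sup>2)" and d2_le: "\<bar>\<integral>x. (d x)\<^sup>2 \<partial>lborel\<bar> \<le> E\<^sup>2 * N3 * T powr (9/8)"
    proof -
      have i: "integrable lborel (\<lambda>x. (E * T powr (3/4))\<^sup>2 * I \<rho> x)" by (intro integrable_mult_right I)
      have le: "(d x)\<^sup>2 \<le> (E * T powr (3/4))\<^sup>2 * I \<rho> x" for x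
      proof (cases "norm x \<le> \<rho>")
        case True
        then show ?thesis using power_mono[OF d_le[of x], of 2] by (simp add: I_def)
      qed (use d_out[of x] I_nn in simp)
      show int: "integrable lborel (\<lambda>x. (d x)\<^sup>2)"
        by (rule Bochner_Integration.integrable_bound[OF i]) (use le in \<open>auto intro!: AE_I2 intro: order_trans[OF _ abs_ge_self]\<close>)
      have "\<bar>\<integral>x. (d x)\<^sup>2 \<partial>lborel\<bar> = (\<integral>x. (d x)\<^sup>2 \<partial>lborel)"
        by (intro abs_of_nonneg Bochner_Integration.integral_nonneg) auto
      also have "\<dots> \<le> (\<integral>x. (E * T powr (3/4))\<^sup>2 * I \<rho> x \<partial>lborel)"
        by (rule integral_mono[OF int i le])
      also have "\<dots> = (E * T powr (3/4))\<^sup>2 * N3" by (simp add: N3_def)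
      also have "\<dots> \<le> E\<^sup>2 * T powr (9/8) * N3"
        by (rule mult_right_mono[OF T32 N(3)])
      finally show "\<bar>\<integral>x. (d x)\<^sup>2 \<partial>lborel\<bar> \<le> E\<^sup>2 * N3 * T powr (9/8)" by (simp add: mult_ac)
    qed
    define R where "R = (\<lambda>x. entropy_fn (w x) - entropy_fn (u x) - u x * ln (u x) * d x)"
    have [measurable]: "R \<in> borel_measurable borel" unfolding R_def by measurable
    have R_int: "integrable lborel R" and R_le: "\<bar>\<integral>x. R x \<partial>lborel\<bar> \<le> L * (sqrt E * E) * N3 * T powr (9/8)"
    proof -
      have pw: "sqrt (E * T powr (3/4)) * (E * T powr (3/4)) = sqrt E * E * T powr (9/8)"
      proof -
        have "sqrt (T powr (3/4)) = T powr (3/8)"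
          using powr_half_sqrt[of "T powr (3/4)"] by (simp add: powr_powr)
        then have "sqrt (E * T powr (3/4)) * (E * T powr (3/4)) = sqrt E * E * (T powr (3/8) * T powr (3/4))"
          by (simp add: real_sqrt_mult)
        then show ?thesis by (simp flip: powr_add)
      qed
      have i: "integrable lborel (\<lambda>x. L * (sqrt E * E * T powr (9/8)) * I \<rho> x)" by (intro integrable_mult_right I)
      have le: "\<bar>R x\<bar> \<le> L * (sqrt E * E * T powr (9/8)) * I \<rho> x" for x
      proof (cases "norm x \<le> \<rho>")
        case True
        have "\<bar>R x\<bar> \<le> L * (sqrt \<bar>w x - u x\<bar> * \<bar>w x - u x\<bar>)"
          unfolding R_def d_def L_def using M True inv_shift_inside[OF \<rho> e t True] u_nonneg
          by (intro entropy_fn_expansion) (auto simp: w_def)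
        also have "\<dots> \<le> L * (sqrt (E * T powr (3/4)) * (E * T powr (3/4)))"
          using d_le[of x] L E by (intro mult_left_mono mult_mono) (auto simp: d_def)
        finally show ?thesis using True by (simp add: pw I_def)
      next
        case False
        then have "d x = 0" using d_out[of x] by simp
        then have "w x = u x" by (simp add: d_def)
        then have "R x = 0" using \<open>d x = 0\<close> by (simp add: R_def)
        then show ?thesis using False by (simp add: I_def)
      qed
      show int: "integrable lborel R"
        by (rule Bochner_Integration.integrable_bound[OF i]) (use le in \<open>auto intro!: AE_I2 intro: order_trans[OF _ abs_ge_self]\<close>)
      have "\<bar>\<integral>x. R x \<partial>lborel\<bar> \<le> (\<integral>x. \<bar>R x\<bar> \<partial>lborel)" by (rule integral_abs_bound)
      also have "\<dots> \<le> (\<integral>x. L * (sqrt E * E * T powr (9/8)) * I \<rho> x \<partial>lborel)"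
        by (rule integral_mono[OF integrable_abs[OF int] i le])
      finally show "\<bar>\<integral>x. R x \<partial>lborel\<bar> \<le> L * (sqrt E * E) * N3 * T powr (9/8)"
        by (simp add: N3_def mult_ac)
    qed
    have ud_int: "integrable ?P (\<lambda>p. near_ker (fst p - snd p) * (u (fst p) - u (snd p)) * (d (fst p) - d (snd p)))"
      and cud_int: "integrable ?P (\<lambda>p. cut_ker 1 (fst p - snd p) * u (snd p) * d (fst p))"
      and weak: "c * (near_form u d / 2 - cut_form u d) + b * (\<integral>x. u x * d x \<partial>lborel) = k * (\<integral>x. u x * ln (u x) * d x \<partial>lborel)"
      by (rule near_form_integrable[OF _ d_le d_out] cut_form_integrable[OF _ d_le d_out] weak_equation[OF _ d_le d_out]; simp)+
    have cdu_int: "integrable ?P (\<lambda>p. cut_ker 1 (fst p - snd p) * d (snd p) * u (fst p))"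
      and cdu: "(\<integral>p. cut_ker 1 (fst p - snd p) * d (snd p) * u (fst p) \<partial>?P) = cut_form u d"
    proof -
      have eq: "cut_ker 1 (snd p - fst p) * u (fst p) * d (snd p) = cut_ker 1 (fst p - snd p) * d (snd p) * u (fst p)" for p :: "'a \<times> 'a"
        by (simp add: cut_ker_minus_commute[of 1 "snd p"] mult_ac)
      show "integrable ?P (\<lambda>p. cut_ker 1 (fst p - snd p) * d (snd p) * u (fst p))"
        using integrable_lborel_pair_swap[OF cud_int] by (simp add: eq)
      show "(\<integral>p. cut_ker 1 (fst p - snd p) * d (snd p) * u (fst p) \<partial>?P) = cut_form u d"
        using integral_lborel_pair_swap[of "\<lambda>p. cut_ker 1 (fst p - snd p) * u (snd p) * d (fst p)"] by (simp add: eq cut_form_def)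
    qed
    have near_w: "near_form w w = near_form u u + 2 * near_form u d + near_form d d"
    proof -
      have "near_ker (fst p - snd p) * (w (fst p) - w (snd p)) * (w (fst p) - w (snd p)) =
        near_ker (fst p - snd p) * (u (fst p) - u (snd p)) * (u (fst p) - u (snd p))
        + 2 * (near_ker (fst p - snd p) * (u (fst p) - u (snd p)) * (d (fst p) - d (snd p)))
        + near_ker (fst p - snd p) * (d (fst p) - d (snd p)) * (d (fst p) - d (snd p))" for p
        by (simp add: d_def algebra_simps)
      then show ?thesis
        unfolding near_form_def using near_energy_integrable ud_int dd_int by simp
    qed
    have cut_w: "cut_form w w = cut_form u u + 2 * cut_form u d + cut_form d d"
    proof -
      have "cut_ker 1 (fst p - snd p) * w (snd p) * w (fst p) =
        cut_ker 1 (fst p - snd p) * u (snd p) * u (fst p)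
        + cut_ker 1 (fst p - snd p) * u (snd p) * d (fst p)
        + cut_ker 1 (fst p - snd p) * d (snd p) * u (fst p)
        + cut_ker 1 (fst p - snd p) * d (snd p) * d (fst p)" for p
        by (simp add: d_def algebra_simps)
      then have "cut_form w w = cut_form u u + cut_form u d + cut_form u d + cut_form d d"
        unfolding cut_form_def[of w w] using far_energy_integrable cud_int cdu_int cdd_int cdu
        by (simp add: cut_form_def)
      then show ?thesis by simp
    qed
    have fin: "integrable lborel (\<lambda>x. u x * d x)" "integrable lborel (\<lambda>x. u x * ln (u x) * d x)"
    proof -
      have i: "integrable lborel (\<lambda>x. (M + L * sqrt M) * (E * T powr (3/4)) * I \<rho> x)" by (intro integrable_mult_right I)
      have le: "\<bar>u x\<bar> \<le> M + L * sqrt M" "\<bar>u x * ln (u x)\<bar> \<le> M + L * sqrt M" if "norm x \<le> \<rho>" for x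
      proof -
        have ux: "0 \<le> u x" "u x \<le> M" using M that u_nonneg by auto
        have "\<bar>u x * ln (u x)\<bar> \<le> L * sqrt (u x)"
          using xlnx_holder[of "u x" M 0] ux M(1) by (simp add: L_def)
        also have "\<dots> \<le> L * sqrt M" using ux L by (intro mult_left_mono) auto
        finally show "\<bar>u x * ln (u x)\<bar> \<le> M + L * sqrt M" using M(1) by simp
        have "0 \<le> L * sqrt M" using L M(1) by simp
        then show "\<bar>u x\<bar> \<le> M + L * sqrt M" using ux by simp
      qed
      have gen: "integrable lborel (\<lambda>x. f x * d x)" if [measurable]: "f \<in> borel_measurable borel"
        and f: "\<And>x. norm x \<le> \<rho> \<Longrightarrow> \<bar>f x\<bar> \<le> M + L * sqrt M" for f
      proof (rule Bochner_Integration.integrable_bound[OF i])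
        show "AE x in lborel. norm (f x * d x) \<le> norm ((M + L * sqrt M) * (E * T powr (3/4)) * I \<rho> x)"
        proof (rule AE_I2)
          fix x
          show "norm (f x * d x) \<le> norm ((M + L * sqrt M) * (E * T powr (3/4)) * I \<rho> x)"
          proof (cases "norm x \<le> \<rho>")
            case True
            have "\<bar>f x * d x\<bar> \<le> (M + L * sqrt M) * (E * T powr (3/4))"
              unfolding abs_mult using f[OF True] d_le[of x] M(1) L by (intro mult_mono) auto
            then show ?thesis using True by (simp add: I_def)
          qed (use d_out[of x] in simp)
        qed
      qed measurable
      show "integrable lborel (\<lambda>x. u x * d x)" "integrable lborel (\<lambda>x. u x * ln (u x) * d x)"
        using le by (intro gen; simp)+
    qed
    have ent_int: "integrable lborel (\<lambda>x. entropy_fn (u x))"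
      unfolding entropy_fn_def using square_int entropy_int by simp
    have sq_w: "(\<integral>x. (w x)\<^sup>2 \<partial>lborel) = (\<integral>x. (u x)\<^sup>2 \<partial>lborel) + 2 * (\<integral>x. u x * d x \<partial>lborel) + (\<integral>x. (d x)\<^sup>2 \<partial>lborel)"
    proof -
      have "(w x)\<^sup>2 = (u x)\<^sup>2 + 2 * (u x * d x) + (d x)\<^sup>2" for x
        by (simp add: d_def power2_eq_square algebra_simps)
      then show ?thesis using square_int fin d2_int by simp
    qed
    have ent_w: "(\<integral>x. entropy_fn (w x) \<partial>lborel) = (\<integral>x. entropy_fn (u x) \<partial>lborel) + (\<integral>x. u x * ln (u x) * d x \<partial>lborel) + (\<integral>x. R x \<partial>lborel)"
    proof -
      have "entropy_fn (w x) = entropy_fn (u x) + u x * ln (u x) * d x + R x" for x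
        by (simp add: R_def)
      then show ?thesis using ent_int fin R_int by simp
    qed
    note subst = shift_distr[OF \<rho> e t] shift_measurable jac_measurable jac_nonneg[OF \<rho> e t]
    have wu: "w (?\<Phi> x) = u x" for x by (simp add: w_def)
    have A: "(\<integral>p. ?J (fst p) * ?J (snd p) * (near_ker (?\<Phi> (fst p) - ?\<Phi> (snd p)) * (u (fst p) - u (snd p)) * (u (fst p) - u (snd p))) \<partial>?P) = near_form w w"
      unfolding near_form_def by (subst integral_lborel_pair_substitution[OF subst]) (simp_all add: wu)
    have B: "(\<integral>p. ?J (fst p) * ?J (snd p) * (cut_ker 1 (?\<Phi> (fst p) - ?\<Phi> (snd p)) * u (snd p) * u (fst p)) \<partial>?P) = cut_form w w"
      unfolding cut_form_def by (subst integral_lborel_pair_substitution[OF subst]) (simp_all add: wu)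
    have S: "(\<integral>x. ?J x * (u x)\<^sup>2 \<partial>lborel) = (\<integral>x. (w x)\<^sup>2 \<partial>lborel)"
      by (subst (2) integral_lborel_substitution[OF subst]) (simp_all add: wu)
    have H: "(\<integral>x. ?J x * entropy_fn (u x) \<partial>lborel) = (\<integral>x. entropy_fn (w x) \<partial>lborel)"
      by (subst (2) integral_lborel_substitution[OF subst]) (simp_all add: wu)
    have "(c * (near_form w w / 2 - cut_form w w) + b * (\<integral>x. (w x)\<^sup>2 \<partial>lborel) - 2 * k * (\<integral>x. entropy_fn (w x) \<partial>lborel))
      - (c * (near_form u u / 2 - cut_form u u) + b * (\<integral>x. (u x)\<^sup>2 \<partial>lborel) - 2 * k * (\<integral>x. entropy_fn (u x) \<partial>lborel))
      = 2 * (c * (near_form u d / 2 - cut_form u d) + b * (\<integral>x. u x * d x \<partial>lborel) - k * (\<integral>x. u x * ln (u x) * d x \<partial>lborel))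
        + (c * (near_form d d / 2 - cut_form d d) + b * (\<integral>x. (d x)\<^sup>2 \<partial>lborel) - 2 * k * (\<integral>x. R x \<partial>lborel))"
      unfolding near_w cut_w sq_w ent_w by (simp add: algebra_simps)
    also have "\<dots> = c * (near_form d d / 2 - cut_form d d) + b * (\<integral>x. (d x)\<^sup>2 \<partial>lborel) - 2 * k * (\<integral>x. R x \<partial>lborel)"
      using weak by simp
    also have "\<bar>\<dots>\<bar> \<le> c * (\<bar>near_form d d\<bar> / 2 + \<bar>cut_form d d\<bar>) + \<bar>b\<bar> * \<bar>\<integral>x. (d x)\<^sup>2 \<partial>lborel\<bar> + 2 * k * \<bar>\<integral>x. R x \<partial>lborel\<bar>"
    proof -
      have tri: "\<bar>x + y - z\<bar> \<le> \<bar>x\<bar> + \<bar>y\<bar> + \<bar>z\<bar>" for x y z :: real by linarith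
      have 1: "\<bar>c * (near_form d d / 2 - cut_form d d)\<bar> \<le> c * (\<bar>near_form d d\<bar> / 2 + \<bar>cut_form d d\<bar>)"
        unfolding abs_mult using c_pos by (intro mult_mono) auto
      have 2: "\<bar>b * (\<integral>x. (d x)\<^sup>2 \<partial>lborel)\<bar> = \<bar>b\<bar> * \<bar>\<integral>x. (d x)\<^sup>2 \<partial>lborel\<bar>" by (rule abs_mult)
      have 3: "\<bar>2 * k * (\<integral>x. R x \<partial>lborel)\<bar> = 2 * k * \<bar>\<integral>x. R x \<partial>lborel\<bar>" using k_pos by (simp add: abs_mult)
      show ?thesis
        by (rule order_trans[OF tri add_mono[OF add_mono[OF 1 eq_refl[OF 2]] eq_refl[OF 3]]])
    qed
    also have "\<dots> \<le> c * (K\<^sup>2 * N1 * T powr (9/8) / 2 + E\<^sup>2 * N2 * T powr (9/8)) + \<bar>b\<bar> * (E\<^sup>2 * N3 * T powr (9/8))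
      + 2 * k * (L * (sqrt E * E) * N3 * T powr (9/8))"
      using c_pos k_pos dd_le cdd_le d2_le R_le by (intro add_mono mult_left_mono divide_right_mono) auto
    also have "\<dots> = C0 * \<bar>t\<bar> powr (9/8)"
      by (simp add: C0_def T_def algebra_simps)
    finally show "\<bar>(c * ((\<integral>p. ?J (fst p) * ?J (snd p) * (near_ker (?\<Phi> (fst p) - ?\<Phi> (snd p))
          * (u (fst p) - u (snd p)) * (u (fst p) - u (snd p))) \<partial>?P) / 2
        - (\<integral>p. ?J (fst p) * ?J (snd p) * (cut_ker 1 (?\<Phi> (fst p) - ?\<Phi> (snd p))
          * u (snd p) * u (fst p)) \<partial>?P))
      + b * (\<integral>x. ?J x * (u x)\<^sup>2 \<partial>lborel) - 2 * k * (\<integral>x. ?J x * entropy_fn (u x) \<partial>lborel))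
     - (c * (near_form u u / 2 - cut_form u u) + b * (\<integral>x. (u x)\<^sup>2 \<partial>lborel) - 2 * k * (\<integral>x. entropy_fn (u x) \<partial>lborel))\<bar>
    \<le> C0 * \<bar>t\<bar> powr (9/8)"
      unfolding A B S H .
  qed
qed

end

lemma AE_lborel_pair_norm_diff_neq:
  "AE p in (lborel \<Otimes>\<^sub>M lborel :: ('a::euclidean_space \<times> 'a) measure). norm (fst p - snd p) \<noteq> r"
proof (rule lborel_pair.AE_pair_measure)
  show "{p \<in> space (lborel \<Otimes>\<^sub>M lborel :: ('a \<times> 'a) measure). norm (fst p - snd p) \<noteq> r} \<in> sets (lborel \<Otimes>\<^sub>M lborel)"
    by measurable
  show "AE x in lborel. AE y in lborel. norm (fst (x::'a, y) - snd (x, y)) \<noteq> r"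
  proof (rule AE_I2)
    fix x :: 'a
    have "sphere x r \<in> null_sets lborel"
      using negligible_sphere[of x r]
      by (auto simp: null_sets_completion_iff negligible_iff_null_sets negligible_convex_frontier)
    then show "AE y in lborel. norm (fst (x, y) - snd (x, y)) \<noteq> r"
      by (rule AE_I') (auto simp: dist_norm)
  qed
qed

definition ker_deriv :: "'a \<Rightarrow> 'a::euclidean_space \<Rightarrow> real" where
  "ker_deriv e z = - (real DIM('a) * (z \<bullet> e) / norm z ^ (DIM('a) + 2))"

lemma DERIV_inverse_norm_power:
  fixes z e :: "'a::euclidean_space"
  assumes z: "z \<noteq> 0"
  shows "((\<lambda>t. 1 / norm (z + (t * g) *\<^sub>R e) ^ DIM('a)) has_real_derivative g * ker_deriv e z) (at 0)"
proof -
  have "((\<lambda>t. z + (t * g) *\<^sub>R e) has_derivative (\<lambda>h. (h * g) *\<^sub>R e)) (at 0)"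
    by (auto intro!: derivative_eq_intros)
  moreover have "(norm has_derivative (\<lambda>h. h \<bullet> sgn (z + (0 * g) *\<^sub>R e))) (at (z + (0 * g) *\<^sub>R e))"
    using z by (intro has_derivative_norm) auto
  ultimately have "((\<lambda>t. norm (z + (t * g) *\<^sub>R e)) has_derivative (\<lambda>h. ((h * g) *\<^sub>R e) \<bullet> sgn (z + (0 * g) *\<^sub>R e))) (at 0)"
    by (rule has_derivative_compose)
  then have d: "((\<lambda>t. norm (z + (t * g) *\<^sub>R e)) has_real_derivative g * (z \<bullet> e) / norm z) (at 0)"
    unfolding has_field_derivative_def
    by (rule has_derivative_eq_rhs) (auto simp: fun_eq_iff sgn_div_norm inner_commute divide_inverse mult_ac)
  obtain m where m: "DIM('a) = Suc m"
    using DIM_positive[where 'a='a] gr0_implies_Suc by blast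
  have "((\<lambda>t. inverse (norm (z + (t * g) *\<^sub>R e) ^ DIM('a))) has_real_derivative
      - (inverse (norm (z + (0 * g) *\<^sub>R e) ^ DIM('a)) * (real DIM('a) * (norm (z + (0 * g) *\<^sub>R e) ^ (DIM('a) - 1) * (g * (z \<bullet> e) / norm z))) * inverse (norm (z + (0 * g) *\<^sub>R e) ^ DIM('a)))) (at 0)"
    using z by (auto intro!: derivative_eq_intros d simp: field_simps)
  then show ?thesis
    unfolding inverse_eq_divide[symmetric]
    by (rule DERIV_cong) (use z in \<open>simp add: ker_deriv_def m field_simps power2_eq_square\<close>)
qed

definition near_var :: "real \<Rightarrow> 'a \<Rightarrow> 'a::euclidean_space \<times> 'a \<Rightarrow> real" where
  "near_var \<rho> e p = (vfield_deriv \<rho> e (fst p) + vfield_deriv \<rho> e (snd p)) * near_ker (fst p - snd p)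
    + (vfield \<rho> e (fst p) - vfield \<rho> e (snd p)) * (if norm (fst p - snd p) < 1 then ker_deriv e (fst p - snd p) else 0)"

definition cut_var :: "real \<Rightarrow> 'a \<Rightarrow> 'a::euclidean_space \<times> 'a \<Rightarrow> real" where
  "cut_var \<rho> e p = (vfield_deriv \<rho> e (fst p) + vfield_deriv \<rho> e (snd p)) * cut_ker 1 (fst p - snd p)
    + (vfield \<rho> e (fst p) - vfield \<rho> e (snd p)) * (if norm (fst p - snd p) > 1 then ker_deriv e (fst p - snd p) else 0)"

lemma ker_deriv_measurable [measurable]: "ker_deriv e \<in> borel_measurable borel"
  unfolding ker_deriv_def by measurable

lemma near_var_measurable [measurable]: "near_var \<rho> e \<in> borel_measurable (lborel \<Otimes>\<^sub>M lborel)"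
  unfolding near_var_def by measurable

lemma cut_var_measurable [measurable]: "cut_var \<rho> e \<in> borel_measurable (lborel \<Otimes>\<^sub>M lborel)"
  unfolding cut_var_def by measurable

lemma jac_0 [simp]: "jac \<rho> e 0 x = 1" and shift_0 [simp]: "shift \<rho> e 0 x = x"
  by (simp_all add: jac_def shift_def)

lemma shift_diff: "shift \<rho> e t x - shift \<rho> e t y = (x - y) + (t * (vfield \<rho> e x - vfield \<rho> e y)) *\<^sub>R e"
  by (simp add: shift_def algebra_simps)

lemma DERIV_jac_product:
  "((\<lambda>t. jac \<rho> e t x * jac \<rho> e t y) has_real_derivative (vfield_deriv \<rho> e x + vfield_deriv \<rho> e y)) (at 0)"
  unfolding jac_def by (auto intro!: derivative_eq_intros simp: algebra_simps)

lemma
  fixes x y :: "'a::euclidean_space"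
  assumes z0: "norm (x - y) \<noteq> 0" and z1: "norm (x - y) \<noteq> 1"
  shows DERIV_near: "((\<lambda>t. jac \<rho> e t x * jac \<rho> e t y * near_ker (shift \<rho> e t x - shift \<rho> e t y)) has_real_derivative near_var \<rho> e (x, y)) (at 0)"
    and DERIV_cut: "((\<lambda>t. jac \<rho> e t x * jac \<rho> e t y * cut_ker 1 (shift \<rho> e t x - shift \<rho> e t y)) has_real_derivative cut_var \<rho> e (x, y)) (at 0)"
proof -
  let ?g = "vfield \<rho> e x - vfield \<rho> e y"
  let ?z = "\<lambda>t. (x - y) + (t * ?g) *\<^sub>R e"
  have "isCont (\<lambda>t. norm (?z t)) 0" by (intro continuous_intros)
  then have lim: "((\<lambda>t. norm (?z t)) \<longlongrightarrow> norm (x - y)) (nhds 0)"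
    unfolding isCont_def using tendsto_at_iff_tendsto_nhds[of "\<lambda>t. norm (?z t)" 0] by simp
  have pos: "\<forall>\<^sub>F t in nhds 0. norm (?z t) > 0"
    using order_tendstoD(1)[OF lim, of 0] z0 by simp
  have N: "((\<lambda>t. 1 / norm (?z t) ^ DIM('a)) has_real_derivative ?g * ker_deriv e (x - y)) (at 0)"
    using z0 by (intro DERIV_inverse_norm_power) auto
  have prod: "((\<lambda>t. jac \<rho> e t x * jac \<rho> e t y * f t) has_real_derivative
      (vfield_deriv \<rho> e x + vfield_deriv \<rho> e y) * f 0 + D) (at 0)"
    if "(f has_real_derivative D) (at 0)" for f D
    using DERIV_mult[OF DERIV_jac_product that] by (simp add: algebra_simps)
  have near: "((\<lambda>t. near_ker (?z t)) has_real_derivative ?g * (if norm (x - y) < 1 then ker_deriv e (x - y) else 0)) (at 0)"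
    and cut: "((\<lambda>t. cut_ker 1 (?z t)) has_real_derivative ?g * (if norm (x - y) > 1 then ker_deriv e (x - y) else 0)) (at 0)"
  proof -
    consider "norm (x - y) < 1" | "norm (x - y) > 1" using z1 by linarith
    then have "((\<lambda>t. near_ker (?z t)) has_real_derivative ?g * (if norm (x - y) < 1 then ker_deriv e (x - y) else 0)) (at 0) \<and>
      ((\<lambda>t. cut_ker 1 (?z t)) has_real_derivative ?g * (if norm (x - y) > 1 then ker_deriv e (x - y) else 0)) (at 0)"
    proof cases
      case 1
      then have ev: "\<forall>\<^sub>F t in nhds 0. norm (?z t) < 1" using order_tendstoD(2)[OF lim] by simp
      have "\<forall>\<^sub>F t in nhds 0. near_ker (?z t) = 1 / norm (?z t) ^ DIM('a) - 1"
        using ev pos by eventually_elim (intro near_ker_inside, auto)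
      then have "((\<lambda>t. near_ker (?z t)) has_real_derivative ?g * ker_deriv e (x - y)) (at 0)"
        by (subst DERIV_cong_ev[OF refl _ refl]) (use DERIV_diff[OF N DERIV_const[of 1]] in simp_all)
      moreover have "\<forall>\<^sub>F t in nhds 0. cut_ker 1 (?z t) = 1"
        using ev by eventually_elim (simp add: cut_ker_inside)
      then have "((\<lambda>t. cut_ker 1 (?z t)) has_real_derivative 0) (at 0)"
        by (subst DERIV_cong_ev[OF refl _ refl]) (rule DERIV_const | assumption)+
      ultimately show ?thesis using 1 by simp
    next
      case 2
      then have ev: "\<forall>\<^sub>F t in nhds 0. norm (?z t) > 1" using order_tendstoD(1)[OF lim] by simp
      have "\<forall>\<^sub>F t in nhds 0. near_ker (?z t) = 0"
        using ev by eventually_elim (simp add: near_ker_eq_0)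
      then have "((\<lambda>t. near_ker (?z t)) has_real_derivative 0) (at 0)"
        by (subst DERIV_cong_ev[OF refl _ refl]) (rule DERIV_const | assumption)+
      moreover have "\<forall>\<^sub>F t in nhds 0. cut_ker 1 (?z t) = 1 / norm (?z t) ^ DIM('a)"
        using ev by eventually_elim (simp add: cut_ker_outside)
      then have "((\<lambda>t. cut_ker 1 (?z t)) has_real_derivative ?g * ker_deriv e (x - y)) (at 0)"
        by (subst DERIV_cong_ev[OF refl _ refl]) (use N in simp_all)
      ultimately show ?thesis using 2 by simp
    qed
    then show "((\<lambda>t. near_ker (?z t)) has_real_derivative ?g * (if norm (x - y) < 1 then ker_deriv e (x - y) else 0)) (at 0)"
      "((\<lambda>t. cut_ker 1 (?z t)) has_real_derivative ?g * (if norm (x - y) > 1 then ker_deriv e (x - y) else 0)) (at 0)"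
      by blast+
  qed
  show "((\<lambda>t. jac \<rho> e t x * jac \<rho> e t y * near_ker (shift \<rho> e t x - shift \<rho> e t y)) has_real_derivative near_var \<rho> e (x, y)) (at 0)"
    using prod[OF near] by (simp add: shift_diff near_var_def split del: if_split cong: if_cong)
  show "((\<lambda>t. jac \<rho> e t x * jac \<rho> e t y * cut_ker 1 (shift \<rho> e t x - shift \<rho> e t y)) has_real_derivative cut_var \<rho> e (x, y)) (at 0)"
    using prod[OF cut] by (simp add: shift_diff cut_var_def split del: if_split cong: if_cong)
qed

definition ker_const :: "nat \<Rightarrow> real" where
  "ker_const n = 12 * (real n * 2 ^ n) + 13"

lemma
  fixes x y e :: "'a::euclidean_space"
  assumes \<rho>: "\<rho> > 0" and e: "e \<in> Basis" and t: "\<bar>t\<bar> \<le> 1/10" and xy: "x \<noteq> y"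
  shows near_diff_le: "\<bar>jac \<rho> e t x * jac \<rho> e t y * near_ker (shift \<rho> e t x - shift \<rho> e t y) - near_ker (x - y)\<bar>
      \<le> ker_const DIM('a) * \<bar>t\<bar> * (indicator (ball 0 2) (x - y) / norm (x - y) ^ DIM('a))"
    and cut_diff_le: "\<bar>jac \<rho> e t x * jac \<rho> e t y * cut_ker 1 (shift \<rho> e t x - shift \<rho> e t y) - cut_ker 1 (x - y)\<bar>
      \<le> ker_const DIM('a) * \<bar>t\<bar> * cut_ker 1 (x - y)"
proof -
  let ?n = "DIM('a)" and ?D = "real DIM('a) * 2 ^ DIM('a)"
  let ?J = "jac \<rho> e t x * jac \<rho> e t y"
  define z where "z = x - y"
  define z' where "z' = shift \<rho> e t x - shift \<rho> e t y"
  have z: "norm z > 0" using xy by (simp add: z_def)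
  have ge: "norm z' \<ge> norm z / 2" unfolding z_def z'_def by (rule shift_norm_ge[OF \<rho> e t])
  have diff: "\<bar>norm z' - norm z\<bar> \<le> 5 * \<bar>t\<bar> * norm z"
    using order_trans[OF norm_triangle_ineq3 shift_diff_le[OF \<rho> e t, of x y]] by (simp add: z_def z'_def)
  have J: "0 \<le> ?J" "?J \<le> 9/4"
    using mult_mono[OF jac_bounds(2)[OF \<rho> e t, of x] jac_bounds(2)[OF \<rho> e t, of y]] jac_nonneg[OF \<rho> e t] by auto
  have J1: "\<bar>?J - 1\<bar> \<le> 13 * \<bar>t\<bar>"
  proof -
    have a: "\<bar>t * vfield_deriv \<rho> e v\<bar> \<le> 5 * \<bar>t\<bar>" for v
      unfolding abs_mult using mult_left_mono[OF vfield_deriv_le[OF \<rho> e, of v], of "\<bar>t\<bar>"] by simp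
    have "?J - 1 = t * vfield_deriv \<rho> e x + t * vfield_deriv \<rho> e y + (t * vfield_deriv \<rho> e x) * (t * vfield_deriv \<rho> e y)"
      by (simp add: jac_def algebra_simps)
    moreover have "\<bar>(t * vfield_deriv \<rho> e x) * (t * vfield_deriv \<rho> e y)\<bar> \<le> (5 * \<bar>t\<bar>) * (1/2)"
      unfolding abs_mult[of "t * vfield_deriv \<rho> e x"] using a[of x] a[of y] t by (intro mult_mono) auto
    ultimately show ?thesis using a[of x] a[of y] by linarith
  qed
  have combine: "\<bar>?J * v' - v\<bar> \<le> ker_const ?n * \<bar>t\<bar> * B"
    if "\<bar>v' - v\<bar> \<le> 5 * ?D * \<bar>t\<bar> * B" "\<bar>v\<bar> \<le> B" for v v' B
  proof -
    have B: "B \<ge> 0" using that(2) by linarith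
    have "\<bar>?J * v' - v\<bar> = \<bar>?J * (v' - v) + (?J - 1) * v\<bar>"
      by (simp add: algebra_simps)
    also have "\<dots> \<le> ?J * \<bar>v' - v\<bar> + \<bar>?J - 1\<bar> * \<bar>v\<bar>"
      using J by (metis abs_mult abs_of_nonneg abs_triangle_ineq)
    also have "\<dots> \<le> 9/4 * (5 * ?D * \<bar>t\<bar> * B) + 13 * \<bar>t\<bar> * B"
      using J J1 that B by (intro add_mono mult_mono) auto
    also have "\<dots> \<le> ker_const ?n * \<bar>t\<bar> * B"
    proof -
      have "0 \<le> ?D * \<bar>t\<bar> * B" using B by simp
      then show ?thesis by (simp add: ker_const_def algebra_simps)
    qed
    finally show ?thesis .
  qed
  show "\<bar>?J * near_ker (shift \<rho> e t x - shift \<rho> e t y) - near_ker (x - y)\<bar> \<le> ker_const ?n * \<bar>t\<bar> * (indicator (ball 0 2) (x - y) / norm (x - y) ^ ?n)"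
    unfolding z_def[symmetric] z'_def[symmetric]
  proof (cases "norm z < 2")
    case True
    show "\<bar>?J * near_ker z' - near_ker z\<bar> \<le> ker_const ?n * \<bar>t\<bar> * (indicator (ball 0 2) z / norm z ^ ?n)"
    proof (rule combine)
      have "\<bar>near_ker z' - near_ker z\<bar> \<le> \<bar>1 / norm z' ^ ?n - 1 / norm z ^ ?n\<bar>"
        unfolding near_ker_def by linarith
      also have "\<dots> \<le> ?D * \<bar>norm z' - norm z\<bar> / norm z ^ Suc ?n"
        using z ge by (intro abs_inverse_power_diff_le) auto
      also have "\<dots> \<le> ?D * (5 * \<bar>t\<bar> * norm z) / norm z ^ Suc ?n"
        using diff by (intro divide_right_mono mult_left_mono) auto
      also have "\<dots> = 5 * ?D * \<bar>t\<bar> * (indicator (ball 0 2) z / norm z ^ ?n)"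
        using z True by simp
      finally show "\<bar>near_ker z' - near_ker z\<bar> \<le> 5 * ?D * \<bar>t\<bar> * (indicator (ball 0 2) z / norm z ^ ?n)" .
      show "\<bar>near_ker z\<bar> \<le> indicator (ball 0 2) z / norm z ^ ?n"
        using near_ker_le[of z] True by simp
    qed
  next
    case False
    then show "\<bar>?J * near_ker z' - near_ker z\<bar> \<le> ker_const ?n * \<bar>t\<bar> * (indicator (ball 0 2) z / norm z ^ ?n)"
      using ge by (simp add: near_ker_eq_0)
  qed
  show "\<bar>?J * cut_ker 1 (shift \<rho> e t x - shift \<rho> e t y) - cut_ker 1 (x - y)\<bar> \<le> ker_const ?n * \<bar>t\<bar> * cut_ker 1 (x - y)"
    unfolding z_def[symmetric] z'_def[symmetric]
  proof (rule combine)
    let ?m = "max 1 (norm z)" and ?m' = "max 1 (norm z')"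
    have "5 * \<bar>t\<bar> * norm z \<le> 5 * \<bar>t\<bar> * ?m" by (intro mult_left_mono) auto
    then have mm: "\<bar>?m' - ?m\<bar> \<le> 5 * \<bar>t\<bar> * ?m"
      using diff by (auto simp: max_def)
    have "\<bar>cut_ker 1 z' - cut_ker 1 z\<bar> \<le> ?D * \<bar>?m' - ?m\<bar> / ?m ^ Suc ?n"
      unfolding cut_ker_def using ge by (intro abs_inverse_power_diff_le) (auto simp: max_def)
    also have "\<dots> \<le> ?D * (5 * \<bar>t\<bar> * ?m) / ?m ^ Suc ?n"
      using mm by (intro divide_right_mono mult_left_mono) auto
    also have "\<dots> = 5 * ?D * \<bar>t\<bar> * cut_ker 1 z"
      by (simp add: cut_ker_def)
    finally show "\<bar>cut_ker 1 z' - cut_ker 1 z\<bar> \<le> 5 * ?D * \<bar>t\<bar> * cut_ker 1 z" .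
  qed simp
qed

definition near_weight :: "'a::euclidean_space \<times> 'a \<Rightarrow> real" where
  "near_weight p = indicator (ball 0 2) (fst p - snd p) / norm (fst p - snd p) ^ DIM('a)"

lemma near_weight_nonneg: "near_weight p \<ge> 0"
  by (simp add: near_weight_def)

lemma near_weight_measurable [measurable]: "near_weight \<in> borel_measurable (lborel \<Otimes>\<^sub>M lborel)"
  unfolding near_weight_def indicator_def mem_ball_0 by measurable

context log_equation_entropy
begin

lemma ball_square_integrable:
  "integrable (lborel \<Otimes>\<^sub>M lborel) (\<lambda>p. indicator (ball 0 r) (fst p - snd p) * (u (fst p))\<^sup>2)"
  "integrable (lborel \<Otimes>\<^sub>M lborel) (\<lambda>p. indicator (ball 0 r) (fst p - snd p) * (u (snd p))\<^sup>2)"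
proof -
  have i: "integrable lborel (\<lambda>z::'a. indicator (ball 0 r) z :: real)"
    using emeasure_lborel_ball_finite[of "0::'a" r] by (intro integrable_real_indicator) auto
  show "integrable (lborel \<Otimes>\<^sub>M lborel) (\<lambda>p. indicator (ball 0 r) (fst p - snd p) * (u (fst p))\<^sup>2)"
    using integrable_lborel_pair_diff[OF square_int i] by (simp add: mult.commute)
  have "indicator (ball 0 r) (- z) = (indicator (ball 0 r) z :: real)" for z :: 'a
    by (simp add: indicator_def)
  then show "integrable (lborel \<Otimes>\<^sub>M lborel) (\<lambda>p. indicator (ball 0 r) (fst p - snd p) * (u (snd p))\<^sup>2)"
    using integrable_lborel_pair_diff_snd[OF square_int i] by (simp add: mult.commute)
qed

lemma ball_square_integral:
  "(\<integral>p. indicator (ball 0 1) (fst p - snd p) * (u (fst p))\<^sup>2 \<partial>(lborel \<Otimes>\<^sub>M lborel)) = unit_ball_vol DIM('a) * (\<integral>x. (u x)\<^sup>2 \<partial>lborel)"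
  "(\<integral>p. indicator (ball 0 1) (fst p - snd p) * (u (snd p))\<^sup>2 \<partial>(lborel \<Otimes>\<^sub>M lborel)) = unit_ball_vol DIM('a) * (\<integral>x. (u x)\<^sup>2 \<partial>lborel)"
proof -
  let ?F = "\<lambda>p. indicator (ball 0 1) (fst p - snd p) * (u (fst p))\<^sup>2"
  have i: "integrable lborel (\<lambda>z::'a. indicator (ball 0 1) z :: real)"
    using emeasure_lborel_ball_finite[of "0::'a" 1] by (intro integrable_real_indicator) auto
  show 1: "(\<integral>p. ?F p \<partial>(lborel \<Otimes>\<^sub>M lborel)) = unit_ball_vol DIM('a) * (\<integral>x. (u x)\<^sup>2 \<partial>lborel)"
    using integral_lborel_pair_diff[OF square_int i] by (simp add: mult.commute content_ball)
  have "?F (snd p, fst p) = indicator (ball 0 1) (fst p - snd p) * (u (snd p))\<^sup>2" for p :: "'a \<times> 'a"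
    by (simp add: indicator_def norm_minus_commute)
  moreover have "?F \<in> borel_measurable (lborel \<Otimes>\<^sub>M lborel)"
    using ball_square_integrable(1)[of 1] by (rule borel_measurable_integrable)
  ultimately show "(\<integral>p. indicator (ball 0 1) (fst p - snd p) * (u (snd p))\<^sup>2 \<partial>(lborel \<Otimes>\<^sub>M lborel)) = unit_ball_vol DIM('a) * (\<integral>x. (u x)\<^sup>2 \<partial>lborel)"
    using integral_lborel_pair_swap[of ?F] 1 by (simp only:)
qed

lemma near_weight_integrable:
  "integrable (lborel \<Otimes>\<^sub>M lborel) (\<lambda>p. near_weight p * ((u (fst p) - u (snd p)) * (u (fst p) - u (snd p))))"
proof (rule Bochner_Integration.integrable_bound)
  let ?B = "\<lambda>p. near_ker (fst p - snd p) * (u (fst p) - u (snd p)) * (u (fst p) - u (snd p))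
    + 2 * (indicator (ball 0 2) (fst p - snd p) * (u (fst p))\<^sup>2 + indicator (ball 0 2) (fst p - snd p) * (u (snd p))\<^sup>2)"
  show "integrable (lborel \<Otimes>\<^sub>M lborel) ?B"
    by (intro Bochner_Integration.integrable_add integrable_mult_right near_energy_integrable ball_square_integrable)
  show "AE p in lborel \<Otimes>\<^sub>M lborel. norm (near_weight p * ((u (fst p) - u (snd p)) * (u (fst p) - u (snd p)))) \<le> norm (?B p)"
  proof (rule AE_I2)
    fix p :: "'a \<times> 'a"
    obtain x y where p: "p = (x, y)" by (cases p)
    let ?d = "(u x - u y) * (u x - u y)" and ?i = "indicator (ball 0 2) (x - y) :: real"
    have w: "near_weight p \<le> near_ker (x - y) + ?i"
    proof (cases "x = y")
      case False
      then show ?thesis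
        using kernel_split[of "x - y"] cut_ker_le_1[of "x - y"] by (auto simp: p near_weight_def split: split_indicator)
    qed (simp add: p near_weight_def zero_power)
    have "near_weight p * ?d \<le> (near_ker (x - y) + ?i) * ?d"
      using w by (intro mult_right_mono) auto
    also have "\<dots> \<le> near_ker (x - y) * ?d + ?i * (2 * ((u x)\<^sup>2 + (u y)\<^sup>2))"
    proof -
      have "0 \<le> (u x + u y)\<^sup>2" by simp
      then have "?d \<le> 2 * ((u x)\<^sup>2 + (u y)\<^sup>2)"
        by (simp add: power2_eq_square algebra_simps)
      then have "?i * ?d \<le> ?i * (2 * ((u x)\<^sup>2 + (u y)\<^sup>2))" by (intro mult_left_mono) auto
      then show ?thesis by (simp add: distrib_right)
    qed
    also have "\<dots> = ?B p" by (simp add: p algebra_simps)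
    finally have "near_weight p * ?d \<le> ?B p" .
    then show "norm (near_weight p * ((u (fst p) - u (snd p)) * (u (fst p) - u (snd p)))) \<le> norm (?B p)"
      using near_weight_nonneg[of p] by (simp add: p abs_mult)
  qed
qed measurable

lemma entropy_fn_integrable: "integrable lborel (\<lambda>x. entropy_fn (u x))"
  unfolding entropy_fn_def using square_int entropy_int by simp

lemma bounded_mult_integrable:
  assumes [measurable]: "v \<in> borel_measurable borel" and v: "\<And>x. \<bar>v x\<bar> \<le> K" and f: "integrable lborel f"
  shows "integrable lborel (\<lambda>x. v x * f x :: real)"
proof (rule Bochner_Integration.integrable_bound)
  show "integrable lborel (\<lambda>x. K * f x)" using f by simp
  have "\<bar>v x\<bar> \<le> \<bar>K\<bar>" for x using v[of x] by linarith
  then show "AE x in lborel. norm (v x * f x) \<le> norm (K * f x)"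
    by (intro AE_I2) (simp add: abs_mult mult_right_mono)
  show "(\<lambda>x. v x * f x) \<in> borel_measurable lborel"
    using borel_measurable_integrable[OF f] by measurable
qed

theorem first_variation:
  assumes \<rho>: "\<rho> > 0" and e: "e \<in> Basis"
  shows "c * ((\<integral>p. near_var \<rho> e p * ((u (fst p) - u (snd p)) * (u (fst p) - u (snd p))) \<partial>(lborel \<Otimes>\<^sub>M lborel)) / 2
       - (\<integral>p. cut_var \<rho> e p * (u (snd p) * u (fst p)) \<partial>(lborel \<Otimes>\<^sub>M lborel)))
     + b * (\<integral>x. vfield_deriv \<rho> e x * (u x)\<^sup>2 \<partial>lborel) - 2 * k * (\<integral>x. vfield_deriv \<rho> e x * entropy_fn (u x) \<partial>lborel) = 0"
proof -
  let ?P = "lborel \<Otimes>\<^sub>M lborel :: ('a \<times> 'a) measure"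
  let ?d = "\<lambda>p. (u (fst p) - u (snd p)) * (u (fst p) - u (snd p))"
  let ?f = "\<lambda>p. u (snd p) * u (fst p)"
  let ?JJ = "\<lambda>t p. jac \<rho> e t (fst p) * jac \<rho> e t (snd p)"
  let ?K = "ker_const DIM('a)"
  obtain C t0 where t0: "t0 > 0" "t0 \<le> 1/10" and est: "\<And>t. \<bar>t\<bar> \<le> t0 \<Longrightarrow>
    \<bar>(c * ((\<integral>p. ?JJ t p * (near_ker (shift \<rho> e t (fst p) - shift \<rho> e t (snd p))
          * (u (fst p) - u (snd p)) * (u (fst p) - u (snd p))) \<partial>?P) / 2
        - (\<integral>p. ?JJ t p * (cut_ker 1 (shift \<rho> e t (fst p) - shift \<rho> e t (snd p))
          * u (snd p) * u (fst p)) \<partial>?P))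
      + b * (\<integral>x. jac \<rho> e t x * (u x)\<^sup>2 \<partial>lborel) - 2 * k * (\<integral>x. jac \<rho> e t x * entropy_fn (u x) \<partial>lborel))
     - (c * (near_form u u / 2 - cut_form u u) + b * (\<integral>x. (u x)\<^sup>2 \<partial>lborel) - 2 * k * (\<integral>x. entropy_fn (u x) \<partial>lborel))\<bar>
    \<le> C * \<bar>t\<bar> powr (9/8)"
    using variation_estimate[OF \<rho> e] by blast
  define \<tau> where "\<tau> = (\<lambda>j. t0 * inverse (real (Suc j)))"
  have \<tau>: "\<tau> j > 0" "\<tau> j \<le> t0" for j
    using t0(1) by (auto simp: \<tau>_def field_simps)
  then have \<tau>10: "\<bar>\<tau> j\<bar> \<le> 1/10" for j using t0(2) \<tau>(1)[of j] \<tau>(2)[of j] by linarith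
  have \<tau>lim: "\<tau> \<longlonglongrightarrow> 0"
  proof -
    have "(\<lambda>j. t0 * inverse (real (Suc j))) \<longlonglongrightarrow> t0 * 0" by (intro tendsto_intros LIMSEQ_inverse_real_of_nat)
    then show ?thesis by (simp add: \<tau>_def)
  qed
  have \<tau>at: "filterlim \<tau> (at 0) sequentially"
  proof (rule filterlim_atI[OF \<tau>lim])
    show "\<forall>\<^sub>F j in sequentially. \<tau> j \<noteq> 0" using \<tau>(1) by (intro always_eventually allI) (metis less_irrefl)
  qed
  define X where "X = (\<lambda>j p. (?JJ (\<tau> j) p * near_ker (shift \<rho> e (\<tau> j) (fst p) - shift \<rho> e (\<tau> j) (snd p)) - near_ker (fst p - snd p)) / \<tau> j)"
  define Y where "Y = (\<lambda>j p. (?JJ (\<tau> j) p * cut_ker 1 (shift \<rho> e (\<tau> j) (fst p) - shift \<rho> e (\<tau> j) (snd p)) - cut_ker 1 (fst p - snd p)) / \<tau> j)"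
  have [measurable]: "X j \<in> borel_measurable ?P" "Y j \<in> borel_measurable ?P" for j
    unfolding X_def Y_def by measurable
  have X_le: "\<bar>X j p\<bar> \<le> ?K * near_weight p" and Y_le: "\<bar>Y j p\<bar> \<le> ?K * cut_ker 1 (fst p - snd p)" if "norm (fst p - snd p) \<noteq> 0" for j p
  proof -
    have xy: "fst p \<noteq> snd p" using that by auto
    have div: "\<bar>v / s\<bar> \<le> \<kappa> * w" if "\<bar>v\<bar> \<le> \<kappa> * \<bar>s\<bar> * w" "s > 0" for v s \<kappa> w :: real
      using that by (simp add: abs_divide pos_divide_le_eq mult_ac)
    show "\<bar>X j p\<bar> \<le> ?K * near_weight p"
      unfolding X_def near_weight_def by (rule div[OF near_diff_le[OF \<rho> e \<tau>10 xy] \<tau>(1)])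
    show "\<bar>Y j p\<bar> \<le> ?K * cut_ker 1 (fst p - snd p)"
      unfolding Y_def by (rule div[OF cut_diff_le[OF \<rho> e \<tau>10 xy] \<tau>(1)])
  qed
  have K: "?K \<ge> 0" by (simp add: ker_const_def)
  have X_dom: "AE p in ?P. norm (X j p * ?d p) \<le> ?K * (near_weight p * ?d p)" for j
    using AE_lborel_pair_norm_diff_neq[of 0]
  proof eventually_elim
    case (elim p)
    show ?case using mult_right_mono[OF X_le[OF elim, of j], of "?d p"] by (simp add: abs_mult mult.assoc)
  qed
  have Y_dom: "AE p in ?P. norm (Y j p * ?f p) \<le> ?K * (cut_ker 1 (fst p - snd p) * u (snd p) * u (fst p))" for j
    using AE_lborel_pair_norm_diff_neq[of 0]
  proof eventually_elim
    case (elim p)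
    show ?case using mult_right_mono[OF Y_le[OF elim, of j], of "?f p"] u_nonneg by (simp add: abs_mult mult.assoc)
  qed
  have X_lim: "AE p in ?P. (\<lambda>j. X j p * ?d p) \<longlonglongrightarrow> near_var \<rho> e p * ?d p"
    using AE_lborel_pair_norm_diff_neq[of 0] AE_lborel_pair_norm_diff_neq[of 1]
  proof eventually_elim
    case (elim p)
    obtain x y where p: "p = (x, y)" by (cases p)
    have "((\<lambda>h. (jac \<rho> e (0 + h) x * jac \<rho> e (0 + h) y * near_ker (shift \<rho> e (0 + h) x - shift \<rho> e (0 + h) y)
        - jac \<rho> e 0 x * jac \<rho> e 0 y * near_ker (shift \<rho> e 0 x - shift \<rho> e 0 y)) / h) \<longlongrightarrow> near_var \<rho> e (x, y)) (at 0)"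
      using elim by (intro DERIV_near[of x y \<rho> e, unfolded DERIV_def]) (auto simp: p)
    from filterlim_compose[OF this \<tau>at] have "(\<lambda>j. X j p) \<longlonglongrightarrow> near_var \<rho> e p"
      by (simp add: X_def p)
    then show ?case by (intro tendsto_intros)
  qed
  have Y_lim: "AE p in ?P. (\<lambda>j. Y j p * ?f p) \<longlonglongrightarrow> cut_var \<rho> e p * ?f p"
    using AE_lborel_pair_norm_diff_neq[of 0] AE_lborel_pair_norm_diff_neq[of 1]
  proof eventually_elim
    case (elim p)
    obtain x y where p: "p = (x, y)" by (cases p)
    have "((\<lambda>h. (jac \<rho> e (0 + h) x * jac \<rho> e (0 + h) y * cut_ker 1 (shift \<rho> e (0 + h) x - shift \<rho> e (0 + h) y)
        - jac \<rho> e 0 x * jac \<rho> e 0 y * cut_ker 1 (shift \<rho> e 0 x - shift \<rho> e 0 y)) / h) \<longlongrightarrow> cut_var \<rho> e (x, y)) (at 0)"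
      using elim by (intro DERIV_cut[of x y \<rho> e, unfolded DERIV_def]) (auto simp: p)
    from filterlim_compose[OF this \<tau>at] have "(\<lambda>j. Y j p) \<longlonglongrightarrow> cut_var \<rho> e p"
      by (simp add: Y_def p)
    then show ?case by (intro tendsto_intros)
  qed
  have wK: "integrable ?P (\<lambda>p. ?K * (near_weight p * ?d p))" by (intro integrable_mult_right near_weight_integrable)
  have cK: "integrable ?P (\<lambda>p. ?K * (cut_ker 1 (fst p - snd p) * u (snd p) * u (fst p)))" by (intro integrable_mult_right far_energy_integrable)
  have X_int: "integrable ?P (\<lambda>p. X j p * ?d p)" for j
    by (rule Bochner_Integration.integrable_bound[OF wK])
      (measurable, use X_dom[of j] in \<open>auto elim!: eventually_mono intro: order_trans[OF _ abs_ge_self]\<close>)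
  have Y_int: "integrable ?P (\<lambda>p. Y j p * ?f p)" for j
    by (rule Bochner_Integration.integrable_bound[OF cK])
      (measurable, use Y_dom[of j] in \<open>auto elim!: eventually_mono intro: order_trans[OF _ abs_ge_self]\<close>)
  have XI: "(\<lambda>j. \<integral>p. X j p * ?d p \<partial>?P) \<longlonglongrightarrow> (\<integral>p. near_var \<rho> e p * ?d p \<partial>?P)"
    by (rule integral_dominated_convergence[OF _ _ wK X_lim X_dom]) measurable
  have YI: "(\<lambda>j. \<integral>p. Y j p * ?f p \<partial>?P) \<longlonglongrightarrow> (\<integral>p. cut_var \<rho> e p * ?f p \<partial>?P)"
    by (rule integral_dominated_convergence[OF _ _ cK Y_lim Y_dom]) measurable
  define S where "S = (\<integral>x. vfield_deriv \<rho> e x * (u x)\<^sup>2 \<partial>lborel)"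
  define H where "H = (\<integral>x. vfield_deriv \<rho> e x * entropy_fn (u x) \<partial>lborel)"
  define V where "V = (\<lambda>j. c * ((\<integral>p. X j p * ?d p \<partial>?P) / 2 - (\<integral>p. Y j p * ?f p \<partial>?P)) + b * S - 2 * k * H)"
  have V_le: "\<bar>V j\<bar> \<le> C * \<tau> j powr (1/8)" for j
  proof -
    let ?t = "\<tau> j"
    have nz: "?t \<noteq> 0" using \<tau>(1)[of j] by simp
    have expand: "J * (n * v * v') = n0 * v * v' + s * ((J * n - n0) / s * (v * v'))" if "s \<noteq> 0" for J n n0 v v' s :: real
      using that by (simp add: field_simps)
    have "?JJ ?t p * (near_ker (shift \<rho> e ?t (fst p) - shift \<rho> e ?t (snd p)) * (u (fst p) - u (snd p)) * (u (fst p) - u (snd p)))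
      = near_ker (fst p - snd p) * (u (fst p) - u (snd p)) * (u (fst p) - u (snd p)) + ?t * (X j p * ?d p)" for p
      unfolding X_def by (rule expand[OF nz])
    then have A: "(\<integral>p. ?JJ ?t p * (near_ker (shift \<rho> e ?t (fst p) - shift \<rho> e ?t (snd p)) * (u (fst p) - u (snd p)) * (u (fst p) - u (snd p))) \<partial>?P)
      = near_form u u + ?t * (\<integral>p. X j p * ?d p \<partial>?P)"
      using near_energy_integrable X_int[of j] by (simp add: near_form_def)
    have "?JJ ?t p * (cut_ker 1 (shift \<rho> e ?t (fst p) - shift \<rho> e ?t (snd p)) * u (snd p) * u (fst p))
      = cut_ker 1 (fst p - snd p) * u (snd p) * u (fst p) + ?t * (Y j p * ?f p)" for p
      unfolding Y_def by (rule expand[OF nz])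
    then have B: "(\<integral>p. ?JJ ?t p * (cut_ker 1 (shift \<rho> e ?t (fst p) - shift \<rho> e ?t (snd p)) * u (snd p) * u (fst p)) \<partial>?P)
      = cut_form u u + ?t * (\<integral>p. Y j p * ?f p \<partial>?P)"
      using far_energy_integrable Y_int[of j] by (simp add: cut_form_def)
    have i1: "integrable lborel (\<lambda>x. vfield_deriv \<rho> e x * (u x)\<^sup>2)"
      by (rule bounded_mult_integrable[OF _ vfield_deriv_le[OF \<rho> e] square_int]) measurable
    have i2: "integrable lborel (\<lambda>x. vfield_deriv \<rho> e x * entropy_fn (u x))"
      by (rule bounded_mult_integrable[OF _ vfield_deriv_le[OF \<rho> e] entropy_fn_integrable]) measurable
    have S': "(\<integral>x. jac \<rho> e ?t x * (u x)\<^sup>2 \<partial>lborel) = (\<integral>x. (u x)\<^sup>2 \<partial>lborel) + ?t * S"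
      unfolding S_def jac_def using i1 square_int by (simp add: distrib_right mult.assoc)
    have H': "(\<integral>x. jac \<rho> e ?t x * entropy_fn (u x) \<partial>lborel) = (\<integral>x. entropy_fn (u x) \<partial>lborel) + ?t * H"
      unfolding H_def jac_def using i2 entropy_fn_integrable by (simp add: distrib_right mult.assoc)
    have collect: "(c * ((nf + s * ix) / 2 - (cf + s * iy)) + b * (u2 + s * S) - 2 * k * (h + s * H)) - (c * (nf / 2 - cf) + b * u2 - 2 * k * h)
      = s * (c * (ix / 2 - iy) + b * S - 2 * k * H)" for nf cf u2 h ix iy s :: real
      by (simp add: field_simps)
    have Vj: "c * ((\<integral>p. X j p * ?d p \<partial>?P) / 2 - (\<integral>p. Y j p * ?f p \<partial>?P)) + b * S - 2 * k * H = V j"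
      by (simp only: V_def)
    have "\<bar>?t\<bar> \<le> t0" using \<tau>(1)[of j] \<tau>(2)[of j] by linarith
    from est[OF this] have "\<bar>?t * V j\<bar> \<le> C * \<bar>?t\<bar> powr (9/8)"
      unfolding A B S' H' collect Vj .
    also have "\<bar>?t\<bar> powr (9/8) = ?t * ?t powr (1/8)"
      using \<tau>(1)[of j] powr_add[of ?t 1 "1/8"] by simp
    finally have "?t * \<bar>V j\<bar> \<le> ?t * (C * ?t powr (1/8))"
      using \<tau>(1)[of j] by (simp add: abs_mult mult_ac)
    then show ?thesis using \<tau>(1)[of j] by simp
  qed
  have "(\<lambda>j. C * \<tau> j powr (1/8)) \<longlonglongrightarrow> C * 0"
  proof (intro tendsto_intros)
    have "(\<lambda>j. \<tau> j powr (1/8)) \<longlonglongrightarrow> 0 powr (1/8)"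
      using \<tau>(1) by (intro tendsto_powr2 \<tau>lim tendsto_const always_eventually) (auto intro: less_imp_le)
    then show "(\<lambda>j. \<tau> j powr (1/8)) \<longlonglongrightarrow> 0" by simp
  qed
  then have "V \<longlonglongrightarrow> 0"
    using V_le by (intro Lim_null_comparison[of V "\<lambda>j. C * \<tau> j powr (1/8)"]) auto
  moreover have "V \<longlonglongrightarrow> c * ((\<integral>p. near_var \<rho> e p * ?d p \<partial>?P) / 2 - (\<integral>p. cut_var \<rho> e p * ?f p \<partial>?P)) + b * S - 2 * k * H"
    unfolding V_def by (intro tendsto_intros XI YI) simp
  ultimately show ?thesis
    unfolding S_def H_def by (rule LIMSEQ_unique[symmetric])
qed

end

section \<open>The Pohozaev identity\<close>

definition near_dil :: "'a \<Rightarrow> 'a::euclidean_space \<times> 'a \<Rightarrow> real" where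
  "near_dil e p = 2 * near_ker (fst p - snd p)
    + ((fst p - snd p) \<bullet> e) * (if norm (fst p - snd p) < 1 then ker_deriv e (fst p - snd p) else 0)"

definition cut_dil :: "'a \<Rightarrow> 'a::euclidean_space \<times> 'a \<Rightarrow> real" where
  "cut_dil e p = 2 * cut_ker 1 (fst p - snd p)
    + ((fst p - snd p) \<bullet> e) * (if norm (fst p - snd p) > 1 then ker_deriv e (fst p - snd p) else 0)"

lemma near_dil_measurable [measurable]: "near_dil e \<in> borel_measurable (lborel \<Otimes>\<^sub>M lborel)"
  unfolding near_dil_def by measurable

lemma cut_dil_measurable [measurable]: "cut_dil e \<in> borel_measurable (lborel \<Otimes>\<^sub>M lborel)"
  unfolding cut_dil_def by measurable

lemma near_var_tendsto: "(\<lambda>m. near_var (real (Suc m)) e p) \<longlonglongrightarrow> near_dil e p"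
proof -
  have "(\<lambda>m. near_var (real (Suc m)) e p) \<longlonglongrightarrow> (1 + 1) * near_ker (fst p - snd p)
    + (fst p \<bullet> e - snd p \<bullet> e) * (if norm (fst p - snd p) < 1 then ker_deriv e (fst p - snd p) else 0)"
    unfolding near_var_def by (intro tendsto_intros vfield_tendsto vfield_deriv_tendsto)
  then show ?thesis by (simp add: near_dil_def inner_diff_left split del: if_split)
qed

lemma cut_var_tendsto: "(\<lambda>m. cut_var (real (Suc m)) e p) \<longlonglongrightarrow> cut_dil e p"
proof -
  have "(\<lambda>m. cut_var (real (Suc m)) e p) \<longlonglongrightarrow> (1 + 1) * cut_ker 1 (fst p - snd p)
    + (fst p \<bullet> e - snd p \<bullet> e) * (if norm (fst p - snd p) > 1 then ker_deriv e (fst p - snd p) else 0)"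
    unfolding cut_var_def by (intro tendsto_intros vfield_tendsto vfield_deriv_tendsto)
  then show ?thesis by (simp add: cut_dil_def inner_diff_left split del: if_split)
qed

lemma ker_deriv_mult_le:
  fixes z e :: "'a::euclidean_space"
  assumes "e \<in> Basis" "\<bar>g\<bar> \<le> 5 * norm z"
  shows "\<bar>g * ker_deriv e z\<bar> \<le> 5 * real DIM('a) * (1 / norm z ^ DIM('a))"
proof (cases "z = 0")
  case False
  have "\<bar>g * ker_deriv e z\<bar> = \<bar>g\<bar> * (real DIM('a) * \<bar>z \<bullet> e\<bar> / norm z ^ (DIM('a) + 2))"
    by (simp add: ker_deriv_def abs_mult)
  also have "\<dots> \<le> (5 * norm z) * (real DIM('a) * norm z / norm z ^ (DIM('a) + 2))"
    using assms(2) abs_inner_Basis_le[OF assms(1), of z] by (intro mult_mono divide_right_mono mult_left_mono) auto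
  also have "\<dots> = 5 * real DIM('a) * (1 / norm z ^ DIM('a))"
    using False by (simp add: field_simps)
  finally show ?thesis .
qed (simp add: ker_deriv_def)

lemma
  fixes e :: "'a::euclidean_space"
  assumes \<rho>: "\<rho> > 0" and e: "e \<in> Basis"
  shows near_var_le: "\<bar>near_var \<rho> e p\<bar> \<le> (10 + 5 * real DIM('a)) * near_weight p"
    and cut_var_le: "\<bar>cut_var \<rho> e p\<bar> \<le> (10 + 5 * real DIM('a)) * cut_ker 1 (fst p - snd p)"
proof -
  let ?n = "real DIM('a)"
  define z where "z = fst p - snd p"
  let ?s = "vfield_deriv \<rho> e (fst p) + vfield_deriv \<rho> e (snd p)"
  let ?g = "vfield \<rho> e (fst p) - vfield \<rho> e (snd p)"
  have s: "\<bar>?s\<bar> \<le> 10"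
    using vfield_deriv_le[OF \<rho> e, of "fst p"] vfield_deriv_le[OF \<rho> e, of "snd p"] by linarith
  have g: "\<bar>?g\<bar> \<le> 5 * norm z" unfolding z_def by (rule vfield_lipschitz[OF \<rho> e])
  note kd = ker_deriv_mult_le[OF e g]
  have 1: "\<bar>?s * near_ker z\<bar> \<le> 10 * near_weight p"
  proof -
    have "near_ker z \<le> near_weight p"
      using near_ker_le[of z] near_ker_eq_0[of z] by (auto simp: near_weight_def z_def[symmetric] split: split_indicator)
    then show ?thesis unfolding abs_mult using s by (intro mult_mono) auto
  qed
  have 2: "\<bar>?g * (if norm z < 1 then ker_deriv e z else 0)\<bar> \<le> 5 * ?n * near_weight p"
    using kd near_weight_nonneg[of p] by (auto simp: near_weight_def z_def[symmetric] split: split_indicator)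
  show "\<bar>near_var \<rho> e p\<bar> \<le> (10 + 5 * ?n) * near_weight p"
    using 1 2 unfolding near_var_def z_def[symmetric] distrib_right by linarith
  have 3: "\<bar>?s * cut_ker 1 z\<bar> \<le> 10 * cut_ker 1 z"
    unfolding abs_mult using s by (intro mult_mono) auto
  have 4: "\<bar>?g * (if norm z > 1 then ker_deriv e z else 0)\<bar> \<le> 5 * ?n * cut_ker 1 z"
    using kd by (auto simp: cut_ker_outside)
  show "\<bar>cut_var \<rho> e p\<bar> \<le> (10 + 5 * ?n) * cut_ker 1 (fst p - snd p)"
    using 3 4 unfolding cut_var_def z_def[symmetric] distrib_right by linarith
qed

lemma sum_inner_ker_deriv:
  fixes z :: "'a::euclidean_space"
  assumes "z \<noteq> 0"
  shows "(\<Sum>e\<in>Basis. (z \<bullet> e) * ker_deriv e z) = - real DIM('a) / norm z ^ DIM('a)"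
proof -
  have "(\<Sum>e\<in>Basis. (z \<bullet> e) * ker_deriv e z) = (\<Sum>e\<in>Basis. (- real DIM('a) / norm z ^ (DIM('a) + 2)) * (z \<bullet> e)\<^sup>2)"
    by (intro sum.cong) (auto simp: ker_deriv_def power2_eq_square)
  also have "\<dots> = (- real DIM('a) / norm z ^ (DIM('a) + 2)) * (\<Sum>e\<in>Basis. (z \<bullet> e)\<^sup>2)"
    by (simp only: sum_distrib_left)
  also have "(\<Sum>e\<in>Basis. (z \<bullet> e)\<^sup>2) = (norm z)\<^sup>2"
    unfolding power2_norm_eq_inner by (rule trans[OF _ euclidean_inner[symmetric]]) (simp add: power2_eq_square)
  finally show ?thesis using assms by (simp add: power_add power2_eq_square)
qed

lemma
  fixes p :: "'a::euclidean_space \<times> 'a"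
  assumes z0: "norm (fst p - snd p) \<noteq> 0" and z1: "norm (fst p - snd p) \<noteq> 1"
  shows sum_near_dil: "(\<Sum>e\<in>Basis. near_dil e p) = real DIM('a) * (near_ker (fst p - snd p) - indicator (ball 0 1) (fst p - snd p))"
    and sum_cut_dil: "(\<Sum>e\<in>Basis. cut_dil e p) = real DIM('a) * (cut_ker 1 (fst p - snd p) + indicator (ball 0 1) (fst p - snd p))"
proof -
  let ?n = "real DIM('a)"
  define z where "z = fst p - snd p"
  have zz: "z \<noteq> 0" "norm z \<noteq> 1" using z0 z1 by (auto simp: z_def)
  have "(\<Sum>e\<in>Basis. near_dil e p) = 2 * ?n * near_ker z + (if norm z < 1 then (\<Sum>e\<in>Basis. (z \<bullet> e) * ker_deriv e z) else 0)"
    by (simp add: near_dil_def z_def[symmetric] sum.distrib)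
  also have "\<dots> = ?n * (near_ker z - indicator (ball 0 1) z)"
    using zz by (auto simp: sum_inner_ker_deriv near_ker_inside near_ker_eq_0 algebra_simps)
  finally show "(\<Sum>e\<in>Basis. near_dil e p) = ?n * (near_ker (fst p - snd p) - indicator (ball 0 1) (fst p - snd p))"
    by (simp add: z_def)
  have "(\<Sum>e\<in>Basis. cut_dil e p) = 2 * ?n * cut_ker 1 z + (if norm z > 1 then (\<Sum>e\<in>Basis. (z \<bullet> e) * ker_deriv e z) else 0)"
    by (simp add: cut_dil_def z_def[symmetric] sum.distrib)
  also have "\<dots> = ?n * (cut_ker 1 z + indicator (ball 0 1) z)"
    using zz by (auto simp: sum_inner_ker_deriv cut_ker_inside cut_ker_outside algebra_simps)
  finally show "(\<Sum>e\<in>Basis. cut_dil e p) = ?n * (cut_ker 1 (fst p - snd p) + indicator (ball 0 1) (fst p - snd p))"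
    by (simp add: z_def)
qed

context log_equation_entropy
begin

lemma
  assumes e: "e \<in> Basis"
  shows near_dil_integrable: "integrable (lborel \<Otimes>\<^sub>M lborel) (\<lambda>p. near_dil e p * ((u (fst p) - u (snd p)) * (u (fst p) - u (snd p))))"
    and cut_dil_integrable: "integrable (lborel \<Otimes>\<^sub>M lborel) (\<lambda>p. cut_dil e p * (u (snd p) * u (fst p)))"
    and directional_identity: "c * ((\<integral>p. near_dil e p * ((u (fst p) - u (snd p)) * (u (fst p) - u (snd p))) \<partial>(lborel \<Otimes>\<^sub>M lborel)) / 2
       - (\<integral>p. cut_dil e p * (u (snd p) * u (fst p)) \<partial>(lborel \<Otimes>\<^sub>M lborel)))
     + b * (\<integral>x. (u x)\<^sup>2 \<partial>lborel) - 2 * k * (\<integral>x. entropy_fn (u x) \<partial>lborel) = 0"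
proof -
  let ?P = "lborel \<Otimes>\<^sub>M lborel :: ('a \<times> 'a) measure"
  let ?d = "\<lambda>p. (u (fst p) - u (snd p)) * (u (fst p) - u (snd p))"
  let ?f = "\<lambda>p. u (snd p) * u (fst p)"
  let ?K = "10 + 5 * real DIM('a)"
  define \<rho> where "\<rho> = (\<lambda>m. real (Suc m))"
  have \<rho>: "\<rho> m > 0" for m by (simp add: \<rho>_def)
  have wK: "integrable ?P (\<lambda>p. ?K * (near_weight p * ?d p))" by (intro integrable_mult_right near_weight_integrable)
  have cK: "integrable ?P (\<lambda>p. ?K * (cut_ker 1 (fst p - snd p) * u (snd p) * u (fst p)))" by (intro integrable_mult_right far_energy_integrable)
  have X_dom: "AE p in ?P. norm (near_var (\<rho> m) e p * ?d p) \<le> ?K * (near_weight p * ?d p)" for m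
  proof (rule AE_I2)
    fix p
    show "norm (near_var (\<rho> m) e p * ?d p) \<le> ?K * (near_weight p * ?d p)"
      using mult_right_mono[OF near_var_le[OF \<rho> e, of m p], of "?d p"] by (simp add: abs_mult mult.assoc)
  qed
  have Y_dom: "AE p in ?P. norm (cut_var (\<rho> m) e p * ?f p) \<le> ?K * (cut_ker 1 (fst p - snd p) * u (snd p) * u (fst p))" for m
  proof (rule AE_I2)
    fix p
    show "norm (cut_var (\<rho> m) e p * ?f p) \<le> ?K * (cut_ker 1 (fst p - snd p) * u (snd p) * u (fst p))"
      using mult_right_mono[OF cut_var_le[OF \<rho> e, of m p], of "?f p"] u_nonneg by (simp add: abs_mult mult.assoc)
  qed
  have X_lim: "AE p in ?P. (\<lambda>m. near_var (\<rho> m) e p * ?d p) \<longlonglongrightarrow> near_dil e p * ?d p"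
    unfolding \<rho>_def by (intro AE_I2 tendsto_intros near_var_tendsto)
  have Y_lim: "AE p in ?P. (\<lambda>m. cut_var (\<rho> m) e p * ?f p) \<longlonglongrightarrow> cut_dil e p * ?f p"
    unfolding \<rho>_def by (intro AE_I2 tendsto_intros cut_var_tendsto)
  have [measurable]: "(\<lambda>p. near_dil e p * ?d p) \<in> borel_measurable ?P" "(\<lambda>p. near_var (\<rho> m) e p * ?d p) \<in> borel_measurable ?P"
    "(\<lambda>p. cut_dil e p * ?f p) \<in> borel_measurable ?P" "(\<lambda>p. cut_var (\<rho> m) e p * ?f p) \<in> borel_measurable ?P" for m
    by measurable
  show "integrable ?P (\<lambda>p. near_dil e p * ?d p)"
    by (rule integrable_dominated_convergence[OF _ _ wK X_lim X_dom]) measurable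
  show "integrable ?P (\<lambda>p. cut_dil e p * ?f p)"
    by (rule integrable_dominated_convergence[OF _ _ cK Y_lim Y_dom]) measurable
  have XI: "(\<lambda>m. \<integral>p. near_var (\<rho> m) e p * ?d p \<partial>?P) \<longlonglongrightarrow> (\<integral>p. near_dil e p * ?d p \<partial>?P)"
    by (rule integral_dominated_convergence[OF _ _ wK X_lim X_dom]) measurable
  have YI: "(\<lambda>m. \<integral>p. cut_var (\<rho> m) e p * ?f p \<partial>?P) \<longlonglongrightarrow> (\<integral>p. cut_dil e p * ?f p \<partial>?P)"
    by (rule integral_dominated_convergence[OF _ _ cK Y_lim Y_dom]) measurable
  have vI: "(\<lambda>m. \<integral>x. vfield_deriv (\<rho> m) e x * f x \<partial>lborel) \<longlonglongrightarrow> (\<integral>x. 1 * f x \<partial>lborel)" if f: "integrable lborel f" for f :: "'a \<Rightarrow> real"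
  proof (rule integral_dominated_convergence)
    have [measurable]: "f \<in> borel_measurable borel" using borel_measurable_integrable[OF f] by simp
    show "(\<lambda>x. 1 * f x) \<in> borel_measurable lborel" "(\<lambda>x. vfield_deriv (\<rho> m) e x * f x) \<in> borel_measurable lborel" for m
      by measurable
    show "integrable lborel (\<lambda>x. 5 * \<bar>f x\<bar>)" using f by simp
    show "AE x in lborel. (\<lambda>m. vfield_deriv (\<rho> m) e x * f x) \<longlonglongrightarrow> 1 * f x"
      unfolding \<rho>_def by (intro AE_I2 tendsto_intros vfield_deriv_tendsto)
    show "AE x in lborel. norm (vfield_deriv (\<rho> m) e x * f x) \<le> 5 * \<bar>f x\<bar>" for m
      using vfield_deriv_le[OF \<rho> e] by (intro AE_I2) (simp add: abs_mult mult_right_mono)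
  qed
  have "(\<lambda>m. c * ((\<integral>p. near_var (\<rho> m) e p * ?d p \<partial>?P) / 2 - (\<integral>p. cut_var (\<rho> m) e p * ?f p \<partial>?P))
      + b * (\<integral>x. vfield_deriv (\<rho> m) e x * (u x)\<^sup>2 \<partial>lborel) - 2 * k * (\<integral>x. vfield_deriv (\<rho> m) e x * entropy_fn (u x) \<partial>lborel))
    \<longlonglongrightarrow> c * ((\<integral>p. near_dil e p * ?d p \<partial>?P) / 2 - (\<integral>p. cut_dil e p * ?f p \<partial>?P))
      + b * (\<integral>x. 1 * (u x)\<^sup>2 \<partial>lborel) - 2 * k * (\<integral>x. 1 * entropy_fn (u x) \<partial>lborel)"
    by (intro tendsto_intros XI YI vI square_int entropy_fn_integrable) simp
  then have "(\<lambda>m::nat. 0::real) \<longlonglongrightarrow> c * ((\<integral>p. near_dil e p * ?d p \<partial>?P) / 2 - (\<integral>p. cut_dil e p * ?f p \<partial>?P))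
      + b * (\<integral>x. 1 * (u x)\<^sup>2 \<partial>lborel) - 2 * k * (\<integral>x. 1 * entropy_fn (u x) \<partial>lborel)"
    unfolding first_variation[OF \<rho> e] .
  then show "c * ((\<integral>p. near_dil e p * ?d p \<partial>?P) / 2 - (\<integral>p. cut_dil e p * ?f p \<partial>?P))
      + b * (\<integral>x. (u x)\<^sup>2 \<partial>lborel) - 2 * k * (\<integral>x. entropy_fn (u x) \<partial>lborel) = 0"
    using LIMSEQ_unique[OF tendsto_const] by fastforce
qed

theorem pohozaev_identity:
  "c * (real DIM('a) * unit_ball_vol DIM('a)) * (\<integral>x. (u x)\<^sup>2 \<partial>lborel) = k * real DIM('a) / 2 * (\<integral>x. (u x)\<^sup>2 \<partial>lborel)"
proof -
  let ?P = "lborel \<Otimes>\<^sub>M lborel :: ('a \<times> 'a) measure"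
  let ?d = "\<lambda>p. (u (fst p) - u (snd p)) * (u (fst p) - u (snd p))"
  let ?f = "\<lambda>p. u (snd p) * u (fst p)"
  let ?n = "real DIM('a)" and ?w = "unit_ball_vol DIM('a)"
  let ?i = "\<lambda>p. indicator (ball 0 1) (fst p - snd p) :: real"
  define U where "U = (\<integral>x. (u x)\<^sup>2 \<partial>lborel)"
  define H where "H = (\<integral>x. entropy_fn (u x) \<partial>lborel)"
  define D3 where "D3 = (\<integral>p. ?i p * ?f p \<partial>?P)"
  have [measurable]: "?i \<in> borel_measurable ?P"
    unfolding indicator_def mem_ball_0 by measurable
  have f_int: "integrable ?P (\<lambda>p. ?i p * ?f p)"
  proof (rule Bochner_Integration.integrable_bound)
    show "integrable ?P (\<lambda>p. ?i p * (u (fst p))\<^sup>2 + ?i p * (u (snd p))\<^sup>2)"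
      by (intro Bochner_Integration.integrable_add ball_square_integrable)
    show "AE p in ?P. norm (?i p * ?f p) \<le> norm (?i p * (u (fst p))\<^sup>2 + ?i p * (u (snd p))\<^sup>2)"
    proof (rule AE_I2)
      fix p :: "'a \<times> 'a"
      have nn: "0 \<le> ?f p" using u_nonneg by simp
      then have "?f p \<le> (u (fst p))\<^sup>2 + (u (snd p))\<^sup>2"
        using sum_squares_bound[of "u (fst p)" "u (snd p)"] by (simp add: mult_ac)
      then show "norm (?i p * ?f p) \<le> norm (?i p * (u (fst p))\<^sup>2 + ?i p * (u (snd p))\<^sup>2)"
        using nn by (auto split: split_indicator)
    qed
  qed measurable
  have d_eq: "?i p * ?d p = ?i p * (u (fst p))\<^sup>2 + ?i p * (u (snd p))\<^sup>2 - 2 * (?i p * ?f p)" for p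
    by (simp add: power2_eq_square algebra_simps)
  have d_int: "integrable ?P (\<lambda>p. ?i p * ?d p)"
    unfolding d_eq by (intro Bochner_Integration.integrable_add Bochner_Integration.integrable_diff integrable_mult_right ball_square_integrable f_int)
  have d_val: "(\<integral>p. ?i p * ?d p \<partial>?P) = 2 * (?w * U) - 2 * D3"
    unfolding d_eq using ball_square_integrable[of 1] f_int by (simp add: ball_square_integral U_def D3_def)
  have near_sum: "(\<Sum>e\<in>Basis. \<integral>p. near_dil e p * ?d p \<partial>?P) = ?n * (near_form u u - (2 * (?w * U) - 2 * D3))"
  proof -
    have "(\<Sum>e\<in>Basis. \<integral>p. near_dil e p * ?d p \<partial>?P) = (\<integral>p. (\<Sum>e\<in>Basis. near_dil e p * ?d p) \<partial>?P)"
      by (intro Bochner_Integration.integral_sum[symmetric] near_dil_integrable)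
    also have "\<dots> = (\<integral>p. ?n * (near_ker (fst p - snd p) * (u (fst p) - u (snd p)) * (u (fst p) - u (snd p)) - ?i p * ?d p) \<partial>?P)"
    proof (rule integral_cong_AE)
      show "AE p in ?P. (\<Sum>e\<in>Basis. near_dil e p * ?d p) = ?n * (near_ker (fst p - snd p) * (u (fst p) - u (snd p)) * (u (fst p) - u (snd p)) - ?i p * ?d p)"
        using AE_lborel_pair_norm_diff_neq[of 0] AE_lborel_pair_norm_diff_neq[of 1]
      proof eventually_elim
        case (elim p)
        show ?case
          unfolding sum_distrib_right[symmetric] sum_near_dil[OF elim] by (simp add: left_diff_distrib mult.assoc)
      qed
    qed measurable
    also have "\<dots> = ?n * (near_form u u - (\<integral>p. ?i p * ?d p \<partial>?P))"
      using near_energy_integrable d_int by (simp add: near_form_def)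
    finally show ?thesis by (simp only: d_val)
  qed
  have cut_sum: "(\<Sum>e\<in>Basis. \<integral>p. cut_dil e p * ?f p \<partial>?P) = ?n * (cut_form u u + D3)"
  proof -
    have "(\<Sum>e\<in>Basis. \<integral>p. cut_dil e p * ?f p \<partial>?P) = (\<integral>p. (\<Sum>e\<in>Basis. cut_dil e p * ?f p) \<partial>?P)"
      by (intro Bochner_Integration.integral_sum[symmetric] cut_dil_integrable)
    also have "\<dots> = (\<integral>p. ?n * (cut_ker 1 (fst p - snd p) * u (snd p) * u (fst p) + ?i p * ?f p) \<partial>?P)"
    proof (rule integral_cong_AE)
      show "AE p in ?P. (\<Sum>e\<in>Basis. cut_dil e p * ?f p) = ?n * (cut_ker 1 (fst p - snd p) * u (snd p) * u (fst p) + ?i p * ?f p)"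
        using AE_lborel_pair_norm_diff_neq[of 0] AE_lborel_pair_norm_diff_neq[of 1]
      proof eventually_elim
        case (elim p)
        show ?case
          unfolding sum_distrib_right[symmetric] sum_cut_dil[OF elim] by (simp add: distrib_right mult.assoc)
      qed
    qed measurable
    also have "\<dots> = ?n * (cut_form u u + D3)"
      using far_energy_integrable f_int by (simp add: cut_form_def D3_def)
    finally show ?thesis .
  qed
  have "(\<Sum>e\<in>(Basis::'a set). c * ((\<integral>p. near_dil e p * ?d p \<partial>?P) / 2 - (\<integral>p. cut_dil e p * ?f p \<partial>?P)) + b * U - 2 * k * H) = 0"
    unfolding U_def H_def by (intro sum.neutral ballI directional_identity)
  then have "c * ((\<Sum>e\<in>Basis. \<integral>p. near_dil e p * ?d p \<partial>?P) / 2 - (\<Sum>e\<in>Basis. \<integral>p. cut_dil e p * ?f p \<partial>?P)) + ?n * (b * U) - ?n * (2 * k * H) = 0"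
    by (simp add: sum_subtractf sum.distrib sum_divide_distrib[symmetric] sum_distrib_left[symmetric])
  then have "?n * (c * (near_form u u / 2 - cut_form u u) + b * U - 2 * k * H) = c * (?n * ?w) * U"
    unfolding near_sum cut_sum by (simp add: field_simps)
  moreover have "c * (near_form u u / 2 - cut_form u u) + b * U = k * (\<integral>x. (u x)\<^sup>2 * ln (u x) \<partial>lborel)"
    using energy_identity by (simp add: U_def)
  moreover have "2 * H = (\<integral>x. (u x)\<^sup>2 * ln (u x) \<partial>lborel) - U / 2"
    unfolding H_def U_def entropy_fn_def using square_int entropy_int by simp
  then have "2 * k * H = k * (\<integral>x. (u x)\<^sup>2 * ln (u x) \<partial>lborel) - k * U / 2"
    by (simp add: right_diff_distrib mult.assoc[symmetric] mult.commute[of 2 k] mult.assoc[of k 2 H])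
  ultimately show ?thesis
    by (auto simp: U_def[symmetric] mult_ac)
qed

lemma log_equation_trivial:
  assumes "c * (real DIM('a) * unit_ball_vol DIM('a)) \<noteq> k * real DIM('a) / 2"
  shows "u x = 0"
proof -
  have "(\<integral>x. (u x)\<^sup>2 \<partial>lborel) = 0"
    using pohozaev_identity assms by simp
  then have ae: "AE x in lborel. (u x)\<^sup>2 = 0"
    using integral_nonneg_eq_0_iff_AE[OF square_int] by simp
  show ?thesis
  proof (rule ccontr)
    assume "u x \<noteq> 0"
    have "open {x. u x \<noteq> 0}"
      using open_Collect_neq[OF cont continuous_on_const[of UNIV 0]] by simp
    then have "{x. u x \<noteq> 0} \<in> sets lborel" by simp
    moreover have "emeasure lborel {x. u x \<noteq> 0} = 0"
      using ae by (subst AE_iff_measurable[symmetric, OF \<open>{x. u x \<noteq> 0} \<in> sets lborel\<close>]) auto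
    ultimately have "{x. u x \<noteq> 0} \<in> null_sets lborel" by auto
    then have "negligible {x. u x \<noteq> 0}"
      by (simp add: negligible_iff_null_sets null_sets_completionI)
    then show False
      using open_not_negligible[OF \<open>open {x. u x \<noteq> 0}\<close>] \<open>u x \<noteq> 0\<close> by blast
  qed
qed

end

lemma log_lap_c_pos: "n > 0 \<Longrightarrow> log_lap_c n > 0"
  by (simp add: log_lap_c_def Gamma_real_pos)

lemma log_lap_c_times_area:
  assumes "n > 0"
  shows "log_lap_c n * (real n * unit_ball_vol (real n)) = 2"
proof -
  have rec: "Gamma (real n / 2 + 1) = real n / 2 * Gamma (real n / 2)"
    by (rule Gamma_plus1) (use assms in \<open>auto elim!: nonpos_Ints_cases\<close>)
  have G: "Gamma (real n / 2) \<noteq> 0"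
    by (rule less_imp_neq[symmetric], rule Gamma_real_pos) (use assms in simp)
  have one: "pi powr (- (real n / 2)) * pi powr (real n / 2) = 1"
    by (simp flip: powr_add)
  have "log_lap_c n * (real n * unit_ball_vol (real n)) =
      (pi powr (- (real n / 2)) * pi powr (real n / 2)) * (real n * Gamma (real n / 2) / Gamma (real n / 2 + 1))"
    by (simp add: log_lap_c_def unit_ball_vol_def)
  also have "\<dots> = 2"
    unfolding one rec using assms G by simp
  finally show ?thesis .
qed

theorem theorem1p2:
  fixes u :: "real ^ 'n \<Rightarrow> real" and k :: real
  assumes "k > 0"
    and "u \<in> L2_functions \<inter> dini_functions"
    and "integrable lebesgue (\<lambda>x. (u x)\<^sup>2 * ln (u x))"
    and "\<forall>x. log_laplacian u x = k * (u x * ln (u x))"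
    and "\<forall>x. u x \<ge> 0"
    and "k \<noteq> 4 / real CARD('n)"
  shows "\<forall>x. u x = 0"
proof -
  let ?n = "DIM(real ^ 'n)"
  let ?c = "log_lap_c ?n"
  have n: "?n > 0" by (rule DIM_positive)
  have cont: "continuous_on UNIV u" by (rule continuous_on_L2_dini[OF assms(2)])
  then have [measurable]: "u \<in> borel_measurable borel" by (rule borel_measurable_continuous_onI)
  interpret log_equation_entropy u k ?c "log_lap_rho ?n + ?c * unit_ball_vol ?n"
  proof
    show "integrable lborel (\<lambda>x. (u x)\<^sup>2 * ln (u x))"
      using assms(3) by (subst (asm) integrable_completion) auto
    show "?c > 0" using n by (rule log_lap_c_pos)
  qed (use assms cont integrable_L2_dini_square[OF assms(2)] integrable_near_ker_dini[OF assms(2)]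
      log_laplacian_kernel_form[OF assms(2), symmetric] in auto)
  have "k * real CARD('n) \<noteq> 4"
    using assms(6) by (auto simp: field_simps)
  then have "?c * (real ?n * unit_ball_vol ?n) \<noteq> k * real ?n / 2"
    unfolding log_lap_c_times_area[OF n] by auto
  then show ?thesis using log_equation_trivial by blast
qed

end
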